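(* Let $n\ge 3$, let $\alpha=2k\in(0,n)$ be an even integer ($k\ge1$ an integer), let $p,q>1$ and $\sigma_1,\sigma_2\in[0,\alpha)$. Then the system of differential equations $$(-\Delta)^{k}u(x)=c_1(x)\frac{v(x)^q}{|x|^{\sigma_1}},\qquad (-\Delta)^{k}v(x)=c_2(x)\frac{u(x)^p}{|x|^{\sigma_2}}\qquad\text{in }\mathbb{R}^n\setminus\{0\}$$ admits a positive solution $(u,v)$ for some double bounded functions $c_1(x)$ and $c_2(x)$ if and only if $$\max\left\{\frac{2k(q+1)-(\sigma_1+\sigma_2 q)}{pq-1},\ \frac{2k(p+1)-(\sigma_2+\sigma_1 p)}{pq-1}\right\}<n-2k.$$
   Context: A function $c:\mathbb{R}^n\to\mathbb{R}$ is double bounded if there exists $C>0$ such that $1/C\le c(x)\le C$ for all $x\in\mathbb{R}^n$. A positive solution means a classical solution $(u,v)$ with positive components in $C^{2k}(\mathbb{R}^n\setminus\{0\})\cap C(\mathbb{R}^n)$ satisfying the system pointwise except at the origin. *)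

theory Defs
  imports "HOL-Analysis.Analysis"
begin

definition partial_derivative :: "'a::euclidean_space \<Rightarrow> ('a \<Rightarrow> real) \<Rightarrow> 'a \<Rightarrow> real" where
  "partial_derivative b f x = frechet_derivative f (at x) b"

text \<open>
  The space \<open>C^m(S)\<close>, meant for open \<open>S\<close>: the derivative is the one with respect to the
  full neighbourhood filter \<open>at x\<close>. Requiring Frechet differentiability rather than mere
  existence of partial derivatives is no restriction, since the partial derivatives are
  required to be continuous.
\<close>

fun C_on :: "nat \<Rightarrow> 'a::euclidean_space set \<Rightarrow> ('a \<Rightarrow> real) \<Rightarrow> bool" where
  "C_on 0 S f \<longleftrightarrow> continuous_on S f"
| "C_on (Suc m) S f \<longleftrightarrow>
     (\<forall>x\<in>S. f differentiable (at x)) \<and> (\<forall>b\<in>Basis. C_on m S (partial_derivative b f))"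

definition laplacian :: "('a::euclidean_space \<Rightarrow> real) \<Rightarrow> 'a \<Rightarrow> real" where
  "laplacian f x = (\<Sum>b\<in>Basis. partial_derivative b (partial_derivative b f) x)"

definition neg_laplacian_pow :: "nat \<Rightarrow> ('a::euclidean_space \<Rightarrow> real) \<Rightarrow> 'a \<Rightarrow> real" where
  "neg_laplacian_pow k = (\<lambda>f x. - laplacian f x) ^^ k"

definition double_bounded :: "('a \<Rightarrow> real) \<Rightarrow> bool" where
  "double_bounded c \<longleftrightarrow> (\<exists>C>0. \<forall>x. 1 / C \<le> c x \<and> c x \<le> C)"

definition positive_solution ::
  "nat \<Rightarrow> real \<Rightarrow> real \<Rightarrow> real \<Rightarrow> real \<Rightarrow> ('a::euclidean_space \<Rightarrow> real) \<Rightarrow> ('a \<Rightarrow> real) \<Rightarrow>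
    ('a \<Rightarrow> real) \<Rightarrow> ('a \<Rightarrow> real) \<Rightarrow> bool" where
  "positive_solution k p q \<sigma>\<^sub>1 \<sigma>\<^sub>2 c\<^sub>1 c\<^sub>2 u v \<longleftrightarrow>
     (\<forall>x. u x > 0) \<and> (\<forall>x. v x > 0) \<and>
     C_on (2 * k) (- {0}) u \<and> continuous_on UNIV u \<and>
     C_on (2 * k) (- {0}) v \<and> continuous_on UNIV v \<and>
     (\<forall>x. x \<noteq> 0 \<longrightarrow>
        neg_laplacian_pow k u x = c\<^sub>1 x * (v x powr q / norm x powr \<sigma>\<^sub>1) \<and>
        neg_laplacian_pow k v x = c\<^sub>2 x * (u x powr p / norm x powr \<sigma>\<^sub>2))"

end

theory Submission
  imports Defs "HOL-Computational_Algebra.Polynomial"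
begin

text \<open>
  Both directions rest on explicit radial functions \<open>g (|x|\<^sup>2)\<close>, on which the operator \<open>-\<Delta>\<close> becomes
  the ordinary differential operator \<open>g \<mapsto> -(4 t g'' + 2 n g')\<close>, \<open>t = |x|\<^sup>2\<close>.

  Necessity is a test function argument. The functions \<open>W (|x|\<^sup>2 / S) - W (|x|\<^sup>2 / \<epsilon>)\<close>, where \<open>W\<close> drops
  from \<open>1\<close> to \<open>0\<close> on \<open>[1,2]\<close>, are supported in an annulus, so \<open>(-\<Delta>)\<^sup>k\<close> can be moved from \<open>u\<close> onto
  them. The contribution of the inner edge is of order \<open>\<epsilon>\<close> to the power \<open>n/2 - k > 0\<close>, because \<open>u\<close> is
  bounded near the origin; this is where \<open>2k < n\<close> makes the origin removable. As \<open>\<epsilon>\<close> tends to \<open>0\<close>, only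
  the outer annulus \<open>S \<le> |x|\<^sup>2 \<le> 2S\<close> remains (\<open>test_inequality\<close>), and Jensen's inequality there
  bounds a power of the mass of \<open>v\<^sup>q / |x|\<^bsup>\<sigma>1\<^esup>\<close> in \<open>1 \<le> |x|\<^sup>2 \<le> 2S\<close> by the mass of \<open>u\<^sup>p / |x|\<^bsup>\<sigma>2\<^esup>\<close> in
  the annulus times a power of \<open>S\<close> (\<open>power_inequality\<close>). Combining this with the same bound for the
  other equation gives \<open>X(S)\<^bsup>pq\<^esup> \<le> C S\<^sup>e x(S)\<close>, with \<open>X\<close> the total mass and \<open>x\<close> its part
  in the annulus, and the exponent satisfies \<open>e \<le> 0\<close> exactly when the first term of the maximum is at least
  \<open>n - 2k\<close>. Since \<open>x(S)\<close> is bounded by \<open>X(2S) - X(S/2)\<close>, such an inequality makes \<open>X\<close> bounded and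
  unbounded at once (\<open>mass_superlinear_growth_impossible\<close>). The second term of
  the maximum is treated by exchanging the two equations.

  For sufficiency let \<open>a\<close> and \<open>b\<close> be the two terms of the maximum. They solve the scaling relations
  \<open>a + 2k = \<sigma>1 + q b\<close> and \<open>b + 2k = \<sigma>2 + p a\<close>, so it suffices to have positive \<open>u\<close> and \<open>v\<close> comparable to
  \<open>(1 + |x|)\<^bsup>-a\<^esup>\<close> and \<open>(1 + |x|)\<^bsup>-b\<^esup>\<close> for which \<open>(-\<Delta>)\<^sup>k u\<close> is comparable to
  \<open>|x|\<^bsup>-\<sigma>1\<^esup> (1 + |x|)\<^bsup>\<sigma>1 - a - 2k\<^esup>\<close> and similarly for \<open>v\<close> (\<open>profile_exists\<close>); the coefficients are then
  defined as quotients. Such functions are \<open>(1 + |x|\<^sup>2)\<^bsup>-a/2\<^esup>\<close> plus, if \<open>\<sigma>1 > 0\<close>, a superposition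
  \<open>\<integral>\<^sub>0\<^sup>1 (z / (z + |x|\<^sup>2))\<^sup>M dt\<close> with \<open>M = n/2 - k\<close> and \<open>z\<close> a power of \<open>t\<close>, which produces the
  singularity of \<open>(-\<Delta>)\<^sup>k u\<close> at the origin. Positivity comes from the closed formula for
  \<open>(-\<Delta>)\<^sup>k (z + |x|\<^sup>2)\<^bsup>-s\<^esup>\<close>, whose coefficients are products of Pochhammer symbols that are nonnegative for
  \<open>s \<le> n/2 - k\<close>.
\<close>

section \<open>Calculus of continuously differentiable functions\<close>

lemma partial_derivative_eqI:
  assumes "(f has_derivative f') (at x)"
  shows "partial_derivative b f x = f' b"
  using frechet_derivative_at[OF assms] by (simp add: partial_derivative_def)

lemma partial_derivative_cong_open:
  assumes "open S" "x \<in> S" "\<And>y. y \<in> S \<Longrightarrow> f y = g y"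
  shows "partial_derivative b f x = partial_derivative b g x"
proof -
  have "(f has_derivative D) (at x) \<longleftrightarrow> (g has_derivative D) (at x)" for D
    using has_derivative_transform_within_open[of f D x UNIV S g]
      has_derivative_transform_within_open[of g D x UNIV S f] assms by auto
  then show ?thesis by (simp add: partial_derivative_def frechet_derivative_def)
qed

lemma differentiable_cong_open:
  assumes "open S" "x \<in> S" "\<And>y. y \<in> S \<Longrightarrow> f y = g y" "f differentiable (at x)"
  shows "g differentiable (at x)"
  using assms has_derivative_transform_within_open[of f _ x UNIV S g]
  unfolding differentiable_def by blast

lemma laplacian_cong_open:
  assumes "open S" "x \<in> S" "\<And>y. y \<in> S \<Longrightarrow> f y = g y"
  shows "laplacian f x = laplacian g x"
  unfolding laplacian_def
  by (intro sum.cong refl partial_derivative_cong_open[OF assms(1,2)])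
     (rule partial_derivative_cong_open[OF assms(1)], use assms in auto)

lemma neg_laplacian_pow_0 [simp]: "neg_laplacian_pow 0 f = f"
  by (simp add: neg_laplacian_pow_def)

lemma neg_laplacian_pow_Suc:
  "neg_laplacian_pow (Suc k) f = (\<lambda>x. - laplacian (neg_laplacian_pow k f) x)"
  by (simp add: neg_laplacian_pow_def)

lemma neg_laplacian_pow_Suc':
  "neg_laplacian_pow (Suc k) f = neg_laplacian_pow k (\<lambda>x. - laplacian f x)"
  unfolding neg_laplacian_pow_def by (subst funpow_Suc_right) simp

lemma C_on_cong:
  assumes "open S" "\<And>x. x \<in> S \<Longrightarrow> f x = g x" "C_on m S f"
  shows "C_on m S g"
  using assms(2,3)
proof (induction m arbitrary: f g)
  case 0
  then show ?case using continuous_on_eq by auto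
next
  case (Suc m)
  have "C_on m S (partial_derivative b g)" if "b \<in> Basis" for b
    by (rule Suc.IH[of "partial_derivative b f"],
        rule partial_derivative_cong_open[OF \<open>open S\<close>]) (use Suc.prems that in auto)
  moreover have "g differentiable (at x)" if "x \<in> S" for x
    by (rule differentiable_cong_open[OF \<open>open S\<close> that Suc.prems(1)]) (use Suc.prems that in auto)
  ultimately show ?case by auto
qed

lemma C_on_imp_continuous_on:
  "C_on m S f \<Longrightarrow> continuous_on S f"
  by (cases m) (auto intro!: continuous_at_imp_continuous_on differentiable_imp_continuous_within)

lemma C_on_SucD: "C_on (Suc m) S f \<Longrightarrow> C_on m S f"
proof (induction m arbitrary: f)
  case 0 then show ?case using C_on_imp_continuous_on[of "Suc 0"] by (simp del: C_on.simps(2))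
next
  case (Suc m)
  have "C_on m S (partial_derivative b f)" if "b \<in> Basis" for b
    using Suc that by (metis C_on.simps(2))
  then show ?case using Suc.prems by (metis C_on.simps(2))
qed

lemma C_on_mono: "C_on m S f \<Longrightarrow> l \<le> m \<Longrightarrow> C_on l S f"
  by (induction m) (auto simp: le_Suc_eq simp del: C_on.simps(2) dest: C_on_SucD)

lemma partial_derivative_add:
  assumes "f differentiable (at x)" "g differentiable (at x)"
  shows "partial_derivative b (\<lambda>x. f x + g x) x = partial_derivative b f x + partial_derivative b g x"
proof -
  from assms obtain D E where "(f has_derivative D) (at x)" "(g has_derivative E) (at x)"
    unfolding differentiable_def by blast
  then show ?thesis
    using has_derivative_add[of f D "at x" g E, THEN partial_derivative_eqI[where b=b]]
    by (simp add: partial_derivative_eqI)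
qed

lemma partial_derivative_cmult:
  assumes "f differentiable (at x)"
  shows "partial_derivative b (\<lambda>x. c * f x) x = c * partial_derivative b f x"
proof -
  from assms obtain D where "(f has_derivative D) (at x)"
    unfolding differentiable_def by blast
  then show ?thesis
    using has_derivative_mult_right[of f D "at x" c, THEN partial_derivative_eqI[where b=b]]
    by (simp add: partial_derivative_eqI)
qed

lemma partial_derivative_mult:
  assumes "f differentiable (at x)" "g differentiable (at x)"
  shows "partial_derivative b (\<lambda>x. f x * g x) x =
    f x * partial_derivative b g x + partial_derivative b f x * g x"
proof -
  from assms obtain D E where "(f has_derivative D) (at x)" "(g has_derivative E) (at x)"
    unfolding differentiable_def by blast
  then show ?thesis
    using has_derivative_mult[of f D x UNIV g E, THEN partial_derivative_eqI[where b=b]]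
    by (simp add: partial_derivative_eqI)
qed

lemma C_on_add:
  assumes "open S" "C_on m S f" "C_on m S g"
  shows "C_on m S (\<lambda>x. f x + g x)"
  using assms(2,3)
proof (induction m arbitrary: f g)
  case 0 then show ?case by (auto intro: continuous_intros)
next
  case (Suc m)
  have "C_on m S (partial_derivative b (\<lambda>x. f x + g x))" if "b \<in> Basis" for b
    by (rule C_on_cong[OF \<open>open S\<close> _ Suc.IH[of "partial_derivative b f" "partial_derivative b g"]])
       (use Suc.prems that in \<open>auto simp: partial_derivative_add\<close>)
  then show ?case using Suc.prems by auto
qed

lemma C_on_cmult:
  assumes "open S" "C_on m S f"
  shows "C_on m S (\<lambda>x. c * f x)"
  using assms(2)
proof (induction m arbitrary: f)
  case 0 then show ?case by (auto intro: continuous_intros)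
next
  case (Suc m)
  have "C_on m S (partial_derivative b (\<lambda>x. c * f x))" if "b \<in> Basis" for b
    by (rule C_on_cong[OF \<open>open S\<close> _ Suc.IH[of "partial_derivative b f"]])
       (use Suc.prems that in \<open>auto simp: partial_derivative_cmult\<close>)
  then show ?case using Suc.prems by auto
qed

lemma C_on_mult:
  assumes "open S" "C_on m S f" "C_on m S g"
  shows "C_on m S (\<lambda>x. f x * g x)"
  using assms(2,3)
proof (induction m arbitrary: f g)
  case 0 then show ?case by (auto intro: continuous_intros)
next
  case (Suc m)
  note fg = C_on_SucD[OF Suc.prems(1)] C_on_SucD[OF Suc.prems(2)]
  have "C_on m S (partial_derivative b (\<lambda>x. f x * g x))" if "b \<in> Basis" for b
  proof (rule C_on_cong[OF \<open>open S\<close> _ C_on_add[OF \<open>open S\<close> Suc.IH[of f "partial_derivative b g"]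
            Suc.IH[of "partial_derivative b f" g]]])
  qed (use Suc.prems fg that in \<open>auto simp: partial_derivative_mult\<close>)
  then show ?case using Suc.prems by auto
qed

lemma C_on_const:
  assumes "open S" shows "C_on m S (\<lambda>x. c)"
proof (induction m arbitrary: c)
  case (Suc m)
  have "C_on m S (partial_derivative b (\<lambda>x. c))" for b
    by (rule C_on_cong[OF assms _ Suc.IH[of 0]]) (simp add: partial_derivative_def)
  then show ?case by simp
qed simp

lemma C_on_sum:
  assumes "open S" "finite B" "\<And>b. b \<in> B \<Longrightarrow> C_on m S (f b)"
  shows "C_on m S (\<lambda>x. \<Sum>b\<in>B. f b x)"
  using assms(2,3)
  by (induction B rule: finite_induct) (simp_all add: C_on_add C_on_const assms(1))

lemma C_on_inner:
  assumes "open S" shows "C_on m S (\<lambda>x. x \<bullet> b)"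
proof (cases m)
  case (Suc l)
  have "((\<lambda>x. x \<bullet> b) has_derivative (\<lambda>h. h \<bullet> b)) (at x)" for x
    by (auto intro!: derivative_eq_intros)
  then have d: "(\<lambda>x. x \<bullet> b) differentiable (at x)"
    "partial_derivative a (\<lambda>x. x \<bullet> b) x = a \<bullet> b" for a x
    by (auto simp: differentiable_def intro: partial_derivative_eqI[of _ "\<lambda>h. h \<bullet> b"])
  have "C_on l S (partial_derivative a (\<lambda>x. x \<bullet> b))" for a
    by (rule C_on_cong[OF assms _ C_on_const[OF assms, of l "a \<bullet> b"]]) (simp add: d)
  with d show ?thesis using Suc by simp
qed (auto intro: continuous_intros)

lemma C_on_neg_laplacian:
  assumes "open S" "C_on (Suc (Suc m)) S f"
  shows "C_on m S (\<lambda>x. - laplacian f x)"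
proof -
  have "C_on m S (\<lambda>x. \<Sum>b\<in>Basis. partial_derivative b (partial_derivative b f) x)"
    using assms by (intro C_on_sum) auto
  from C_on_cmult[OF assms(1) this, of "-1"] show ?thesis by (simp add: laplacian_def)
qed

lemma C_on_neg_laplacian_pow:
  assumes "open S" "C_on (2 * k + m) S f"
  shows "C_on m S (neg_laplacian_pow k f)"
  using assms(2)
proof (induction k arbitrary: m)
  case (Suc k)
  then show ?case using C_on_neg_laplacian[OF assms(1) Suc.IH[of "Suc (Suc m)"]]
    by (simp add: neg_laplacian_pow_Suc del: C_on.simps(2))
qed simp

lemma laplacian_add:
  assumes "open S" "x \<in> S" "C_on 2 S f" "C_on 2 S g"
  shows "laplacian (\<lambda>x. f x + g x) x = laplacian f x + laplacian g x"
proof -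
  have *: "partial_derivative b (partial_derivative b (\<lambda>x. f x + g x)) x =
      partial_derivative b (partial_derivative b f) x + partial_derivative b (partial_derivative b g) x"
    if "b \<in> Basis" for b
  proof -
    have "partial_derivative b (partial_derivative b (\<lambda>x. f x + g x)) x
        = partial_derivative b (\<lambda>x. partial_derivative b f x + partial_derivative b g x) x"
      using assms by (intro partial_derivative_cong_open[OF assms(1,2)] partial_derivative_add)
        (auto simp: numeral_2_eq_2)
    also have "\<dots> = partial_derivative b (partial_derivative b f) x + partial_derivative b (partial_derivative b g) x"
      using assms that by (intro partial_derivative_add) (auto simp: numeral_2_eq_2)
    finally show ?thesis .
  qed
  show ?thesis unfolding laplacian_def sum.distrib[symmetric] by (rule sum.cong[OF refl *])
qed

lemma neg_laplacian_pow_cong_open: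
  assumes "open S" "x \<in> S" "\<And>y. y \<in> S \<Longrightarrow> f y = g y"
  shows "neg_laplacian_pow k f x = neg_laplacian_pow k g x"
  using assms(2)
proof (induction k arbitrary: x)
  case (Suc k)
  then show ?case
    using laplacian_cong_open[OF assms(1) Suc.prems, of "neg_laplacian_pow k f" "neg_laplacian_pow k g"]
    by (simp add: neg_laplacian_pow_Suc)
qed (use assms in simp)

lemma neg_laplacian_pow_add:
  assumes "open S" "x \<in> S" "C_on (2 * k) S f" "C_on (2 * k) S g"
  shows "neg_laplacian_pow k (\<lambda>x. f x + g x) x = neg_laplacian_pow k f x + neg_laplacian_pow k g x"
  using assms(2-4)
proof (induction k arbitrary: x)
  case (Suc k)
  have C: "C_on 2 S (neg_laplacian_pow k f)" "C_on 2 S (neg_laplacian_pow k g)"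
    using Suc.prems assms(1) C_on_neg_laplacian_pow[of S k 2] by (simp_all del: C_on.simps(2))
  have C': "C_on (2 * k) S f" "C_on (2 * k) S g" using Suc.prems C_on_mono[of "2 * Suc k" S _ "2*k"] by auto
  have "laplacian (neg_laplacian_pow k (\<lambda>x. f x + g x)) x =
     laplacian (\<lambda>x. neg_laplacian_pow k f x + neg_laplacian_pow k g x) x"
    using Suc.IH C' Suc.prems by (intro laplacian_cong_open[OF assms(1)]) auto
  also have "\<dots> = laplacian (neg_laplacian_pow k f) x + laplacian (neg_laplacian_pow k g) x"
    using C Suc.prems by (intro laplacian_add[OF assms(1)]) auto
  finally show ?case by (simp add: neg_laplacian_pow_Suc)
qed simp

section \<open>Radial functions\<close>

text \<open>
  The successive derivatives are carried along as an explicit sequence: \<open>radial_op\<close> below then maps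
  sequences to sequences by a closed formula and can be iterated without forming derivatives of
  derivatives.
\<close>

definition deriv_seq :: "nat \<Rightarrow> real set \<Rightarrow> (nat \<Rightarrow> real \<Rightarrow> real) \<Rightarrow> bool" where
  "deriv_seq N T G \<longleftrightarrow>
     (\<forall>i<N. \<forall>t\<in>T. (G i has_real_derivative G (Suc i) t) (at t)) \<and> continuous_on T (G N)"

text \<open>
  The \<open>i\<close>-th derivative of \<open>-(4 t g'' + 2 n g')\<close> in terms of the derivatives \<open>G\<close> of \<open>g\<close>; the summand
  \<open>4 i\<close> is the Leibniz term from differentiating the factor \<open>t\<close>.
\<close>

definition radial_op :: "nat \<Rightarrow> (nat \<Rightarrow> real \<Rightarrow> real) \<Rightarrow> nat \<Rightarrow> real \<Rightarrow> real" where
  "radial_op n G i t = - (4 * t * G (i + 2) t + (4 * real i + 2 * real n) * G (i + 1) t)"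

lemma deriv_seq_continuous_on:
  assumes "deriv_seq N T G" "i \<le> N" shows "continuous_on T (G i)"
  using assms unfolding deriv_seq_def
  by (cases "i = N") (auto intro!: continuous_at_imp_continuous_on DERIV_isCont[of "G i" "G (Suc i) x" x for x])

lemma deriv_seq_shift: "deriv_seq (Suc N) T G \<Longrightarrow> deriv_seq N T (\<lambda>i. G (Suc i))"
  by (simp add: deriv_seq_def)

lemma deriv_seq_radial_op:
  assumes "deriv_seq (N + 2) T G" shows "deriv_seq N T (radial_op n G)"
proof -
  have "(radial_op n G i has_real_derivative radial_op n G (Suc i) t) (at t)"
    if "i < N" "t \<in> T" for i t
  proof -
    have d: "(G (Suc i) has_real_derivative G (Suc (Suc i)) t) (at t)"
      "(G (Suc (Suc i)) has_real_derivative G (Suc (Suc (Suc i))) t) (at t)"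
      using assms that by (auto simp: deriv_seq_def)
    show ?thesis unfolding radial_op_def[abs_def]
      by (auto intro!: derivative_eq_intros d[THEN DERIV_cong] simp: algebra_simps)
  qed
  moreover have "continuous_on T (radial_op n G N)"
    unfolding radial_op_def[abs_def]
    by (intro continuous_intros deriv_seq_continuous_on[OF assms]) auto
  ultimately show ?thesis by (simp add: deriv_seq_def)
qed

lemma has_derivative_radial:
  fixes x :: "'a::euclidean_space"
  assumes "(g has_real_derivative d) (at (x \<bullet> x))"
  shows "((\<lambda>x. g (x \<bullet> x)) has_derivative (\<lambda>h. 2 * (x \<bullet> h) * d)) (at x)"
proof -
  have "((\<lambda>x. x \<bullet> x) has_derivative (\<lambda>h. 2 * (x \<bullet> h))) (at x)"
    by (auto intro!: derivative_eq_intros simp: inner_commute)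
  from has_derivative_compose[OF this assms[unfolded has_field_derivative_def]]
  show ?thesis by (simp add: mult.commute o_def)
qed

lemma open_radial: "open T \<Longrightarrow> open {x::'a::euclidean_space. x \<bullet> x \<in> T}"
  using open_vimage[of T "\<lambda>x::'a. x \<bullet> x"] by (simp add: vimage_def continuous_on_inner)

lemma C_on_radial:
  assumes "open T" "deriv_seq m T G"
  shows "C_on m {x::'a::euclidean_space. x \<bullet> x \<in> T} (\<lambda>x. G 0 (x \<bullet> x))"
  using assms(2)
proof (induction m arbitrary: G)
  case 0
  then show ?case
    by (auto simp: deriv_seq_def intro!: continuous_on_compose2[of T "G 0"] continuous_intros)
next
  case (Suc m)
  let ?S = "{x::'a. x \<bullet> x \<in> T}"
  have o: "open ?S" using open_radial[OF assms(1)] .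
  have d: "((\<lambda>x. G 0 (x \<bullet> x)) has_derivative (\<lambda>h. 2 * (x \<bullet> h) * G 1 (x \<bullet> x))) (at x)"
    if "x \<in> ?S" for x
    using Suc.prems that by (intro has_derivative_radial) (auto simp: deriv_seq_def)
  have "C_on m ?S (partial_derivative b (\<lambda>x. G 0 (x \<bullet> x)))" for b
  proof (rule C_on_cong[OF o])
    show "C_on m ?S (\<lambda>x. (2 * (x \<bullet> b)) * G 1 (x \<bullet> x))"
      using Suc.IH[OF deriv_seq_shift[OF Suc.prems]]
      by (intro C_on_mult C_on_cmult C_on_inner o) auto
    show "2 * (x \<bullet> b) * G 1 (x \<bullet> x) = partial_derivative b (\<lambda>x. G 0 (x \<bullet> x)) x" if "x \<in> ?S" for x
      using partial_derivative_eqI[OF d[OF that]] by simp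
  qed
  then show ?case using d by (auto simp: differentiable_def)
qed

text \<open>
  By the chain rule, the second derivative of \<open>g (|x|\<^sup>2)\<close> in a basis direction \<open>b\<close> is
  \<open>2 g' + 4 (x \<bullet> b)\<^sup>2 g''\<close>; summing over the basis turns \<open>(x \<bullet> b)\<^sup>2\<close> into \<open>|x|\<^sup>2\<close>.
\<close>

lemma neg_laplacian_radial:
  fixes x :: "'a::euclidean_space"
  assumes "open T" "deriv_seq 2 T G" "x \<bullet> x \<in> T"
  shows "- laplacian (\<lambda>x. G 0 (x \<bullet> x)) x = radial_op DIM('a) G 0 (x \<bullet> x)"
proof -
  let ?S = "{x::'a. x \<bullet> x \<in> T}"
  have G: "(G 0 has_real_derivative G 1 t) (at t)" "(G 1 has_real_derivative G 2 t) (at t)"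
    if "t \<in> T" for t using assms that by (auto simp: deriv_seq_def numeral_2_eq_2)
  have "partial_derivative b (partial_derivative b (\<lambda>x. G 0 (x \<bullet> x))) x =
     2 * G 1 (x \<bullet> x) + 4 * ((x \<bullet> b) * (x \<bullet> b)) * G 2 (x \<bullet> x)" if "b \<in> Basis" for b
  proof -
    have "partial_derivative b (partial_derivative b (\<lambda>x. G 0 (x \<bullet> x))) x =
        partial_derivative b (\<lambda>x. 2 * (x \<bullet> b) * G 1 (x \<bullet> x)) x"
      using assms by (intro partial_derivative_cong_open[OF open_radial[OF assms(1)]]
          partial_derivative_eqI has_derivative_radial G) auto
    also have "\<dots> = 2 * (b \<bullet> b) * G 1 (x \<bullet> x) + 2 * (x \<bullet> b) * (2 * (x \<bullet> b) * G 2 (x \<bullet> x))"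
      by (rule partial_derivative_eqI[where b=b and f'="\<lambda>h. 2 * (h \<bullet> b) * G 1 (x \<bullet> x) +
            2 * (x \<bullet> b) * (2 * (x \<bullet> h) * G 2 (x \<bullet> x))"])
         (rule derivative_eq_intros has_derivative_radial[OF G(2)[OF assms(3)]] refl
           | simp add: algebra_simps fun_eq_iff)+
    finally show ?thesis using that by simp
  qed
  then have "laplacian (\<lambda>x. G 0 (x \<bullet> x)) x =
      (\<Sum>b\<in>(Basis::'a set). 2 * G 1 (x \<bullet> x)) + (\<Sum>b\<in>Basis. 4 * ((x \<bullet> b) * (x \<bullet> b)) * G 2 (x \<bullet> x))"
    unfolding laplacian_def sum.distrib[symmetric] by (intro sum.cong) auto
  also have "(\<Sum>b\<in>(Basis::'a set). 4 * ((x \<bullet> b) * (x \<bullet> b)) * G 2 (x \<bullet> x)) = 4 * (x \<bullet> x) * G 2 (x \<bullet> x)"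
    by (simp add: euclidean_inner[of x x] sum_distrib_left sum_distrib_right)
  finally show ?thesis by (simp add: radial_op_def algebra_simps numeral_2_eq_2)
qed

lemma neg_laplacian_pow_radial:
  fixes x :: "'a::euclidean_space"
  assumes "open T" "deriv_seq (2 * k) T G" "x \<bullet> x \<in> T"
  shows "neg_laplacian_pow k (\<lambda>x. G 0 (x \<bullet> x)) x = (radial_op DIM('a) ^^ k) G 0 (x \<bullet> x)"
  using assms(2,3)
proof (induction k arbitrary: G x)
  case (Suc k)
  have ds: "deriv_seq (2 * k) T (radial_op DIM('a) G)"
    using Suc.prems by (intro deriv_seq_radial_op) simp
  have d2: "deriv_seq 2 T G"
    using Suc.prems(1) deriv_seq_continuous_on[OF Suc.prems(1), of 2] by (auto simp: deriv_seq_def)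
  have "neg_laplacian_pow (Suc k) (\<lambda>x. G 0 (x \<bullet> x)) x =
      neg_laplacian_pow k (\<lambda>x. radial_op DIM('a) G 0 (x \<bullet> x)) x"
    unfolding neg_laplacian_pow_Suc'
    by (rule neg_laplacian_pow_cong_open[OF open_radial[OF assms(1)]])
       (use Suc.prems neg_laplacian_radial[OF assms(1) d2] in auto)
  also have "\<dots> = (radial_op DIM('a) ^^ Suc k) G 0 (x \<bullet> x)"
    using Suc.IH[OF ds Suc.prems(2)] by (simp add: funpow_swap1)
  finally show ?case .
qed simp

section \<open>Integration by parts\<close>

lemma C_on_Un_open:
  assumes "open S" "open T" "C_on m S f" "C_on m T f"
  shows "C_on m (S \<union> T) f"
  using assms(3,4)
proof (induction m arbitrary: f)
  case 0 then show ?case using continuous_on_open_Un[OF assms(1,2)] by simp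
qed auto

lemma C_on_subset: "C_on m S f \<Longrightarrow> T \<subseteq> S \<Longrightarrow> C_on m T f"
  by (induction m arbitrary: f) (auto intro: continuous_on_subset)

text \<open>
  Together, the open sets \<open>S\<close> and \<open>- K\<close> cover the space. This allows products of a test function with a
  solution that is smooth only away from the origin.
\<close>

lemma C_on_extend_zero:
  assumes "open S" "closed K" "K \<subseteq> S" "C_on m S f" "\<And>x. x \<notin> K \<Longrightarrow> f x = 0"
  shows "C_on m UNIV f"
proof -
  have "C_on m (- K) f"
    using assms by (intro C_on_cong[OF _ _ C_on_const[of "-K" m 0]]) auto
  then have "C_on m (S \<union> - K) f" using assms by (intro C_on_Un_open) auto
  moreover have "S \<union> - K = UNIV" using assms by auto
  ultimately show ?thesis by simp
qed

lemma partial_derivative_eq_0_off: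
  assumes "closed K" "\<And>x. x \<notin> K \<Longrightarrow> f x = 0" "x \<notin> K"
  shows "partial_derivative b f x = 0"
  using partial_derivative_cong_open[of "- K" x f "\<lambda>_. 0" b] assms
  by (auto simp: partial_derivative_def)

lemma laplacian_eq_0_off:
  assumes "closed K" "\<And>x. x \<notin> K \<Longrightarrow> f x = 0" "x \<notin> K"
  shows "laplacian f x = 0"
  unfolding laplacian_def
  by (intro sum.neutral ballI partial_derivative_eq_0_off[OF assms(1) _ assms(3)])
     (rule partial_derivative_eq_0_off[OF assms(1,2)])

lemma neg_laplacian_pow_eq_0_off:
  assumes "closed K" "\<And>x. x \<notin> K \<Longrightarrow> f x = 0" "x \<notin> K"
  shows "neg_laplacian_pow k f x = 0"
  using assms(3)
proof (induction k arbitrary: x)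
  case (Suc k)
  then show ?case
    using laplacian_eq_0_off[OF assms(1), of "neg_laplacian_pow k f"] by (simp add: neg_laplacian_pow_Suc)
qed (use assms in simp)

lemma integrable_compact_support:
  fixes f :: "'a::euclidean_space \<Rightarrow> real"
  assumes "compact K" "continuous_on K f" "\<And>x. x \<notin> K \<Longrightarrow> f x = 0"
  shows "integrable lborel f"
proof -
  have "(\<lambda>x. indicator K x *\<^sub>R f x) = f" using assms(3) by (force simp: indicator_def)
  with borel_integrable_compact[OF assms(1,2)] show ?thesis by simp
qed

lemma lborel_integral_translation:
  fixes f :: "'a::euclidean_space \<Rightarrow> real"
  assumes "f \<in> borel_measurable borel"
  shows "(\<integral>x. f (x + c) \<partial>lborel) = (\<integral>x. f x \<partial>lborel)"
  using integral_distr[of "(+) c" lborel borel f] assms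
  by (simp add: lborel_distr_plus add.commute)

text \<open>
  By translation invariance all difference quotients of \<open>g\<close> in
  direction \<open>b\<close> have integral zero. They are bounded by the supremum of the derivative and vanish
  outside a fixed ball, so the integral of their limit is zero by dominated convergence.
\<close>

lemma integral_partial_derivative_eq_0:
  fixes g :: "'a::euclidean_space \<Rightarrow> real"
  assumes K: "compact K" and g: "C_on 1 UNIV g" "\<And>x. x \<notin> K \<Longrightarrow> g x = 0"
    and b: "b \<in> Basis"
  shows "(\<integral>x. partial_derivative b g x \<partial>lborel) = 0"
proof -
  define D where "D = partial_derivative b g"
  have diff: "g differentiable (at x)" for x using g by auto
  have contD: "continuous_on UNIV D" using g b by (simp add: D_def)
  have contg: "continuous_on UNIV g" using C_on_imp_continuous_on[OF g(1)] .
  obtain r where r: "K \<subseteq> cball 0 r"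
    using compact_imp_bounded[OF K] by (auto simp: bounded_iff subset_iff)
  have D0: "D x = 0" if "x \<notin> K" for x
    unfolding D_def using partial_derivative_eq_0_off[OF compact_imp_closed[OF K] g(2) that] .
  have "compact (D ` K)" using K contD by (meson compact_continuous_image continuous_on_subset subset_UNIV)
  then obtain B0 where "\<And>x. x \<in> K \<Longrightarrow> norm (D x) \<le> B0"
    by (meson bounded_iff compact_imp_bounded image_eqI)
  then have B: "\<bar>D x\<bar> \<le> max B0 0" for x using D0[of x] by (cases "x \<in> K") force+
  define B where "B = max B0 0"
  have DB: "\<bar>D x\<bar> \<le> B" for x using B by (simp add: B_def)
  define K' where "K' = cball (0::'a) (r + 1)"
  have deriv: "((\<lambda>t. g (x + t *\<^sub>R b)) has_real_derivative D (x + t *\<^sub>R b)) (at t)" for x t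
  proof -
    from diff obtain g' where g': "(g has_derivative g') (at (x + t *\<^sub>R b))"
      unfolding differentiable_def by blast
    have "((\<lambda>t. x + t *\<^sub>R b) has_derivative (\<lambda>h. h *\<^sub>R b)) (at t)"
      by (auto intro!: derivative_eq_intros)
    from has_derivative_compose[OF this g']
    have "((\<lambda>t. g (x + t *\<^sub>R b)) has_derivative (\<lambda>h. g' (h *\<^sub>R b))) (at t)" .
    moreover have "g' (h *\<^sub>R b) = D (x + t *\<^sub>R b) * h" for h
      using partial_derivative_eqI[OF g', of b] linear_cmul[OF has_derivative_linear[OF g']]
      by (simp add: D_def)
    ultimately show ?thesis by (simp add: has_field_derivative_def)
  qed
  define h where "h i = 1 / real (Suc i)" for i
  have h: "h i > 0" "h i \<le> 1" for i by (auto simp: h_def)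
  define s where "s i x = (g (x + h i *\<^sub>R b) - g x) / h i" for i x
  have cs: "continuous_on UNIV (s i)" for i
    unfolding s_def[abs_def]
    by (intro continuous_intros continuous_on_compose2[OF contg]) (use h[of i] in auto)
  have lim: "(\<lambda>i. \<integral>x. s i x \<partial>lborel) \<longlonglongrightarrow> (\<integral>x. D x \<partial>lborel)"
  proof (rule integral_dominated_convergence)
    show "D \<in> borel_measurable lborel" "s i \<in> borel_measurable lborel" for i
      using contD cs borel_measurable_continuous_onI by auto
    show "integrable lborel (\<lambda>x. indicator K' x *\<^sub>R B)"
      by (intro borel_integrable_compact) (auto simp: K'_def)
    show "AE x in lborel. (\<lambda>i. s i x) \<longlonglongrightarrow> D x"
    proof (rule AE_I2)
      fix x
      have "((\<lambda>t. (g (x + t *\<^sub>R b) - g x) / t) \<longlongrightarrow> D x) (at 0)"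
        using deriv[of x 0] by (simp add: has_field_derivative_iff)
      moreover have "filterlim h (at 0) sequentially"
        unfolding filterlim_at h_def[abs_def] using LIMSEQ_Suc[OF lim_1_over_n] by (auto simp: eventually_sequentially)
      ultimately show "(\<lambda>i. s i x) \<longlonglongrightarrow> D x"
        unfolding s_def by (rule filterlim_compose)
    qed
    show "AE x in lborel. norm (s i x) \<le> indicator K' x *\<^sub>R B" for i
    proof (rule AE_I2)
      fix x
      obtain t where t: "g (x + h i *\<^sub>R b) - g (x + 0 *\<^sub>R b) = (h i - 0) * D (x + t *\<^sub>R b)"
        using MVT2[of 0 "h i" "\<lambda>t. g (x + t *\<^sub>R b)" "\<lambda>t. D (x + t *\<^sub>R b)"] deriv h[of i] by blast
      then have "s i x = D (x + t *\<^sub>R b)" using h[of i] by (simp add: s_def)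
      then have 1: "norm (s i x) \<le> B" using DB by simp
      show "norm (s i x) \<le> indicator K' x *\<^sub>R B"
      proof (cases "x \<in> K'")
        case False
        then have "norm x > r + 1" by (simp add: K'_def)
        moreover have "norm x \<le> norm (x + h i *\<^sub>R b) + norm (h i *\<^sub>R b)"
          using norm_triangle_ineq4[of "x + h i *\<^sub>R b" "h i *\<^sub>R b"] by simp
        moreover have "norm (h i *\<^sub>R b) \<le> 1" using h[of i] b by simp
        ultimately have "norm x > r" "norm (x + h i *\<^sub>R b) > r" by auto
        then have "x \<notin> K" "x + h i *\<^sub>R b \<notin> K" using r by auto
        then show ?thesis using g(2) False by (simp add: s_def)
      qed (use 1 in simp)
    qed
  qed
  have ig: "integrable lborel g"
    using integrable_compact_support[OF K continuous_on_subset[OF contg] g(2)] by simp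
  have mg: "g \<in> borel_measurable borel" using contg borel_measurable_continuous_onI by auto
  have "integrable lborel (\<lambda>x. g (x + h i *\<^sub>R b))" for i
  proof -
    have "integrable (distr lborel borel ((+) (h i *\<^sub>R b))) g" using ig by (simp add: lborel_distr_plus)
    then show ?thesis by (subst (asm) integrable_distr_eq) (auto simp: mg add.commute)
  qed
  then have "(\<integral>x. s i x \<partial>lborel) = 0" for i
    unfolding s_def using lborel_integral_translation[OF mg] ig by simp
  with lim have "(\<lambda>i. 0) \<longlonglongrightarrow> (\<integral>x. D x \<partial>lborel)" by simp
  then show ?thesis using LIMSEQ_unique tendsto_const unfolding D_def by blast
qed

lemma C_on_zero_extension_mult:
  assumes "open S" "compact K" "K \<subseteq> S" "C_on m S w" "C_on m UNIV \<psi>" "\<And>x. x \<notin> K \<Longrightarrow> \<psi> x = 0"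
  shows "C_on m UNIV (\<lambda>x. w x * \<psi> x)"
  using assms by (intro C_on_extend_zero[OF assms(1) compact_imp_closed[OF assms(2)] assms(3)] C_on_mult
      C_on_subset[OF assms(5)]) auto

text \<open>
  For each basis direction, \<open>w \<partial>\<^sub>b\<^sup>2 \<psi> - \<partial>\<^sub>b\<^sup>2 w \<psi>\<close> is the derivative of the compactly supported
  \<open>C\<^sup>1\<close> function \<open>w \<partial>\<^sub>b \<psi> - \<partial>\<^sub>b w \<psi>\<close>.
\<close>

lemma integral_laplacian_symmetric:
  fixes w \<psi> :: "'a::euclidean_space \<Rightarrow> real"
  assumes S: "open S" and K: "compact K" "K \<subseteq> S" and w: "C_on 2 S w"
    and \<psi>: "C_on 2 UNIV \<psi>" "\<And>x. x \<notin> K \<Longrightarrow> \<psi> x = 0"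
  shows "(\<integral>x. w x * laplacian \<psi> x \<partial>lborel) = (\<integral>x. laplacian w x * \<psi> x \<partial>lborel)"
proof -
  let ?d = partial_derivative
  have Kc: "closed K" using K compact_imp_closed by auto
  have w1: "C_on 1 S w" "b \<in> Basis \<Longrightarrow> C_on 1 S (?d b w)" for b
    using w C_on_SucD[of 1 S w] by (auto simp: numeral_2_eq_2 simp del: C_on.simps(2))
       (auto simp: numeral_2_eq_2)
  have p1: "C_on 1 UNIV \<psi>" "b \<in> Basis \<Longrightarrow> C_on 1 UNIV (?d b \<psi>)" for b
    using \<psi> C_on_SucD[of 1 UNIV \<psi>] by (auto simp: numeral_2_eq_2 simp del: C_on.simps(2))
       (auto simp: numeral_2_eq_2)
  have off: "?d b \<psi> x = 0" if "x \<notin> K" for b x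
    using partial_derivative_eq_0_off[OF Kc \<psi>(2) that] .
  have off2: "?d b (?d b \<psi>) x = 0" if "x \<notin> K" for b x
    using partial_derivative_eq_0_off[OF Kc off that] .
  have main: "(\<integral>x. w x * ?d b (?d b \<psi>) x - ?d b (?d b w) x * \<psi> x \<partial>lborel) = 0" if b: "b \<in> Basis" for b
  proof -
    define g where "g x = w x * ?d b \<psi> x - ?d b w x * \<psi> x" for x
    have C1: "C_on 1 UNIV (\<lambda>x. w x * ?d b \<psi> x)" "C_on 1 UNIV (\<lambda>x. ?d b w x * \<psi> x)"
      using C_on_zero_extension_mult[OF S K w1(1) p1(2)[OF b] off]
        C_on_zero_extension_mult[OF S K w1(2)[OF b] p1(1) \<psi>(2)] by auto
    have g1: "C_on 1 UNIV g"
      using C_on_add[OF _ C1(1) C_on_cmult[OF _ C1(2), of "-1"]] by (simp add: g_def[abs_def])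
    have g0: "g x = 0" if "x \<notin> K" for x using off \<psi>(2) that by (simp add: g_def)
    have "?d b g x = w x * ?d b (?d b \<psi>) x - ?d b (?d b w) x * \<psi> x" for x
    proof (cases "x \<in> K")
      case False
      then show ?thesis using partial_derivative_eq_0_off[OF Kc g0 False] off2 \<psi>(2) by simp
    next
      case True
      then have "x \<in> S" using K by auto
      then have "w differentiable at x" "?d b w differentiable at x" "\<psi> differentiable at x"
        "?d b \<psi> differentiable at x" using w1 p1 b by auto
      then obtain w' dw' p' dp' where D: "(w has_derivative w') (at x)" "(?d b w has_derivative dw') (at x)"
        "(\<psi> has_derivative p') (at x)" "(?d b \<psi> has_derivative dp') (at x)"
        unfolding differentiable_def by blast
      have "(g has_derivative (\<lambda>h. (w x * dp' h + w' h * ?d b \<psi> x) - (?d b w x * p' h + dw' h * \<psi> x))) (at x)"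
        unfolding g_def by (intro has_derivative_diff has_derivative_mult D)
      from partial_derivative_eqI[OF this] show ?thesis
        by (simp add: D[THEN partial_derivative_eqI])
    qed
    then show ?thesis using integral_partial_derivative_eq_0[OF K(1) g1 g0 b] by simp
  qed
  have i1: "integrable lborel (\<lambda>x. w x * ?d b (?d b \<psi>) x)" if "b \<in> Basis" for b
    using continuous_on_subset[OF C_on_imp_continuous_on[OF w] K(2)] p1(2)[OF that] off2 that
    by (intro integrable_compact_support[OF K(1)] continuous_intros) (auto intro: continuous_on_subset)
  have i2: "integrable lborel (\<lambda>x. ?d b (?d b w) x * \<psi> x)" if "b \<in> Basis" for b
  proof -
    have "continuous_on S (?d b (?d b w))" using w1(2)[OF that] that by auto
    then show ?thesis using \<psi>(2) C_on_imp_continuous_on[OF p1(1)] K(2)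
      by (intro integrable_compact_support[OF K(1)] continuous_intros) (auto intro: continuous_on_subset)
  qed
  have i1': "integrable lborel (\<lambda>x. w x * laplacian \<psi> x)"
    unfolding laplacian_def sum_distrib_left by (intro Bochner_Integration.integrable_sum i1)
  have i2': "integrable lborel (\<lambda>x. laplacian w x * \<psi> x)"
    unfolding laplacian_def sum_distrib_right by (intro Bochner_Integration.integrable_sum i2)
  have "(\<integral>x. w x * laplacian \<psi> x \<partial>lborel) - (\<integral>x. laplacian w x * \<psi> x \<partial>lborel) =
     (\<integral>x. w x * laplacian \<psi> x - laplacian w x * \<psi> x \<partial>lborel)"
    using i1' i2' by simp
  also have "\<dots> = (\<integral>x. (\<Sum>b\<in>Basis. w x * ?d b (?d b \<psi>) x - ?d b (?d b w) x * \<psi> x) \<partial>lborel)"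
    unfolding laplacian_def sum_distrib_left sum_distrib_right sum_subtractf ..
  also have "\<dots> = (\<Sum>b\<in>Basis. \<integral>x. w x * ?d b (?d b \<psi>) x - ?d b (?d b w) x * \<psi> x \<partial>lborel)"
    by (intro Bochner_Integration.integral_sum Bochner_Integration.integrable_diff i1 i2)
  also have "\<dots> = 0" using main by simp
  finally show ?thesis by simp
qed

lemma integral_neg_laplacian_pow_symmetric:
  fixes w \<psi> :: "'a::euclidean_space \<Rightarrow> real"
  assumes S: "open S" and K: "compact K" "K \<subseteq> S" and w: "C_on (2 * k) S w"
    and \<psi>: "C_on (2 * k) UNIV \<psi>" "\<And>x. x \<notin> K \<Longrightarrow> \<psi> x = 0"
  shows "(\<integral>x. w x * neg_laplacian_pow k \<psi> x \<partial>lborel) = (\<integral>x. neg_laplacian_pow k w x * \<psi> x \<partial>lborel)"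
  using w \<psi>(1)
proof (induction k arbitrary: w)
  case (Suc k)
  have 2: "C_on 2 UNIV (neg_laplacian_pow k \<psi>)" "C_on (2 * k) UNIV \<psi>"
    using C_on_neg_laplacian_pow[of UNIV k 2 \<psi>] C_on_mono[OF Suc.prems(2), of "2 * k"] Suc.prems
    by (simp_all del: C_on.simps(2))
  have w2: "C_on 2 S w" "C_on (2 * k) S (\<lambda>x. - laplacian w x)"
    using Suc.prems C_on_mono[OF Suc.prems(1), of 2] C_on_neg_laplacian[OF S, of "2 * k" w]
    by (simp_all del: C_on.simps(2))
  have "(\<integral>x. w x * neg_laplacian_pow (Suc k) \<psi> x \<partial>lborel) = - (\<integral>x. w x * laplacian (neg_laplacian_pow k \<psi>) x \<partial>lborel)"
    by (simp add: neg_laplacian_pow_Suc)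
  also have "\<dots> = - (\<integral>x. laplacian w x * neg_laplacian_pow k \<psi> x \<partial>lborel)"
    by (subst integral_laplacian_symmetric[OF S K w2(1) 2(1)])
       (use neg_laplacian_pow_eq_0_off[OF compact_imp_closed[OF K(1)] \<psi>(2)] in auto)
  also have "\<dots> = (\<integral>x. - laplacian w x * neg_laplacian_pow k \<psi> x \<partial>lborel)" by simp
  also have "\<dots> = (\<integral>x. neg_laplacian_pow (Suc k) w x * \<psi> x \<partial>lborel)"
    unfolding neg_laplacian_pow_Suc' by (rule Suc.IH[OF w2(2) 2(2)])
  finally show ?case .
qed simp

section \<open>A cutoff function\<close>

lemma dvd_pderiv:
  fixes P :: "real poly"
  assumes "[:-c, 1:] ^ Suc j dvd P" shows "[:-c, 1:] ^ j dvd pderiv P"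
proof -
  obtain R where "P = [:-c, 1:] ^ Suc j * R" using assms by blast
  then have "pderiv P = [:-c, 1:] ^ j * ([:-c, 1:] * pderiv R + smult (of_nat (Suc j)) (pderiv [:-c, 1:]) * R)"
    by (simp add: pderiv_mult pderiv_power_Suc algebra_simps del: power_Suc)
       (simp add: algebra_simps)
  then show ?thesis by simp
qed

lemma dvd_pderiv_funpow:
  fixes P :: "real poly"
  assumes "[:-c, 1:] ^ (i + j) dvd P" shows "[:-c, 1:] ^ j dvd (pderiv ^^ i) P"
  using assms
proof (induction i arbitrary: j)
  case (Suc i)
  then show ?case using dvd_pderiv[of c j] Suc.IH[of "Suc j"] by simp
qed simp

lemma poly_eq_0_if_power_dvd:
  fixes P :: "real poly"
  assumes "[:-c, 1:] ^ Suc j dvd P" shows "poly P c = 0"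
proof -
  have "[:-c, 1:] dvd P" using assms unfolding power_Suc by (rule dvd_mult_left)
  then show ?thesis by (simp add: poly_eq_0_iff_dvd)
qed

lemma DERIV_glue:
  fixes A B :: "real \<Rightarrow> real"
  assumes "A c = B c" "A' c = B' c"
    and A: "(A has_real_derivative A' t) (at t)"
    and B: "(B has_real_derivative B' t) (at t)"
  shows "((\<lambda>t. if t \<le> c then A t else B t) has_real_derivative (if t \<le> c then A' t else B' t)) (at t)"
proof -
  consider "t < c" | "t > c" | "t = c" by linarith
  then show ?thesis
  proof cases
    case 1
    then show ?thesis using has_field_derivative_transform_within_open[OF A, of "{..<c}"] by auto
  next
    case 2
    then show ?thesis using has_field_derivative_transform_within_open[OF B, of "{c<..}"] by auto
  next
    case 3
    let ?f = "\<lambda>t. if t \<le> c then A t else B t"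
    have "(?f has_real_derivative A' c) (at c within {..c})"
      using has_field_derivative_transform_within[OF has_field_derivative_at_within[OF A], of 1 "{..c}" ?f] 3
      by auto
    moreover have "(?f has_real_derivative A' c) (at c within {c..})"
      using has_field_derivative_transform_within[OF has_field_derivative_at_within[OF B], of 1 "{c..}" ?f]
        3 assms(1,2) by auto
    ultimately have "(?f has_real_derivative A' c) (at c within ({..c} \<union> {c..}))"
      unfolding has_field_derivative_iff by (rule Lim_Un)
    moreover have "{..c} \<union> {c..} = UNIV" by auto
    ultimately show ?thesis using 3 by simp
  qed
qed

text \<open>
  A cutoff made of polynomial pieces: smoothness at the break points and the decay of all derivatives
  at \<open>2\<close> both reduce to divisibility by powers of linear polynomials.
\<close>

definition poly_step :: "real \<Rightarrow> real poly \<Rightarrow> real \<Rightarrow> real" where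
  "poly_step a P t = (if t \<le> 1 then a else if t \<le> 2 then poly P t else 0)"

lemma DERIV_poly_step:
  assumes "[:-1, 1:] ^ 2 dvd P - [:a:]" "[:-2, 1:] ^ 2 dvd P"
  shows "(poly_step a P has_real_derivative poly_step 0 (pderiv P) t) (at t)"
proof -
  have p1: "poly P 1 = a" using poly_eq_0_if_power_dvd[of 1 1 "P - [:a:]"] assms by (simp add: numeral_2_eq_2)
  have p2: "poly P 2 = 0" using poly_eq_0_if_power_dvd[of 2 1 P] assms by (simp add: numeral_2_eq_2)
  have "[:-1, 1:] dvd pderiv (P - [:a:])" "[:-2, 1:] dvd pderiv P"
    using dvd_pderiv[of 1 1 "P - [:a:]"] dvd_pderiv[of 2 1 P] assms by (simp_all add: numeral_2_eq_2)
  then have d: "poly (pderiv P) 1 = 0" "poly (pderiv P) 2 = 0"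
    by (simp_all add: poly_eq_0_iff_dvd pderiv_diff pderiv_pCons)
  have "((\<lambda>t. if t \<le> 2 then poly P t else 0) has_real_derivative (if t \<le> 2 then poly (pderiv P) t else 0)) (at t)"
    for t using DERIV_glue[of "poly P" 2 "\<lambda>_. 0" "poly (pderiv P)" "\<lambda>_. 0"] p2 d by auto
  then show ?thesis unfolding poly_step_def[abs_def] using p1 d
    by (intro DERIV_glue[of "\<lambda>_. a" 1 "\<lambda>t. if t \<le> 2 then poly P t else 0" "\<lambda>_. 0"
        "\<lambda>t. if t \<le> 2 then poly (pderiv P) t else 0"]) auto
qed

text \<open>
  Each derivative costs one order of vanishing at \<open>2\<close>, and \<open>radial_op\<close> takes two derivatives.
\<close>

lemma radial_op_bound:
  assumes "N + 2 \<le> j"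
    and "\<And>i. i \<le> N + 2 \<Longrightarrow> \<exists>C\<ge>0. \<forall>t\<in>{1..2}. \<bar>G i t\<bar> \<le> C * (2 - t) ^ (j - i)"
    and "i \<le> N"
  shows "\<exists>C\<ge>0. \<forall>t\<in>{1..2}. \<bar>radial_op n G i t\<bar> \<le> C * (2 - t) ^ (j - 2 - i)"
proof -
  obtain C1 where C1: "C1 \<ge> 0" "\<And>t. t\<in>{1..2} \<Longrightarrow> \<bar>G (i + 1) t\<bar> \<le> C1 * (2 - t) ^ (j - (i + 1))"
    using assms(2)[of "i + 1"] assms(3) by auto
  obtain C2 where C2: "C2 \<ge> 0" "\<And>t. t\<in>{1..2} \<Longrightarrow> \<bar>G (i + 2) t\<bar> \<le> C2 * (2 - t) ^ (j - (i + 2))"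
    using assms(2)[of "i + 2"] assms(3) by auto
  let ?c = "4 * real i + 2 * real n"
  have "\<bar>radial_op n G i t\<bar> \<le> (8 * C2 + ?c * C1) * (2 - t) ^ (j - 2 - i)" if t: "t \<in> {1..2}" for t
  proof -
    have "\<bar>radial_op n G i t\<bar> \<le> \<bar>4 * t * G (i + 2) t\<bar> + \<bar>?c * G (i + 1) t\<bar>"
      unfolding radial_op_def by linarith
    also have "\<dots> = (4 * t) * \<bar>G (i + 2) t\<bar> + ?c * \<bar>G (i + 1) t\<bar>"
      using t by (simp add: abs_mult)
    also have "\<dots> \<le> 8 * (C2 * (2 - t) ^ (j - (i + 2))) + ?c * (C1 * (2 - t) ^ (j - (i + 1)))"
      using t C1 C2 by (intro add_mono mult_mono) auto
    also have "\<dots> \<le> 8 * (C2 * (2 - t) ^ (j - 2 - i)) + ?c * (C1 * (2 - t) ^ (j - 2 - i))"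
      using t C1 C2 by (intro add_mono mult_left_mono power_decreasing) auto
    finally show ?thesis by (simp add: algebra_simps)
  qed
  then show ?thesis using C1 C2 by (intro exI[of _ "8 * C2 + ?c * C1"]) auto
qed

lemma radial_op_pow_bound:
  assumes "N + 2 * k \<le> j"
    and "\<And>i. i \<le> N + 2 * k \<Longrightarrow> \<exists>C\<ge>0. \<forall>t\<in>{1..2}. \<bar>G i t\<bar> \<le> C * (2 - t) ^ (j - i)"
    and "i \<le> N"
  shows "\<exists>C\<ge>0. \<forall>t\<in>{1..2}. \<bar>(radial_op n ^^ k) G i t\<bar> \<le> C * (2 - t) ^ (j - 2 * k - i)"
  using assms
proof (induction k arbitrary: N i)
  case (Suc k)
  have "\<exists>C\<ge>0. \<forall>t\<in>{1..2}. \<bar>(radial_op n ^^ k) G i t\<bar> \<le> C * (2 - t) ^ (j - 2 * k - i)" if "i \<le> N + 2" for i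
    using that Suc.prems by (intro Suc.IH[of "N + 2"]) auto
  from radial_op_bound[OF _ this, of "i"] Suc.prems show ?case by (simp add: add.commute)
qed simp

lemma radial_op_pow_eq_0:
  assumes "\<And>i. i > 0 \<Longrightarrow> G i t = 0" "k > 0 \<or> i > 0"
  shows "(radial_op n ^^ k) G i t = 0"
  using assms(2)
proof (induction k arbitrary: i)
  case (Suc k) then show ?case by (simp add: radial_op_def)
qed (use assms(1) in simp)

text \<open>
  The cutoff is \<open>(1 - (t - 1)\<^sup>m)\<^sup>m\<close> on \<open>[1,2]\<close>. It differs from \<open>1\<close> by a multiple of \<open>(t - 1)\<^sup>m\<close> and is itself a
  multiple of \<open>(t - 2)\<^sup>m\<close>, which gives the smoothness at both break points. Near \<open>2\<close> it is at least
  \<open>(2 - t)\<^sup>m\<close>, whereas the \<open>k\<close>-th iterate of the radial operator is bounded by a multiple of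
  \<open>(2 - t)\<^bsup>m - 2k\<^esup>\<close>; for large \<open>m\<close> the latter is at most the \<open>1/p\<close>-th power of the former. This bound is what
  makes the cutoff reappear, with exponent one, after an application of Jensen's inequality.
\<close>

lemma cutoff_exists:
  fixes p q :: real
  assumes k: "k \<ge> 1" and p: "p > 1" and q: "q > 1"
  obtains G K where "deriv_seq (2 * k) UNIV G" "\<And>t. t \<le> 1 \<Longrightarrow> G 0 t = 1" "\<And>t. t \<ge> 2 \<Longrightarrow> G 0 t = 0"
    "\<And>t. 0 \<le> G 0 t" "\<And>t. G 0 t \<le> 1" "K > 0"
    "\<And>t. t \<notin> {1..2} \<Longrightarrow> (radial_op n ^^ k) G 0 t = 0"
    "\<And>t. \<bar>(radial_op n ^^ k) G 0 t\<bar> \<le> K * G 0 t powr (1 / p)"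
    "\<And>t. \<bar>(radial_op n ^^ k) G 0 t\<bar> \<le> K * G 0 t powr (1 / q)"
proof -
  \<comment> \<open>The last two summands make \<open>m / r \<le> m - 2 k\<close> for \<open>r = p\<close> and \<open>r = q\<close>.\<close>
  obtain m :: nat where m0: "real m > 2 * k + 2 + 2 * k / (1 - 1 / p) + 2 * k / (1 - 1 / q)"
    using reals_Archimedean2 by blast
  have pos: "1 - 1 / p > 0" "1 - 1 / q > 0" using p q by auto
  then have "2 * k / (1 - 1 / p) \<ge> 0" "2 * k / (1 - 1 / q) \<ge> 0" by auto
  then have mp: "real m \<ge> 2 * k / (1 - 1 / p)" "real m \<ge> 2 * k / (1 - 1 / q)" and "real m > 2 * k + 2"
    using m0 by linarith+
  then have m: "m > 2 * k + 2" by linarith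
  have mr: "real m * (1 / r) \<le> real (m - 2 * k)" if "r \<in> {p, q}" for r
  proof -
    have "2 * real k \<le> real m * (1 - 1 / r)" using mp that pos by (auto simp: pos_divide_le_eq)
    moreover have "real (m - 2 * k) = real m - 2 * real k" using m by (simp add: of_nat_diff)
    ultimately show ?thesis by (simp add: right_diff_distrib)
  qed
  define Q :: "real poly" where "Q = (1 - [:-1, 1:] ^ m) ^ m"
  have Q: "poly Q t = (1 - (t - 1) ^ m) ^ m" for t by (simp add: Q_def algebra_simps)
  have "[:-1, 1:] ^ m dvd Q - [:1:]"
  proof -
    define z where "z = 1 - [:-1, 1::real:] ^ m"
    have "Q - 1 = (z - 1) * (\<Sum>i<m. z ^ i)"
      unfolding Q_def z_def[symmetric] by (rule power_diff_1_eq)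
    moreover have "z - 1 = - ([:-1, 1:] ^ m)" by (simp add: z_def)
    ultimately show ?thesis by (simp add: one_pCons)
  qed
  note dvd1 = this
  have "[:-2, 1:] dvd 1 - [:-1, 1::real:] ^ m"
    by (subst poly_eq_0_iff_dvd[symmetric]) simp
  then have dvd2: "[:-2, 1:] ^ m dvd Q" unfolding Q_def by (rule dvd_power_same)
  define G where "G i = poly_step (if i = 0 then 1 else 0) ((pderiv ^^ i) Q)" for i
  have d1: "[:-1, 1:] ^ (m - i) dvd (pderiv ^^ i) Q - [:if i = 0 then 1 else 0:]" if "i < m" for i
  proof (cases i)
    case 0 then show ?thesis using dvd1 by simp
  next
    case (Suc l)
    have "[:-1, 1:] ^ (m - i) dvd (pderiv ^^ i) (Q - [:1:])"
      using dvd_pderiv_funpow[of 1 i "m - i" "Q - [:1:]"] dvd1 that by simp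
    moreover have "(pderiv ^^ i) (Q - [:1:]) = (pderiv ^^ i) Q"
      unfolding Suc funpow_Suc_right by (simp add: pderiv_diff pderiv_pCons)
    ultimately show ?thesis using Suc by simp
  qed
  have d2: "[:-2, 1:] ^ (m - i) dvd (pderiv ^^ i) Q" if "i < m" for i
    using dvd_pderiv_funpow[of 2 i "m - i" Q] dvd2 that by simp
  have der: "(G i has_real_derivative G (Suc i) t) (at t)" if "i \<le> 2 * k" for i t
  proof -
    have "2 \<le> m - i" "i < m" using that m by auto
    then have "[:-1, 1:] ^ 2 dvd (pderiv ^^ i) Q - [:if i = 0 then 1 else 0:]" "[:-2, 1:] ^ 2 dvd (pderiv ^^ i) Q"
      using d1[of i] d2[of i] power_le_dvd by blast+
    from DERIV_poly_step[OF this] show ?thesis by (simp add: G_def)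
  qed
  have 1: "deriv_seq (2 * k) UNIV G"
    unfolding deriv_seq_def using der
    by (auto intro!: continuous_at_imp_continuous_on DERIV_isCont)
  have G0: "G 0 t = (if t \<le> 1 then 1 else if t \<le> 2 then (1 - (t - 1) ^ m) ^ m else 0)" for t
    by (simp add: G_def poly_step_def Q)
  have base: "(t - 1) ^ m \<le> t - 1" "0 \<le> (t - 1) ^ m" if "1 \<le> t" "t \<le> 2" for t :: real
    using that power_decreasing[of 1 m "t - 1"] m by auto
  have 2: "0 \<le> G 0 t" "G 0 t \<le> 1" for t
    using base[of t] by (auto simp: G0 intro!: power_le_one)
  have low: "(2 - t) ^ m \<le> G 0 t" if "t \<in> {1..2}" for t
    using base[of t] that by (auto simp: G0 intro!: power_mono)
  have bnd: "\<exists>C\<ge>0. \<forall>t\<in>{1..2}. \<bar>G i t\<bar> \<le> C * (2 - t) ^ (m - i)" if "i \<le> 0 + 2 * k" for i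
  proof -
    have "i < m" using that m by simp
    then obtain R where R: "(pderiv ^^ i) Q = [:-2, 1:] ^ (m - i) * R" using d2[of i] unfolding dvd_def by blast
    have "compact (poly R ` {1..2})" by (intro compact_continuous_image continuous_intros) auto
    then have "bounded (poly R ` {1..2})" by (rule compact_imp_bounded)
    then obtain C where C: "\<And>t. t \<in> {1..2} \<Longrightarrow> \<bar>poly R t\<bar> \<le> C"
      unfolding bounded_iff by (metis image_eqI real_norm_def)
    then have C0: "C \<ge> 0" using order_trans[OF abs_ge_zero C[of 1]] by simp
    have "\<bar>G i t\<bar> \<le> C * (2 - t) ^ (m - i)" if t: "t \<in> {1..2}" for t
    proof -
      have "\<bar>poly ((pderiv ^^ i) Q) t\<bar> = (2 - t) ^ (m - i) * \<bar>poly R t\<bar>"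
        using t by (simp add: R abs_mult power_abs)
      also have "\<dots> \<le> (2 - t) ^ (m - i) * C" using C[OF t] t by (intro mult_left_mono) auto
      finally have *: "\<bar>poly ((pderiv ^^ i) Q) t\<bar> \<le> C * (2 - t) ^ (m - i)" by (simp add: mult.commute)
      show ?thesis
      proof (cases "t = 1")
        case True
        then show ?thesis using * C0 m by (cases "i = 0") (auto simp: G_def poly_step_def Q power_0_left)
      qed (use * t in \<open>auto simp: G_def poly_step_def\<close>)
    qed
    with C0 show ?thesis by blast
  qed
  obtain K where K: "K \<ge> 0" "\<And>t. t \<in> {1..2} \<Longrightarrow> \<bar>(radial_op n ^^ k) G 0 t\<bar> \<le> K * (2 - t) ^ (m - 2 * k)"
  proof -
    have "\<exists>C\<ge>0. \<forall>t\<in>{1..2}. \<bar>(radial_op n ^^ k) G 0 t\<bar> \<le> C * (2 - t) ^ (m - 2 * k - 0)"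
      by (rule radial_op_pow_bound[where N=0, OF _ bnd]) (use m in auto)
    then show thesis using that by auto
  qed
  have out: "(radial_op n ^^ k) G 0 t = 0" if "t \<notin> {1..2}" for t
    using that k by (intro radial_op_pow_eq_0) (auto simp: G_def poly_step_def)
  have main: "\<bar>(radial_op n ^^ k) G 0 t\<bar> \<le> (K + 1) * G 0 t powr (1 / r)" if r: "r \<in> {p, q}" for r t
  proof (cases "t \<in> {1..2}")
    case True
    have r1: "r > 1" using p q r by auto
    have "(2 - t) ^ (m - 2 * k) \<le> G 0 t powr (1 / r)"
    proof (cases "t = 2")
      case True then show ?thesis using m by (simp add: power_0_left)
    next
      case False
      then have t: "0 < 2 - t" "2 - t \<le> 1" using \<open>t \<in> {1..2}\<close> by auto
      have "(2 - t) ^ (m - 2 * k) = (2 - t) powr real (m - 2 * k)" using t by (simp add: powr_realpow)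
      also have "\<dots> \<le> (2 - t) powr (real m * (1 / r))" by (rule powr_mono'[OF mr[OF r]]) (use t in auto)
      also have "\<dots> = ((2 - t) ^ m) powr (1 / r)"
        unfolding powr_realpow[OF t(1), symmetric] powr_powr ..
      also have "\<dots> \<le> G 0 t powr (1 / r)" using low[OF True] t r1 by (intro powr_mono2) auto
      finally show ?thesis .
    qed
    then have "K * (2 - t) ^ (m - 2 * k) \<le> (K + 1) * G 0 t powr (1 / r)"
      using K True by (intro mult_mono) auto
    with K(2)[OF True] show ?thesis by linarith
  qed (use out K in simp)
  show thesis
  proof (rule that[of G "K + 1"])
    show "G 0 t = 0" if "t \<ge> 2" for t using that m by (cases "t = 2") (simp_all add: G0 power_0_left)
  qed (use 1 2 K out main in \<open>auto simp: G0\<close>)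
qed

text \<open>
  The scaling law \<open>(-\<Delta>)\<^sup>k (f (\<cdot> / R)) = R\<^bsup>-2k\<^esup> ((-\<Delta>)\<^sup>k f) (\<cdot> / R)\<close>, with \<open>S = R\<^sup>2\<close>.
\<close>

lemma radial_op_pow_scale:
  assumes "S > 0"
  shows "(radial_op n ^^ k) (\<lambda>i t. G i (t / S) / S ^ i) i t = (radial_op n ^^ k) G i (t / S) / S ^ (i + k)"
proof (induction k arbitrary: i t)
  case (Suc k)
  have "(radial_op n ^^ Suc k) (\<lambda>i t. G i (t / S) / S ^ i) i t =
     - (4 * t * ((radial_op n ^^ k) G (i + 2) (t / S) / S ^ (i + 2 + k)) +
       (4 * real i + 2 * real n) * ((radial_op n ^^ k) G (i + 1) (t / S) / S ^ (i + 1 + k)))"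
    unfolding funpow.simps(2) o_def radial_op_def[of n "(radial_op n ^^ k) (\<lambda>i t. G i (t / S) / S ^ i)"] Suc ..
  also have "\<dots> = radial_op n ((radial_op n ^^ k) G) i (t / S) / S ^ (i + Suc k)"
  proof -
    have "t / S ^ (i + 2 + k) = (t / S) / S ^ (i + Suc k)" "S ^ (i + 1 + k) = S ^ (i + Suc k)"
      by simp_all
    then have "- (4 * t * (a / S ^ (i + 2 + k)) + c * (b / S ^ (i + 1 + k)))
      = - (4 * (t / S) * a + c * b) / S ^ (i + Suc k)" for a b c
      by (simp add: diff_divide_distrib)
    then show ?thesis unfolding radial_op_def .
  qed
  finally show ?case by simp
qed simp

lemma radial_op_pow_lincomb:
  assumes "\<And>i. H i t = a * F i t + b * G i t"
  shows "(radial_op n ^^ k) H i t = a * (radial_op n ^^ k) F i t + b * (radial_op n ^^ k) G i t"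
proof (induction k arbitrary: i)
  case (Suc k)
  have "(radial_op n ^^ Suc k) H i t =
     - (4 * t * (a * (radial_op n ^^ k) F (i + 2) t + b * (radial_op n ^^ k) G (i + 2) t) +
       (4 * real i + 2 * real n) * (a * (radial_op n ^^ k) F (i + 1) t + b * (radial_op n ^^ k) G (i + 1) t))"
    unfolding funpow.simps(2) o_def radial_op_def[of n "(radial_op n ^^ k) H"] Suc ..
  also have "\<dots> = a * (radial_op n ^^ Suc k) F i t + b * (radial_op n ^^ Suc k) G i t"
    by (simp add: radial_op_def algebra_simps)
  finally show ?case .
qed (use assms in simp)

lemma radial_op_pow_diff:
  "(radial_op n ^^ k) (\<lambda>i t. F i t - G i t) i t = (radial_op n ^^ k) F i t - (radial_op n ^^ k) G i t"
  using radial_op_pow_lincomb[of "\<lambda>i t. F i t - G i t" t 1 F "-1" G] by simp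

lemma deriv_seq_scale:
  assumes "S > 0" "deriv_seq N UNIV G"
  shows "deriv_seq N UNIV (\<lambda>i t. G i (t / S) / S ^ i)"
proof -
  have "((\<lambda>t. G i (t / S) / S ^ i) has_real_derivative G (Suc i) (t / S) / S ^ Suc i) (at t)" if "i < N" for i t
  proof -
    have "(G i has_real_derivative G (Suc i) (t / S)) (at (t / S))" using assms that by (auto simp: deriv_seq_def)
    moreover have "((\<lambda>t. t / S) has_real_derivative 1 / S) (at t)"
      by (rule DERIV_cdivide[OF DERIV_ident])
    ultimately have "((\<lambda>t. G i (t / S)) has_real_derivative G (Suc i) (t / S) * (1 / S)) (at t)"
      by (rule DERIV_chain2)
    from DERIV_cdivide[OF this, of "S ^ i"] show ?thesis
      by (rule DERIV_cong) simp
  qed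
  moreover have "continuous_on UNIV (\<lambda>t. G N (t / S) / S ^ N)"
  proof (intro continuous_on_divide continuous_on_const)
    show "continuous_on UNIV (\<lambda>t. G N (t / S))"
      by (rule continuous_on_compose2[of UNIV "G N"])
         (use assms in \<open>auto simp: deriv_seq_def intro!: continuous_intros\<close>)
  qed (use assms in simp)
  ultimately show ?thesis by (simp add: deriv_seq_def)
qed

lemma deriv_seq_diff:
  assumes "deriv_seq N T F" "deriv_seq N T G"
  shows "deriv_seq N T (\<lambda>i t. F i t - G i t)"
  using assms by (auto simp: deriv_seq_def intro!: DERIV_diff continuous_intros)

section \<open>Test function estimates\<close>

lemma deriv_seq_radial_op_pow:
  "deriv_seq (N + 2 * k) T G \<Longrightarrow> deriv_seq N T ((radial_op n ^^ k) G)"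
proof (induction k arbitrary: N)
  case (Suc k)
  then show ?case using deriv_seq_radial_op[of N T "(radial_op n ^^ k) G" n] Suc.IH[of "N + 2"] by simp
qed simp

text \<open>
  The bounds refer to \<open>|x|\<^sup>2\<close>, the variable of the radial calculus.
\<close>

definition annulus :: "real \<Rightarrow> real \<Rightarrow> 'a::euclidean_space set" where
  "annulus a b = {x. a \<le> x \<bullet> x \<and> x \<bullet> x \<le> b}"

lemma annulus_subset_cball: "annulus a b \<subseteq> cball 0 (sqrt b)"
  by (auto simp: annulus_def norm_eq_sqrt_inner)

lemma compact_annulus: "compact (annulus a b)"
proof -
  have "closed (annulus a b :: 'a set)"
    unfolding annulus_def by (intro closed_Collect_conj closed_Collect_le continuous_intros)
  moreover have "bounded (annulus a b :: 'a set)"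
    using annulus_subset_cball bounded_cball bounded_subset by blast
  ultimately show ?thesis by (simp add: compact_eq_bounded_closed)
qed

lemma measure_annulus_le:
  assumes "0 \<le> b"
  shows "measure lborel (annulus a b :: 'a::euclidean_space set) \<le> unit_ball_vol DIM('a) * b powr (DIM('a) / 2)"
proof -
  have "measure lborel (annulus a b :: 'a set) \<le> measure lborel (cball (0::'a) (sqrt b))"
    by (intro measure_mono_fmeasurable annulus_subset_cball fmeasurable_compact)
      (auto simp: compact_imp_closed compact_annulus)
  also have "\<dots> = unit_ball_vol DIM('a) * sqrt b ^ DIM('a)" using assms content_cball[of "sqrt b" "0::'a"] by simp
  also have "sqrt b ^ DIM('a) = b powr (DIM('a) / 2)"
    using assms by (cases "b = 0")
      (auto simp: powr_half_sqrt[symmetric] powr_powr powr_realpow[symmetric])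
  finally show ?thesis .
qed

definition annulus_integral :: "real \<Rightarrow> real \<Rightarrow> ('a::euclidean_space \<Rightarrow> real) \<Rightarrow> real" where
  "annulus_integral a b f = (\<integral>x. indicator (annulus a b) x * f x \<partial>lborel)"

lemma integrable_annulus:
  fixes f :: "'a::euclidean_space \<Rightarrow> real"
  assumes "continuous_on (annulus a b) f"
  shows "integrable lborel (\<lambda>x. indicator (annulus a b) x * f x)"
  using borel_integrable_compact[OF compact_annulus assms] by simp

lemma annulus_integral_mono:
  assumes "continuous_on (annulus a b) f" "continuous_on (annulus a b) g"
    "\<And>x. x \<in> annulus a b \<Longrightarrow> f x \<le> g x"
  shows "annulus_integral a b f \<le> annulus_integral a b g"
  unfolding annulus_integral_def
  by (intro integral_mono integrable_annulus assms) (auto simp: indicator_def assms)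

lemma annulus_integral_nonneg:
  assumes "\<And>x. x \<in> annulus a b \<Longrightarrow> 0 \<le> f x"
  shows "0 \<le> annulus_integral a b f"
  unfolding annulus_integral_def
  by (intro Bochner_Integration.integral_nonneg) (auto simp: indicator_def assms)

lemma annulus_integral_cmult:
  "annulus_integral a b (\<lambda>x. c * f x) = c * annulus_integral a b f"
  by (simp add: annulus_integral_def mult.left_commute)

text \<open>
  The graph of a convex power lies above its tangent at \<open>m\<close>; this is Young's inequality for
  \<open>s\<close> and \<open>m powr (r - 1)\<close>.
\<close>

lemma powr_tangent:
  fixes s m r :: real
  assumes "s \<ge> 0" "m > 0" "r > 1"
  shows "r * m powr (r - 1) * s - (r - 1) * m powr r \<le> s powr r"
proof -
  have "s * m powr (r - 1) \<le> s powr r / r + (m powr (r - 1)) powr (r / (r - 1)) / (r / (r - 1))"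
    using assms by (intro Youngs_inequality) (auto simp: field_simps)
  also have "(m powr (r - 1)) powr (r / (r - 1)) = m powr r" using assms by (simp add: powr_powr)
  finally show ?thesis using assms by (simp add: field_simps)
qed

text \<open>
  Integrate the tangent inequality at \<open>t = I / m\<close> with \<open>I\<close> the integral of \<open>s\<close>; this is the mean value of \<open>s\<close> if \<open>m\<close> is the measure of the annulus.
\<close>

lemma annulus_integral_Jensen:
  fixes s :: "'a::euclidean_space \<Rightarrow> real"
  assumes s: "continuous_on (annulus a b) s" "\<And>x. x \<in> annulus a b \<Longrightarrow> 0 \<le> s x"
    and r: "r > 1" and m: "measure lborel (annulus a b :: 'a set) \<le> m" "m > 0"
  shows "annulus_integral a b s powr r \<le> m powr (r - 1) * annulus_integral a b (\<lambda>x. s x powr r)"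
proof (cases "annulus_integral a b s = 0")
  case True
  have "0 \<le> annulus_integral a b (\<lambda>x. s x powr r)" by (intro annulus_integral_nonneg) simp
  then show ?thesis using True by simp
next
  case False
  define I where "I = annulus_integral a b s"
  have I: "I > 0" using False annulus_integral_nonneg[of a b s] s(2) by (simp add: I_def)
  define t where "t = I / m"
  have t: "t > 0" using I m by (simp add: t_def)
  have fin: "integrable lborel (indicator (annulus a b :: 'a set) :: _ \<Rightarrow> real)"
    using integrable_annulus[of a b "\<lambda>_::'a. 1"] by simp
  have ms: "(\<integral>x. indicator (annulus a b :: 'a set) x \<partial>lborel) = measure lborel (annulus a b :: 'a set)"
    by simp
  have "t powr (r - 1) * I = r * t powr (r - 1) * I - (r - 1) * (t powr r * m)"
  proof -
    have "t powr r = t powr (r - 1) * t" using t by (simp add: powr_diff)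
    then have "t powr r * m = t powr (r - 1) * I" using m by (simp add: t_def)
    then show ?thesis by (simp add: algebra_simps)
  qed
  also have "\<dots> \<le> r * t powr (r - 1) * I - (r - 1) * (t powr r * measure lborel (annulus a b :: 'a set))"
    using r m by (intro diff_left_mono mult_left_mono) auto
  also have "\<dots> = (\<integral>x. r * t powr (r - 1) * (indicator (annulus a b) x * s x) - (r - 1) * t powr r * indicator (annulus a b) x \<partial>lborel)"
    using integrable_annulus[OF s(1)] fin
    by (simp add: I_def annulus_integral_def ms)
  also have "\<dots> \<le> annulus_integral a b (\<lambda>x. s x powr r)"
    unfolding annulus_integral_def
  proof (rule integral_mono)
    show "integrable lborel (\<lambda>x. indicator (annulus a b) x * s x powr r)"
      using s r by (intro integrable_annulus continuous_on_powr' continuous_intros) auto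
    show "integrable lborel (\<lambda>x. r * t powr (r - 1) * (indicator (annulus a b) x * s x) - (r - 1) * t powr r * indicator (annulus a b) x)"
      using integrable_annulus[OF s(1)] fin by simp
    show "r * t powr (r - 1) * (indicator (annulus a b) x * s x) - (r - 1) * t powr r * indicator (annulus a b) x
        \<le> indicator (annulus a b) x * s x powr r" for x
      using powr_tangent[of "s x" t r] s(2) t r by (auto simp: indicator_def)
  qed
  finally have *: "t powr (r - 1) * I \<le> annulus_integral a b (\<lambda>x. s x powr r)" .
  have "I powr r = I powr (r - 1) * I" using I by (simp add: powr_diff)
  also have "\<dots> = m powr (r - 1) * (t powr (r - 1) * I)"
    using I m by (simp add: t_def powr_divide)
  also have "\<dots> \<le> m powr (r - 1) * annulus_integral a b (\<lambda>x. s x powr r)"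
    using * by (intro mult_left_mono) auto
  finally show ?thesis by (simp add: I_def)
qed

locale cutoff =
  fixes k n :: nat and G :: "nat \<Rightarrow> real \<Rightarrow> real" and K :: real
  assumes smooth: "deriv_seq (2 * k) UNIV G"
    and one: "t \<le> 1 \<Longrightarrow> G 0 t = 1" and zero: "t \<ge> 2 \<Longrightarrow> G 0 t = 0"
    and nonneg: "0 \<le> G 0 t" and le_one: "G 0 t \<le> 1" and K: "K > 0"
    and op_zero: "t \<notin> {1..2} \<Longrightarrow> (radial_op n ^^ k) G 0 t = 0"
    and op_le: "\<bar>(radial_op n ^^ k) G 0 t\<bar> \<le> K"
begin

abbreviation \<theta> :: "real \<Rightarrow> real" where "\<theta> \<equiv> (radial_op n ^^ k) G 0"

lemma cont_cut [continuous_intros]: "continuous_on A (\<lambda>x. G 0 (x \<bullet> x / S))" for A :: "'a::euclidean_space set"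
proof (cases "S = 0")
  case False
  have "continuous_on UNIV (G 0)" using deriv_seq_continuous_on[OF smooth] by simp
  then show ?thesis
    by (rule continuous_on_compose2[of UNIV "G 0"]) (use False in \<open>auto intro!: continuous_intros\<close>)
qed simp

lemma cont_op [continuous_intros]: "continuous_on A (\<lambda>x. \<theta> (x \<bullet> x / S))" for A :: "'a::euclidean_space set"
proof (cases "S = 0")
  case False
  have "continuous_on UNIV \<theta>"
    using deriv_seq_continuous_on[OF deriv_seq_radial_op_pow[of 0 k UNIV G]] smooth by simp
  then show ?thesis
    by (rule continuous_on_compose2[of UNIV \<theta>]) (use False in \<open>auto intro!: continuous_intros\<close>)
qed simp

text \<open>
  Test the inequality \<open>c w \<le> (-\<Delta>)\<^sup>k u\<close> with the cutoff at scale \<open>S\<close> minus the cutoff at scale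
  \<open>\<epsilon>\<close>. This difference is nonnegative, vanishes near the origin and agrees with the cutoff at scale \<open>S\<close> where
  \<open>|x|\<^sup>2 \<ge> 1\<close>. Its \<open>k\<close>-th iterated Laplacian lives on the annuli at the two scales. On the inner one
  it is of size \<open>\<epsilon>\<^bsup>-k\<^esup>\<close>, the function \<open>u\<close> is bounded and the volume is of order
  \<open>\<epsilon>\<^bsup>n/2\<^esup>\<close>, so this part disappears in the limit.
\<close>

lemma test_inequality:
  fixes u w :: "'a::euclidean_space \<Rightarrow> real"
  assumes n: "n = DIM('a)" "2 * k < DIM('a)"
    and u: "C_on (2 * k) (- {0}) u" "continuous_on UNIV u" "\<And>x. 0 \<le> u x"
    and w: "continuous_on (- {0}) w" "\<And>x. x \<noteq> 0 \<Longrightarrow> 0 \<le> w x"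
    and c: "c > 0" "\<And>x. x \<noteq> 0 \<Longrightarrow> c * w x \<le> neg_laplacian_pow k u x"
    and S: "S \<ge> 1"
  shows "c * annulus_integral 1 (2 * S) (\<lambda>x. w x * G 0 (x \<bullet> x / S)) \<le>
     annulus_integral S (2 * S) (\<lambda>x. u x * \<bar>\<theta> (x \<bullet> x / S)\<bar>) / S ^ k" (is "?L \<le> ?R")
proof -
  have contL: "continuous_on (- {0}) (neg_laplacian_pow k u)"
    using C_on_imp_continuous_on[OF C_on_neg_laplacian_pow[of "- {0}" k 0 u]] u by (simp add: open_Compl)
  obtain M where M: "\<And>x. x \<in> cball 0 1 \<Longrightarrow> u x \<le> M"
  proof -
    have "compact (u ` cball 0 1)"
      using u(2) by (intro compact_continuous_image continuous_on_subset[OF u(2)]) auto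
    then have "bounded (u ` cball 0 1)" by (rule compact_imp_bounded)
    then obtain M where "\<forall>x\<in>cball 0 1. \<bar>u x\<bar> \<le> M" by (auto simp: bounded_iff)
    then show thesis using that by (meson abs_le_D1)
  qed
  have M0: "M \<ge> 0" using M[of 0] u(3)[of 0] by auto
  \<comment> \<open>The volume of the ball of radius \<open>\<surd>2\<close>, which contains the inner annulus for \<open>\<epsilon> = 1\<close>.\<close>
  define V where "V = unit_ball_vol (DIM('a)) * sqrt 2 ^ DIM('a)"
  have V: "V \<ge> 0" by (simp add: V_def unit_ball_vol_def)
  have key: "?L \<le> ?R + M * K * V * \<delta>" if \<delta>: "0 < \<delta>" "\<delta> \<le> 1/2" for \<delta>
  proof -
    \<comment> \<open>In terms of \<open>\<delta>\<close>, the error \<open>\<epsilon>\<^bsup>n/2 - k\<^esup>\<close> is a natural power of exponent at least one.\<close>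
    define \<epsilon> where "\<epsilon> = \<delta>\<^sup>2"
    have "\<delta>\<^sup>2 \<le> (1/2)\<^sup>2" using \<delta> by (intro power_mono) auto
    then have e: "0 < \<epsilon>" "\<epsilon> \<le> 1/4" using \<delta> by (auto simp: \<epsilon>_def power2_eq_square)
    define H where "H i t = G i (t / S) / S ^ i - G i (t / \<epsilon>) / \<epsilon> ^ i" for i t
    define h :: "'a \<Rightarrow> real" where "h x = H 0 (x \<bullet> x)" for x
    let ?E = "annulus \<epsilon> (2 * S) :: 'a set"
    have H: "deriv_seq (2 * k) UNIV H"
      unfolding H_def[abs_def] using S e by (intro deriv_seq_diff deriv_seq_scale smooth) auto
    have hC: "C_on (2 * k) UNIV h" using C_on_radial[OF open_UNIV H] by (simp add: h_def[abs_def])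
    have h: "h x = G 0 (x \<bullet> x / S) - G 0 (x \<bullet> x / \<epsilon>)" for x by (simp add: h_def H_def)
    have h0: "h x = 0" if "x \<notin> ?E" for x
    proof -
      consider "x \<bullet> x < \<epsilon>" | "x \<bullet> x > 2 * S" using \<open>x \<notin> ?E\<close> by (auto simp: annulus_def)
      then show ?thesis
      proof cases
        case 1
        then have "x \<bullet> x / S \<le> 1" "x \<bullet> x / \<epsilon> \<le> 1" using e S by auto
        then show ?thesis by (simp add: h one)
      next
        case 2
        then have "x \<bullet> x / S \<ge> 2" "x \<bullet> x / \<epsilon> \<ge> 2" using e S by (auto simp: field_simps)
        then show ?thesis by (simp add: h zero)
      qed
    qed
    have hn: "0 \<le> h x" for x
    proof (cases "x \<bullet> x \<le> S")
      case True
      then have "G 0 (x \<bullet> x / S) = 1" using S by (intro one) auto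
      then show ?thesis using le_one by (simp add: h)
    next
      case False
      then have "G 0 (x \<bullet> x / \<epsilon>) = 0" using S e by (intro zero) (auto simp: field_simps)
      then show ?thesis using nonneg by (simp add: h)
    qed
    have Lh: "neg_laplacian_pow k h x = \<theta> (x \<bullet> x / S) / S ^ k - \<theta> (x \<bullet> x / \<epsilon>) / \<epsilon> ^ k" for x
      using neg_laplacian_pow_radial[OF open_UNIV H, of x] S e radial_op_pow_diff[of k n "\<lambda>i t. G i (t / S) / S ^ i" "\<lambda>i t. G i (t / \<epsilon>) / \<epsilon> ^ i"]
      by (simp add: h_def[abs_def] H_def[abs_def] radial_op_pow_scale n)
    have E0: "?E \<subseteq> - {0}" using e by (auto simp: annulus_def)
    have E1: "annulus 1 b \<subseteq> - {0}" for b :: real by (auto simp: annulus_def)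
    have "?L = (\<integral>x. indicator (annulus 1 (2 * S)) x * (c * (w x * G 0 (x \<bullet> x / S))) \<partial>lborel)"
      unfolding annulus_integral_cmult[symmetric] unfolding annulus_integral_def ..
    also have "\<dots> \<le> (\<integral>x. neg_laplacian_pow k u x * h x \<partial>lborel)"
    proof (rule integral_mono)
      show "integrable lborel (\<lambda>x. indicator (annulus 1 (2 * S)) x * (c * (w x * G 0 (x \<bullet> x / S))))"
        by (intro integrable_annulus continuous_intros continuous_on_subset[OF w(1) E1])
      show "integrable lborel (\<lambda>x. neg_laplacian_pow k u x * h x)"
        using h0 by (intro integrable_compact_support[OF compact_annulus[of \<epsilon> "2 * S"]])
          (auto simp: h intro!: continuous_intros continuous_on_subset[OF contL E0])
      show "indicator (annulus 1 (2 * S)) x * (c * (w x * G 0 (x \<bullet> x / S))) \<le> neg_laplacian_pow k u x * h x" for x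
      proof (cases "x \<in> annulus 1 (2 * S)")
        case True
        then have x: "x \<noteq> 0" "x \<bullet> x \<ge> 1" by (auto simp: annulus_def)
        then have "G 0 (x \<bullet> x / \<epsilon>) = 0" using e by (intro zero) (auto simp: field_simps)
        then show ?thesis using True mult_right_mono[OF c(2)[OF x(1)] hn[of x]] by (simp add: h mult.assoc)
      next
        case False
        show ?thesis
        proof (cases "x = 0")
          case True then show ?thesis using False h0[of x] E0 by auto
        next
          case nz: False
          have "0 \<le> neg_laplacian_pow k u x"
            using c(1) c(2)[OF nz] w(2)[OF nz] by (meson mult_nonneg_nonneg less_imp_le order_trans)
          then show ?thesis using False hn[of x] by simp
        qed
      qed
    qed
    also have "\<dots> = (\<integral>x. u x * neg_laplacian_pow k h x \<partial>lborel)"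
      using integral_neg_laplacian_pow_symmetric[OF _ compact_annulus E0 u(1) hC h0] by (simp add: open_Compl)
    also have "\<dots> \<le> (\<integral>x. indicator (annulus S (2 * S)) x * (u x * \<bar>\<theta> (x \<bullet> x / S)\<bar>) / S ^ k
        + indicator (annulus \<epsilon> (2 * \<epsilon>)) x * (M * K) / \<epsilon> ^ k \<partial>lborel)"
    proof (rule integral_mono)
      have "continuous_on UNIV (neg_laplacian_pow k h)"
        unfolding Lh by (intro continuous_intros) (use S e in auto)
      then show "integrable lborel (\<lambda>x. u x * neg_laplacian_pow k h x)"
        using neg_laplacian_pow_eq_0_off[of ?E h, OF compact_imp_closed[OF compact_annulus] h0]
        by (intro integrable_compact_support[OF compact_annulus[of \<epsilon> "2 * S"]])
           (auto intro!: continuous_intros intro: continuous_on_subset u(2))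
      show "integrable lborel (\<lambda>x. indicator (annulus S (2 * S)) x * (u x * \<bar>\<theta> (x \<bullet> x / S)\<bar>) / S ^ k
        + indicator (annulus \<epsilon> (2 * \<epsilon>)) x * (M * K) / \<epsilon> ^ k)"
        by (intro Bochner_Integration.integrable_add integrable_divide integrable_annulus continuous_intros
             continuous_on_subset[OF u(2)]) auto
      fix x
      have a: "u x * (\<theta> (x \<bullet> x / S) / S ^ k) \<le> indicator (annulus S (2 * S)) x * (u x * \<bar>\<theta> (x \<bullet> x / S)\<bar>) / S ^ k"
      proof (cases "x \<in> annulus S (2 * S)")
        case True
        have "u x * \<theta> (x \<bullet> x / S) \<le> u x * \<bar>\<theta> (x \<bullet> x / S)\<bar>" using u(3) by (intro mult_left_mono) auto
        then show ?thesis using True S by (simp add: divide_right_mono)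
      next
        case False
        then have "\<theta> (x \<bullet> x / S) = 0" using S by (intro op_zero) (auto simp: annulus_def field_simps)
        then show ?thesis using False by simp
      qed
      have b: "- (u x * (\<theta> (x \<bullet> x / \<epsilon>) / \<epsilon> ^ k)) \<le> indicator (annulus \<epsilon> (2 * \<epsilon>)) x * (M * K) / \<epsilon> ^ k"
      proof (cases "x \<in> annulus \<epsilon> (2 * \<epsilon>)")
        case True
        then have "x \<bullet> x \<le> 1" using e by (auto simp: annulus_def)
        then have "u x \<le> M" by (intro M) (simp add: norm_eq_sqrt_inner)
        then have "u x * \<bar>\<theta> (x \<bullet> x / \<epsilon>)\<bar> \<le> M * K"
          using M0 op_le[of "x \<bullet> x / \<epsilon>"] by (intro mult_mono) auto
        moreover have "u x * (- \<theta> (x \<bullet> x / \<epsilon>)) \<le> u x * \<bar>\<theta> (x \<bullet> x / \<epsilon>)\<bar>"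
          using u(3) by (intro mult_left_mono) auto
        ultimately have "u x * (- \<theta> (x \<bullet> x / \<epsilon>)) \<le> M * K" by linarith
        then have "u x * (- \<theta> (x \<bullet> x / \<epsilon>)) / \<epsilon> ^ k \<le> M * K / \<epsilon> ^ k"
          using e by (intro divide_right_mono) auto
        then show ?thesis using True by simp
      next
        case False
        then have "\<theta> (x \<bullet> x / \<epsilon>) = 0" using e by (intro op_zero) (auto simp: annulus_def field_simps)
        then show ?thesis using False by simp
      qed
      show "u x * neg_laplacian_pow k h x \<le> indicator (annulus S (2 * S)) x * (u x * \<bar>\<theta> (x \<bullet> x / S)\<bar>) / S ^ k
        + indicator (annulus \<epsilon> (2 * \<epsilon>)) x * (M * K) / \<epsilon> ^ k"
        unfolding Lh right_diff_distrib using a b by linarith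
    qed
    also have "\<dots> = ?R + M * K * measure lborel (annulus \<epsilon> (2 * \<epsilon>) :: 'a set) / \<epsilon> ^ k"
    proof -
      have "integrable lborel (\<lambda>x::'a. indicator (annulus S (2 * S)) x * (u x * \<bar>\<theta> (x \<bullet> x / S)\<bar>))"
        by (intro integrable_annulus continuous_intros continuous_on_subset[OF u(2)]) auto
      moreover have "integrable lborel (indicator (annulus \<epsilon> (2 * \<epsilon>)) :: 'a \<Rightarrow> real)"
        using integrable_annulus[of \<epsilon> "2 * \<epsilon>" "\<lambda>_::'a. 1"] by simp
      ultimately show ?thesis
        by (simp add: annulus_integral_def)
    qed
    also have "\<dots> \<le> ?R + M * K * (V * \<delta> ^ DIM('a)) / \<epsilon> ^ k"
    proof -
      have "measure lborel (annulus \<epsilon> (2 * \<epsilon>) :: 'a set) \<le> measure lborel (cball (0::'a) (sqrt (2 * \<epsilon>)))"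
        by (intro measure_mono_fmeasurable annulus_subset_cball fmeasurable_compact)
      (auto simp: compact_imp_closed compact_annulus)
      also have "\<dots> = unit_ball_vol DIM('a) * sqrt (2 * \<epsilon>) ^ DIM('a)"
        using e content_cball[of "sqrt (2 * \<epsilon>)" "0::'a"] by simp
      also have "sqrt (2 * \<epsilon>) = sqrt 2 * \<delta>" using \<delta> by (simp add: \<epsilon>_def real_sqrt_mult)
      finally have "measure lborel (annulus \<epsilon> (2 * \<epsilon>) :: 'a set) \<le> V * \<delta> ^ DIM('a)"
        by (simp add: V_def power_mult_distrib mult.assoc)
      then show ?thesis using e M0 K by (intro add_left_mono divide_right_mono mult_left_mono) auto
    qed
    also have "M * K * (V * \<delta> ^ DIM('a)) / \<epsilon> ^ k = M * K * V * \<delta> ^ (DIM('a) - 2 * k)"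
      using \<delta> n(2) by (simp add: \<epsilon>_def power_diff flip: power_mult)
    also have "\<dots> \<le> M * K * V * \<delta> ^ 1"
      using \<delta> n(2) M0 K V by (intro mult_left_mono power_decreasing) auto
    finally show ?thesis by simp
  qed
  show ?thesis
  proof (rule field_le_epsilon)
    fix e :: real assume e: "e > 0"
    define D where "D = M * K * V"
    have D: "D \<ge> 0" using M0 K V by (simp add: D_def)
    define \<delta> where "\<delta> = min (1/2) (e / (D + 1))"
    have "0 < \<delta>" using D e by (simp add: \<delta>_def)
    moreover have "\<delta> \<le> 1/2" unfolding \<delta>_def by (rule min.cobounded1)
    moreover have "D * \<delta> \<le> e"
    proof -
      have "D * \<delta> \<le> D * (e / (D + 1))" using D by (intro mult_left_mono) (auto simp: \<delta>_def)
      also have "\<dots> \<le> e" using D e by (simp add: field_simps)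
      finally show ?thesis .
    qed
    ultimately show "?L \<le> ?R + e" using key[of \<delta>] by (simp add: D_def)
  qed
qed

text \<open>
  The bound on the iterated Laplacian of the cutoff allows Jensen's inequality with
  exponent \<open>p\<close> on the right-hand side of \<open>test_inequality\<close>. The exponent of \<open>S\<close> collects the volume of the
  annulus to the power \<open>p - 1\<close>, the weight \<open>|x|\<^bsup>\<sigma>\<^esup>\<close> and the \<open>p\<close>-th power of the factor \<open>S\<^bsup>-k\<^esup>\<close>.
\<close>

lemma power_inequality:
  fixes u w :: "'a::euclidean_space \<Rightarrow> real"
  assumes n: "n = DIM('a)" "2 * k < DIM('a)"
    and u: "C_on (2 * k) (- {0}) u" "continuous_on UNIV u" "\<And>x. 0 < u x"
    and w: "continuous_on (- {0}) w" "\<And>x. x \<noteq> 0 \<Longrightarrow> 0 \<le> w x"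
    and c: "c > 0" "\<And>x. x \<noteq> 0 \<Longrightarrow> c * w x \<le> neg_laplacian_pow k u x"
    and p: "p > 1" and \<sigma>: "\<sigma> \<ge> 0"
    and op_le_powr: "\<And>t. \<bar>\<theta> t\<bar> \<le> K * G 0 t powr (1 / p)"
  shows "\<exists>C>0. \<forall>S\<ge>1. annulus_integral 1 (2 * S) (\<lambda>x. w x * G 0 (x \<bullet> x / S)) powr p \<le>
     C * S powr (real n / 2 * (p - 1) + \<sigma> / 2 - real k * p) *
     annulus_integral S (2 * S) (\<lambda>x. u x powr p / norm x powr \<sigma> * G 0 (x \<bullet> x / S))"
proof -
  define V where "V = unit_ball_vol (DIM('a))"
  have V: "V > 0" by (simp add: V_def)
  define C where "C = (K / c) powr p * (V powr (p - 1) * 2 powr (real n / 2 * (p - 1)) * 2 powr (\<sigma> / 2))"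
  have C: "C > 0" using V K c by (simp add: C_def)
  have "annulus_integral 1 (2 * S) (\<lambda>x. w x * G 0 (x \<bullet> x / S)) powr p \<le>
     C * S powr (real n / 2 * (p - 1) + \<sigma> / 2 - real k * p) *
     annulus_integral S (2 * S) (\<lambda>x. u x powr p / norm x powr \<sigma> * G 0 (x \<bullet> x / S))"
    (is "?X powr p \<le> _ * _ * ?y") if S: "S \<ge> 1" for S
  proof -
    let ?s = "\<lambda>x::'a. u x * G 0 (x \<bullet> x / S) powr (1 / p)"
    let ?I = "annulus_integral S (2 * S) ?s"
    have A0: "annulus S (2 * S) \<subseteq> - {0 :: 'a}" using S by (auto simp: annulus_def)
    have A1: "annulus 1 b \<subseteq> - {0 :: 'a}" for b by (auto simp: annulus_def)
    have cu: "continuous_on A u" for A using continuous_on_subset[OF u(2)] by auto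
    have cs: "continuous_on A ?s" for A
      using nonneg p by (intro continuous_on_mult cu continuous_on_powr' cont_cut continuous_on_const) auto
    have cy: "continuous_on (annulus S (2 * S)) (\<lambda>x. u x powr p / norm x powr \<sigma> * G 0 (x \<bullet> x / S))"
      using A0 u(3) by (intro continuous_intros cu) (auto simp: less_imp_neq[symmetric])
    have X0: "0 \<le> ?X"
      by (intro annulus_integral_nonneg mult_nonneg_nonneg nonneg w(2)) (auto simp: annulus_def)
    have I0: "0 \<le> ?I" using u(3) less_imp_le by (intro annulus_integral_nonneg mult_nonneg_nonneg) auto
    have y0: "0 \<le> ?y" using nonneg by (intro annulus_integral_nonneg mult_nonneg_nonneg) auto
    have "c * ?X \<le> annulus_integral S (2 * S) (\<lambda>x. u x * \<bar>\<theta> (x \<bullet> x / S)\<bar>) / S ^ k"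
      using test_inequality[OF n u(1,2) less_imp_le[OF u(3)] w c S] .
    also have "\<dots> \<le> annulus_integral S (2 * S) (\<lambda>x. K * ?s x) / S ^ k"
    proof (intro divide_right_mono annulus_integral_mono)
      show "continuous_on (annulus S (2 * S)) (\<lambda>x. u x * \<bar>\<theta> (x \<bullet> x / S)\<bar>)"
        by (intro continuous_intros cu)
      show "continuous_on (annulus S (2 * S)) (\<lambda>x. K * ?s x)"
        by (rule continuous_on_mult[OF continuous_on_const cs])
      show "u x * \<bar>\<theta> (x \<bullet> x / S)\<bar> \<le> K * ?s x" for x
        using mult_left_mono[OF op_le_powr[of "x \<bullet> x / S"] less_imp_le[OF u(3)[of x]]] by (simp add: mult_ac)
    qed (use S in auto)
    also have "\<dots> = K * ?I / S ^ k" by (simp add: annulus_integral_cmult)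
    finally have "?X * c \<le> K * ?I / S ^ k" by (simp only: mult.commute[of c])
    then have "?X \<le> K * ?I / S ^ k / c" using c(1) by (simp only: pos_le_divide_eq)
    then have "?X \<le> K / c * ?I / S ^ k" by (simp add: mult.commute)
    then have "?X powr p \<le> (K / c * ?I / S ^ k) powr p"
      using X0 p by (intro powr_mono2) auto
    also have "\<dots> = (K / c) powr p * S powr (- real k * p) * ?I powr p"
      using K c I0 S by (simp add: powr_mult powr_divide powr_powr powr_minus_divide flip: powr_realpow)
    also have "?I powr p \<le> (V * (2 * S) powr (real n / 2)) powr (p - 1) * annulus_integral S (2 * S) (\<lambda>x. ?s x powr p)"
    proof (rule annulus_integral_Jensen[OF cs _ p])
      show "0 \<le> ?s x" for x using less_imp_le[OF u(3)] by simp
      show "measure lborel (annulus S (2 * S) :: 'a set) \<le> V * (2 * S) powr (real n / 2)"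
        using measure_annulus_le[of "2 * S" S, where 'a='a] S by (simp add: V_def n)
      show "0 < V * (2 * S) powr (real n / 2)" using V S by simp
    qed
    also have "annulus_integral S (2 * S) (\<lambda>x. ?s x powr p) \<le> annulus_integral S (2 * S)
        (\<lambda>x. (2 * S) powr (\<sigma> / 2) * (u x powr p / norm x powr \<sigma> * G 0 (x \<bullet> x / S)))"
    proof (intro annulus_integral_mono)
      show "continuous_on (annulus S (2 * S)) (\<lambda>x. ?s x powr p)"
        using less_imp_le[OF u(3)] p by (intro continuous_on_powr' cs continuous_on_const) auto
      show "continuous_on (annulus S (2 * S)) (\<lambda>x. (2 * S) powr (\<sigma> / 2) * (u x powr p / norm x powr \<sigma> * G 0 (x \<bullet> x / S)))"
        by (intro continuous_on_mult continuous_on_const cy)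
      fix x :: 'a assume x: "x \<in> annulus S (2 * S)"
      then have "x \<noteq> 0" using A0 by auto
      have "norm x = (x \<bullet> x) powr (1 / 2)" by (simp add: norm_eq_sqrt_inner powr_half_sqrt)
      also have "\<dots> \<le> (2 * S) powr (1 / 2)" using x by (intro powr_mono2) (auto simp: annulus_def)
      finally have "norm x powr \<sigma> \<le> ((2 * S) powr (1 / 2)) powr \<sigma>" using \<sigma> by (intro powr_mono2) auto
      then have *: "norm x powr \<sigma> \<le> (2 * S) powr (\<sigma> / 2)" by (simp add: powr_powr)
      have "?s x powr p = u x powr p * G 0 (x \<bullet> x / S)"
        using less_imp_le[OF u(3)] nonneg p by (simp add: powr_mult powr_powr)
      also have "\<dots> = norm x powr \<sigma> * (u x powr p / norm x powr \<sigma> * G 0 (x \<bullet> x / S))"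
        using \<open>x \<noteq> 0\<close> by simp
      also have "\<dots> \<le> (2 * S) powr (\<sigma> / 2) * (u x powr p / norm x powr \<sigma> * G 0 (x \<bullet> x / S))"
        using * nonneg by (intro mult_right_mono) auto
      finally show "?s x powr p \<le> (2 * S) powr (\<sigma> / 2) * (u x powr p / norm x powr \<sigma> * G 0 (x \<bullet> x / S))" .
    qed
    also have "\<dots> = (2 * S) powr (\<sigma> / 2) * ?y" by (rule annulus_integral_cmult)
    finally have "?X powr p \<le> (K / c) powr p * S powr (- real k * p) *
       ((V * (2 * S) powr (real n / 2)) powr (p - 1) * ((2 * S) powr (\<sigma> / 2) * ?y))"
      using K c by (simp add: mult_left_mono)
    also have "\<dots> = C * S powr (real n / 2 * (p - 1) + \<sigma> / 2 - real k * p) * ?y"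
    proof -
      have "(V * (2 * S) powr (real n / 2)) powr (p - 1) =
         V powr (p - 1) * (2 powr (real n / 2 * (p - 1)) * S powr (real n / 2 * (p - 1)))"
        using V S by (simp add: powr_mult powr_powr)
      moreover have "(2 * S) powr (\<sigma> / 2) = 2 powr (\<sigma> / 2) * S powr (\<sigma> / 2)" using S by (simp add: powr_mult)
      moreover have "S powr (real n / 2 * (p - 1) + \<sigma> / 2 - real k * p) =
         S powr (real n / 2 * (p - 1)) * S powr (\<sigma> / 2) * S powr (- real k * p)"
        by (simp flip: powr_add)
      ultimately show ?thesis by (simp add: C_def mult_ac)
    qed
    finally show ?thesis .
  qed
  with C show ?thesis by blast
qed

end

section \<open>Growth of mass and nonexistence\<close>

context cutoff
begin

text \<open>
  The cut-off integral of \<open>w\<close> over \<open>|x|\<^sup>2 \<ge> a\<close>: for \<open>a = 1\<close> it is the total mass at scale \<open>S\<close>, for \<open>a = S\<close>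
  only the part where the cutoff decreases.
\<close>

definition mass :: "('a::euclidean_space \<Rightarrow> real) \<Rightarrow> real \<Rightarrow> real \<Rightarrow> real" where
  "mass w a S = annulus_integral a (2 * S) (\<lambda>x. w x * G 0 (x \<bullet> x / S))"

context
  fixes w :: "'a::euclidean_space \<Rightarrow> real"
  assumes w: "continuous_on (- {0}) w" "\<And>x. x \<noteq> 0 \<Longrightarrow> 0 < w x"
begin

lemma integrable_mass:
  assumes "a > 0"
  shows "integrable lborel (\<lambda>x. indicator (annulus a b) x * (w x * G 0 (x \<bullet> x / S)))"
  using assms by (intro integrable_annulus continuous_on_mult cont_cut continuous_on_subset[OF w(1)])
    (auto simp: annulus_def)

lemma weight_nonneg: "x \<noteq> 0 \<Longrightarrow> 0 \<le> w x * G 0 (x \<bullet> x / S)"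
  using w(2) nonneg by (simp add: less_imp_le)

lemma mass_nonneg: "a > 0 \<Longrightarrow> 0 \<le> mass w a S"
  unfolding mass_def by (intro annulus_integral_nonneg weight_nonneg) (auto simp: annulus_def)

lemma mass_antimono:
  assumes "0 < a" "a \<le> b" shows "mass w b S \<le> mass w a S"
  unfolding mass_def annulus_integral_def
  by (intro integral_mono integrable_mass)
     (use assms in \<open>auto simp: indicator_def annulus_def intro!: weight_nonneg\<close>)

lemma mass_mono:
  assumes "S \<ge> 1" shows "mass w 1 S \<le> mass w 1 (2 * S)"
  unfolding mass_def annulus_integral_def
proof (intro integral_mono integrable_mass)
  fix x :: 'a
  have "G 0 (x \<bullet> x / S) \<le> G 0 (x \<bullet> x / (2 * S))"
  proof (cases "x \<bullet> x \<le> 2 * S")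
    case True
    then have "G 0 (x \<bullet> x / (2 * S)) = 1" using assms by (intro one) (simp add: field_simps)
    then show ?thesis using le_one by simp
  next
    case False
    then have "G 0 (x \<bullet> x / S) = 0" using assms by (intro zero) (simp add: field_simps)
    then show ?thesis using nonneg by simp
  qed
  moreover have "x \<in> annulus 1 (2 * S) \<Longrightarrow> x \<in> annulus 1 (2 * (2 * S)) \<and> x \<noteq> 0"
    using assms by (auto simp: annulus_def)
  ultimately show "indicator (annulus 1 (2 * S)) x * (w x * G 0 (x \<bullet> x / S)) \<le>
     indicator (annulus 1 (2 * (2 * S))) x * (w x * G 0 (x \<bullet> x / (2 * S)))"
    using mult_left_mono[of "G 0 (x \<bullet> x / S)" "G 0 (x \<bullet> x / (2 * S))" "w x"]
      less_imp_le[OF w(2)[of x]] weight_nonneg[of x "2 * S"]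
    by (cases "x = 0") (auto simp: indicator_def annulus_def)
qed simp_all

text \<open>
  The cutoff at scale \<open>S\<close> vanishes where the annulus at scale \<open>2 S\<close> begins, and the cutoff at scale \<open>4 S\<close> is still \<open>1\<close>
  where that annulus ends.
\<close>

lemma mass_increment:
  assumes "S \<ge> 1" shows "mass w (2 * S) (2 * S) + mass w 1 S \<le> mass w 1 (4 * S)"
proof -
  have "mass w (2 * S) (2 * S) + mass w 1 S =
    (\<integral>x. indicator (annulus (2 * S) (2 * (2 * S))) x * (w x * G 0 (x \<bullet> x / (2 * S)))
      + indicator (annulus 1 (2 * S)) x * (w x * G 0 (x \<bullet> x / S)) \<partial>lborel)"
    using assms integrable_mass[of "2 * S" "2 * (2 * S)" "2 * S"] integrable_mass[of 1 "2 * S" S]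
    by (simp add: mass_def annulus_integral_def)
  also have "\<dots> \<le> mass w 1 (4 * S)"
    unfolding mass_def annulus_integral_def
  proof (intro integral_mono Bochner_Integration.integrable_add integrable_mass)
    fix x :: 'a
    let ?r = "x \<bullet> x"
    consider "?r < 1" | "1 \<le> ?r" "?r < 2 * S" | "1 \<le> ?r" "2 * S \<le> ?r" "?r \<le> 4 * S" | "?r > 4 * S"
      by linarith
    then show "indicator (annulus (2 * S) (2 * (2 * S))) x * (w x * G 0 (?r / (2 * S)))
      + indicator (annulus 1 (2 * S)) x * (w x * G 0 (?r / S)) \<le>
      indicator (annulus 1 (2 * (4 * S))) x * (w x * G 0 (?r / (4 * S)))"
    proof cases
      case 1
      then show ?thesis using assms by (simp add: annulus_def)
    next
      case 2
      have "x \<noteq> 0" using 2 by auto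
      have "G 0 (?r / (4 * S)) = 1" using 2 assms by (intro one) (simp add: field_simps)
      then show ?thesis using 2 assms w(2)[OF \<open>x \<noteq> 0\<close>] le_one[of "?r / S"] by (simp add: annulus_def mult_left_le)
    next
      case 3
      have "x \<noteq> 0" using 3 by auto
      have "G 0 (?r / (4 * S)) = 1" using 3 assms by (intro one) (simp add: field_simps)
      moreover have "G 0 (?r / S) = 0" using 3 assms by (intro zero) (simp add: field_simps)
      ultimately show ?thesis
        using 3 assms w(2)[OF \<open>x \<noteq> 0\<close>] le_one[of "?r / (2 * S)"] by (simp add: annulus_def mult_left_le)
    next
      case 4
      then have "x \<noteq> 0" using assms by auto
      from 4 show ?thesis using weight_nonneg[OF \<open>x \<noteq> 0\<close>, of "4 * S"] assms by (simp add: annulus_def indicator_def)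
    qed
  qed (use assms in auto)
  finally show ?thesis .
qed

lemma mass_pos:
  assumes "S \<ge> 2" shows "mass w 1 S > 0"
proof -
  obtain b :: 'a where b: "b \<in> Basis" using nonempty_Basis by blast
  \<comment> \<open>A ball inside \<open>1 \<le> |x|\<^sup>2 \<le> 2\<close>, where the cutoff equals \<open>1\<close>.\<close>
  let ?B = "cball ((5/4) *\<^sub>R b) (1/8)"
  have B: "?B \<subseteq> annulus 1 2"
  proof
    fix x assume "x \<in> ?B"
    then have "norm ((5/4) *\<^sub>R b - x) \<le> 1/8" by (simp add: dist_norm)
    moreover have "norm ((5/4) *\<^sub>R b) = 5/4" using b by simp
    ultimately have "1 \<le> norm x" "norm x \<le> 11/8"
      using norm_triangle_ineq3[of "(5/4) *\<^sub>R b" x] by linarith+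
    then have "1\<^sup>2 \<le> (norm x)\<^sup>2" "(norm x)\<^sup>2 \<le> (11/8)\<^sup>2" by (intro power_mono; simp)+
    then show "x \<in> annulus 1 2" by (simp add: annulus_def dot_square_norm power2_eq_square)
  qed
  have "0 \<notin> annulus 1 2" by (simp add: annulus_def)
  with B have B0: "?B \<subseteq> - {0}" by blast
  obtain y where y: "y \<in> ?B" "\<And>x. x \<in> ?B \<Longrightarrow> w y \<le> w x"
    using continuous_attains_inf[OF compact_cball _ continuous_on_subset[OF w(1) B0]] by auto
  have wy: "w y > 0" using y(1) B0 by (intro w(2)) auto
  have "0 < measure lborel ?B" by (subst content_cball_gt_0_iff) simp
  then have "0 < w y * measure lborel ?B" using wy by simp
  also have "\<dots> = (\<integral>x. indicator ?B x * w y \<partial>lborel)" by simp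
  also have "\<dots> \<le> mass w 1 S"
    unfolding mass_def annulus_integral_def
  proof (intro integral_mono integrable_mass)
    show "integrable lborel (\<lambda>x. indicator ?B x * w y)"
      using borel_integrable_compact[of ?B "\<lambda>_. w y"] by simp
    fix x
    show "indicator ?B x * w y \<le> indicator (annulus 1 (2 * S)) x * (w x * G 0 (x \<bullet> x / S))"
    proof (cases "x \<in> ?B")
      case True
      then have x: "x \<in> annulus 1 2" using B by auto
      then have "G 0 (x \<bullet> x / S) = 1" using assms by (intro one) (simp add: annulus_def field_simps)
      then show ?thesis using True y(2)[OF True] x assms by (simp add: annulus_def)
    next
      case False
      then show ?thesis using weight_nonneg[of x S] by (cases "x = 0") (auto simp: indicator_def annulus_def)
    qed
  qed simp
  finally show ?thesis .
qed

text \<open>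
  Since the annulus carries at most the total mass and \<open>r > 1\<close>, the total mass is bounded. On the other hand
  the mass of the annulus is at least a fixed multiple of the \<open>r\<close>-th power of the total mass, which does not decrease, so by
  \<open>mass_increment\<close> every passage from scale \<open>S\<close> to \<open>4 S\<close> adds at least a fixed positive amount.
\<close>

lemma mass_superlinear_growth_impossible:
  assumes r: "r > 1" and C: "C > 0"
    and le: "\<And>S. S \<ge> 1 \<Longrightarrow> mass w 1 S powr r \<le> C * mass w S S"
  shows False
proof -
  define b where "b j = mass w 1 (4 ^ Suc j)" for j :: nat
  have S: "(4::real) ^ Suc j \<ge> 4" for j by simp
  have bpos: "b j > 0" for j unfolding b_def using S[of j] by (intro mass_pos) linarith
  have bound: "b j \<le> C powr (1 / (r - 1))" for j
  proof -
    have "b j powr r \<le> C * mass w (4 ^ Suc j) (4 ^ Suc j)"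
      unfolding b_def using S[of j] by (intro le) linarith
    also have "\<dots> \<le> C * b j" unfolding b_def using C one_le_power[of "4::real" "Suc j"] by (intro mult_left_mono mass_antimono) auto
    finally have "b j powr (r - 1) \<le> C" using bpos[of j] by (simp add: powr_diff divide_le_eq)
    then have "(b j powr (r - 1)) powr (1 / (r - 1)) \<le> C powr (1 / (r - 1))"
      using r by (intro powr_mono2) auto
    then show ?thesis using r bpos[of j] by (simp add: powr_powr)
  qed
  \<comment> \<open>The least amount by which the mass grows in every step.\<close>
  define d where "d = b 0 powr r / C"
  have d: "d > 0" using C bpos[of 0] by (simp add: d_def)
  have grow: "b 0 + real j * d \<le> b j" for j
  proof (induction j)
    case (Suc j)
    have S1: "(1::real) \<le> 4 ^ Suc j" using S[of j] by linarith
    have "0 \<le> real j * d" using d by simp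
    with Suc have "b 0 \<le> b j" by linarith
    also have "b j \<le> mass w 1 (2 * 4 ^ Suc j)" unfolding b_def by (rule mass_mono[OF S1])
    finally have "b 0 powr r \<le> mass w 1 (2 * 4 ^ Suc j) powr r"
      using r bpos[of 0] by (intro powr_mono2) auto
    also have "\<dots> \<le> C * mass w (2 * 4 ^ Suc j) (2 * 4 ^ Suc j)" using S1 by (intro le) linarith
    finally have "d \<le> mass w (2 * 4 ^ Suc j) (2 * 4 ^ Suc j)"
      using C by (simp add: d_def divide_le_eq mult.commute)
    also have "\<dots> \<le> b (Suc j) - b j"
      using mass_increment[OF S1] unfolding b_def power_Suc by linarith
    finally show ?case using Suc by (simp add: algebra_simps)
  qed simp
  obtain j :: nat where "C powr (1 / (r - 1)) < real j * d"
    using d reals_Archimedean3 by blast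
  with grow[of j] bound[of j] bpos[of 0] show False by linarith
qed

end

end

text \<open>
  Inserting one power inequality into the other gives \<open>X\<^bsup>pq\<^esup> \<le> C S\<^sup>e x\<close> for the total mass \<open>X\<close> and the
  annulus mass \<open>x\<close> of \<open>v\<^sup>q / |x|\<^bsup>\<sigma>1\<^esup>\<close>, where \<open>2 e = (n - 2k)(pq - 1) - (2k(q+1) - \<sigma>1 - \<sigma>2 q)\<close>. If the
  asserted inequality fails then \<open>e \<le> 0\<close>, and such a mass cannot exist.
\<close>

lemma coercive_system_nonexistence:
  fixes u v :: "'a::euclidean_space \<Rightarrow> real"
  assumes k: "k \<ge> 1" and n: "2 * k < DIM('a)"
    and p: "p > 1" and q: "q > 1" and \<sigma>: "\<sigma>\<^sub>1 \<ge> 0" "\<sigma>\<^sub>2 \<ge> 0"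
    and u: "C_on (2 * k) (- {0}) u" "continuous_on UNIV u" "\<And>x. 0 < u x"
    and v: "C_on (2 * k) (- {0}) v" "continuous_on UNIV v" "\<And>x. 0 < v x"
    and c: "c > 0" "d > 0"
    and Lu: "\<And>x. x \<noteq> 0 \<Longrightarrow> c * (v x powr q / norm x powr \<sigma>\<^sub>1) \<le> neg_laplacian_pow k u x"
    and Lv: "\<And>x. x \<noteq> 0 \<Longrightarrow> d * (u x powr p / norm x powr \<sigma>\<^sub>2) \<le> neg_laplacian_pow k v x"
  shows "(2 * real k * (q + 1) - (\<sigma>\<^sub>1 + \<sigma>\<^sub>2 * q)) / (p * q - 1) < real DIM('a) - 2 * real k"
proof (rule ccontr)
  assume neg: "\<not> ?thesis"
  have "1 * 1 < p * q" using p q by (intro mult_strict_mono) auto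
  then have pq: "p * q > 1" by simp
  let ?n = "real DIM('a)"
  have crit: "(?n - 2 * real k) * (p * q - 1) \<le> 2 * real k * (q + 1) - (\<sigma>\<^sub>1 + \<sigma>\<^sub>2 * q)"
    using neg pq by (simp add: not_less le_divide_eq)
  obtain G K where G: "deriv_seq (2 * k) UNIV G" "\<And>t. t \<le> 1 \<Longrightarrow> G 0 t = 1" "\<And>t. t \<ge> 2 \<Longrightarrow> G 0 t = 0"
    "\<And>t. 0 \<le> G 0 t" "\<And>t. G 0 t \<le> 1" "K > 0"
    "\<And>t. t \<notin> {1..2} \<Longrightarrow> (radial_op DIM('a) ^^ k) G 0 t = 0"
    "\<And>t. \<bar>(radial_op DIM('a) ^^ k) G 0 t\<bar> \<le> K * G 0 t powr (1 / p)"
    "\<And>t. \<bar>(radial_op DIM('a) ^^ k) G 0 t\<bar> \<le> K * G 0 t powr (1 / q)"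
    using cutoff_exists[OF k p q, of "DIM('a)"] by metis
  interpret cutoff k "DIM('a)" G K
  proof
    show "\<bar>(radial_op DIM('a) ^^ k) G 0 t\<bar> \<le> K" for t
    proof -
      have "G 0 t powr (1 / p) \<le> 1" using G(4,5)[of t] p by (intro powr_le1) auto
      then have "K * G 0 t powr (1 / p) \<le> K" using G(6) by (simp add: mult_left_le)
      with G(8)[of t] show ?thesis by linarith
    qed
  qed (use G k in auto)
  define w1 where "w1 x = v x powr q / norm x powr \<sigma>\<^sub>1" for x
  define w2 where "w2 x = u x powr p / norm x powr \<sigma>\<^sub>2" for x
  have w1: "continuous_on (- {0}) w1" "x \<noteq> 0 \<Longrightarrow> 0 < w1 x" for x
    unfolding w1_def using v(3)
    by (auto intro!: continuous_intros continuous_on_subset[OF v(2)] simp: less_imp_neq[symmetric])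
  have w2: "continuous_on (- {0}) w2" "x \<noteq> 0 \<Longrightarrow> 0 < w2 x" for x
    unfolding w2_def using u(3)
    by (auto intro!: continuous_intros continuous_on_subset[OF u(2)] simp: less_imp_neq[symmetric])
  define X where "X = mass w1" define Y where "Y = mass w2"
  let ?e1 = "?n / 2 * (p - 1) + \<sigma>\<^sub>2 / 2 - real k * p"
  let ?e2 = "?n / 2 * (q - 1) + \<sigma>\<^sub>1 / 2 - real k * q"
  obtain C1 where C1: "C1 > 0" "\<And>S. S \<ge> 1 \<Longrightarrow> X 1 S powr p \<le> C1 * S powr ?e1 * Y S S"
    using power_inequality[OF refl n u w1(1) less_imp_le[OF w1(2)] c(1) Lu[folded w1_def] p \<sigma>(2) G(8)]
    unfolding X_def Y_def mass_def w2_def by auto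
  obtain C2 where C2: "C2 > 0" "\<And>S. S \<ge> 1 \<Longrightarrow> Y 1 S powr q \<le> C2 * S powr ?e2 * X S S"
    using power_inequality[OF refl n v w2(1) less_imp_le[OF w2(2)] c(2) Lv[folded w2_def] q \<sigma>(1) G(9)]
    unfolding X_def Y_def mass_def w1_def by auto
  have "X 1 S powr (p * q) \<le> (C1 powr q * C2) * X S S" if S: "S \<ge> 1" for S
  proof -
    have Y: "0 \<le> Y S S" "Y S S \<le> Y 1 S" "0 \<le> X S S"
      unfolding Y_def X_def using S mass_nonneg[OF w2] mass_nonneg[OF w1] mass_antimono[OF w2] by auto
    have "X 1 S powr (p * q) = (X 1 S powr p) powr q" by (simp add: powr_powr)
    also have "\<dots> \<le> (C1 * S powr ?e1 * Y S S) powr q" using C1(2)[OF S] q by (intro powr_mono2) auto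
    also have "\<dots> = C1 powr q * S powr (?e1 * q) * Y S S powr q"
      using C1 S Y by (simp add: powr_mult powr_powr)
    also have "\<dots> \<le> C1 powr q * S powr (?e1 * q) * (C2 * S powr ?e2 * X S S)"
      using order_trans[OF powr_mono2[of q "Y S S" "Y 1 S"] C2(2)[OF S]] Y q C1 by (intro mult_left_mono) auto
    also have "\<dots> = (C1 powr q * C2 * X S S) * S powr (?e1 * q + ?e2)"
      using S by (simp add: powr_add mult_ac)
    also have "\<dots> \<le> (C1 powr q * C2 * X S S) * 1"
    proof (intro mult_left_mono)
      have "2 * (?e1 * q + ?e2) = (?n - 2 * real k) * (p * q - 1) - (2 * real k * (q + 1) - (\<sigma>\<^sub>1 + \<sigma>\<^sub>2 * q))"
        by (simp add: field_simps)
      also have "\<dots> \<le> 0" using crit by (simp only: diff_le_0_iff_le)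
      finally have "?e1 * q + ?e2 \<le> 0" by (simp only: mult_le_0_iff) simp
      then show "S powr (?e1 * q + ?e2) \<le> 1" using powr_mono[of _ 0 S] S by simp
    qed (use C1 C2 Y in auto)
    finally show ?thesis by simp
  qed
  then show False
    using mass_superlinear_growth_impossible[OF w1 pq, of "C1 powr q * C2"] C1 C2 unfolding X_def by auto
qed

lemma positive_solution_imp_subcritical:
  fixes u v :: "'a::euclidean_space \<Rightarrow> real"
  assumes k: "k \<ge> 1" and n: "2 * k < DIM('a)"
    and p: "p > 1" and q: "q > 1" and \<sigma>: "\<sigma>\<^sub>1 \<ge> 0" "\<sigma>\<^sub>2 \<ge> 0"
    and "double_bounded c\<^sub>1" "double_bounded c\<^sub>2"
    and sol: "positive_solution k p q \<sigma>\<^sub>1 \<sigma>\<^sub>2 c\<^sub>1 c\<^sub>2 u v"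
  shows "max ((2 * real k * (q + 1) - (\<sigma>\<^sub>1 + \<sigma>\<^sub>2 * q)) / (p * q - 1))
             ((2 * real k * (p + 1) - (\<sigma>\<^sub>2 + \<sigma>\<^sub>1 * p)) / (p * q - 1))
           < real DIM('a) - 2 * real k"
proof -
  obtain C1 C2 where C: "C1 > 0" "\<And>x. 1 / C1 \<le> c\<^sub>1 x" "C2 > 0" "\<And>x. 1 / C2 \<le> c\<^sub>2 x"
    using assms unfolding double_bounded_def by blast
  note s = sol[unfolded positive_solution_def]
  have Lu: "1 / C1 * (v x powr q / norm x powr \<sigma>\<^sub>1) \<le> neg_laplacian_pow k u x"
    and Lv: "1 / C2 * (u x powr p / norm x powr \<sigma>\<^sub>2) \<le> neg_laplacian_pow k v x" if "x \<noteq> 0" for x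
  proof -
    have "neg_laplacian_pow k u x = c\<^sub>1 x * (v x powr q / norm x powr \<sigma>\<^sub>1)"
      "neg_laplacian_pow k v x = c\<^sub>2 x * (u x powr p / norm x powr \<sigma>\<^sub>2)" using s that by blast+
    then show "1 / C1 * (v x powr q / norm x powr \<sigma>\<^sub>1) \<le> neg_laplacian_pow k u x"
      "1 / C2 * (u x powr p / norm x powr \<sigma>\<^sub>2) \<le> neg_laplacian_pow k v x"
      using mult_right_mono[OF C(2)[of x], of "v x powr q / norm x powr \<sigma>\<^sub>1"]
        mult_right_mono[OF C(4)[of x], of "u x powr p / norm x powr \<sigma>\<^sub>2"] by simp_all
  qed
  have "1 / C1 > 0" "1 / C2 > 0" using C by auto
  then show ?thesis
    using coercive_system_nonexistence[OF k n p q \<sigma>, of u v "1 / C1" "1 / C2"]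
      coercive_system_nonexistence[OF k n q p \<sigma>(2,1), of v u "1 / C2" "1 / C1"] Lu Lv s
    by (simp add: mult.commute[of q p])
qed

section \<open>Superpositions of inverse powers\<close>

text \<open>
  The coefficient of \<open>z\<^bsup>k - j\<^esup> (z + |x|\<^sup>2)\<^bsup>-(s + 2k - j)\<^esup>\<close> in \<open>(-\<Delta>)\<^sup>k (z + |x|\<^sup>2)\<^bsup>-s\<^esup>\<close>, where \<open>h = n/2\<close>.
  For \<open>0 < s < h - k\<close> all of them are positive; for \<open>s = h - k\<close> only the one with \<open>j = 0\<close> survives.
\<close>

definition radial_coeff :: "real \<Rightarrow> nat \<Rightarrow> nat \<Rightarrow> real \<Rightarrow> real" where
  "radial_coeff h k j s = 4 ^ k * real (k choose j) * pochhammer s (2 * k - j) * pochhammer (h - real k - s) j"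

text \<open>
  Both sides count pairs of an \<open>i\<close>-subset and a further element of a \<open>k\<close>-set.
\<close>

lemma choose_Suc_mult: "(real k - real i) * real (k choose i) = real (Suc i) * real (k choose Suc i)" if "i \<le> k"
proof -
  have "Suc i * (k choose Suc i) = (k - i) * (k choose i)"
    by (cases k) (simp_all add: binomial_absorb_comp Suc_times_binomial del: binomial_Suc_Suc mult_Suc)
  then have "real (Suc i * (k choose Suc i)) = real ((k - i) * (k choose i))" by (rule arg_cong)
  then show ?thesis using that by (simp add: of_nat_diff distrib_right)
qed

text \<open>
  One application of \<open>-\<Delta>\<close> maps the exponent \<open>s\<close> to \<open>s + 1\<close> and \<open>s + 2\<close> with the factors
  \<open>4 s (h - 1 - s)\<close> and \<open>4 s (s + 1)\<close>. After removing the common Pochhammer factors, the recursion is Pascal's rule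
  combined with \<open>choose_Suc_mult\<close>.
\<close>

lemma radial_coeff_Suc:
  assumes "j \<le> Suc k"
  shows "radial_coeff h (Suc k) j s =
    (case j of 0 \<Rightarrow> 0 | Suc i \<Rightarrow> 4 * s * (h - 1 - s) * radial_coeff h k i (s + 1)) +
    4 * s * (s + 1) * radial_coeff h k j (s + 2)"
proof (cases j)
  case 0
  have "pochhammer s (2 * Suc k) = s * (s + 1) * pochhammer (s + 2) (2 * k)"
    using pochhammer_rec[of s "Suc (2 * k)"] pochhammer_rec[of "s + 1" "2 * k"] by (simp add: add.assoc)
  then show ?thesis by (simp add: 0 radial_coeff_def)
next
  case (Suc i)
  then have i: "i \<le> k" using assms by simp
  \<comment> \<open>The parameter of the last Pochhammer factor for the pairs \<open>(k + 1, s)\<close> and \<open>(k, s + 1)\<close>; for \<open>(k, s + 2)\<close> it is \<open>B - 1\<close>.\<close>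
  define B where "B = h - real k - 1 - s"
  have e1: "h - real k - (s + 1) = B" "h - 1 - s = B + real k" "h - real (Suc k) - s = B"
    "h - real k - (s + 2) = B - 1"
    by (simp_all add: B_def)
  have p1: "s * pochhammer (s + 1) (2 * k - i) = pochhammer s (2 * Suc k - j)"
    using i Suc pochhammer_rec[of s "2 * k - i"] by (simp add: Suc_diff_le)
  have p2: "s * (s + 1) * pochhammer (s + 2) (2 * k - j) = pochhammer s (2 * Suc k - j)" if "i < k"
  proof -
    have "2 * Suc k - j = Suc (Suc (2 * k - j))" using that Suc by simp
    then show ?thesis
      using pochhammer_rec[of s "Suc (2 * k - j)"] pochhammer_rec[of "s + 1" "2 * k - j"] by (simp add: add.assoc)
  qed
  have p3: "pochhammer (B - 1) j = (B - 1) * pochhammer B i" "pochhammer B j = (B + real i) * pochhammer B i"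
    using pochhammer_rec[of "B - 1" i] pochhammer_rec'[of B i] by (simp_all add: Suc)
  let ?P = "4 ^ Suc k * pochhammer s (2 * Suc k - j) * pochhammer B i"
  have "4 * s * (h - 1 - s) * radial_coeff h k i (s + 1) =
      4 ^ Suc k * (B + real k) * real (k choose i) * (s * pochhammer (s + 1) (2 * k - i)) * pochhammer B i"
    by (simp only: radial_coeff_def e1) simp
  then have t1: "4 * s * (h - 1 - s) * radial_coeff h k i (s + 1) = ?P * ((B + real k) * real (k choose i))"
    unfolding p1 by simp
  have "radial_coeff h k j (s + 2) =
      4 ^ k * real (k choose j) * pochhammer (s + 2) (2 * k - j) * ((B - 1) * pochhammer B i)"
    by (simp only: radial_coeff_def e1 p3)
  then have "4 * s * (s + 1) * radial_coeff h k j (s + 2) =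
      4 ^ Suc k * real (k choose j) * (s * (s + 1) * pochhammer (s + 2) (2 * k - j)) * ((B - 1) * pochhammer B i)"
    by (simp only: power_Suc mult_ac)
  also have "\<dots> = ?P * ((B - 1) * real (k choose j))"
  proof (cases "i = k")
    case True
    then have "k choose j = 0" by (simp add: Suc)
    then show ?thesis by simp
  next
    case False
    then have "i < k" using i by simp
    show ?thesis unfolding p2[OF \<open>i < k\<close>] by (simp only: mult_ac)
  qed
  finally have t2: "4 * s * (s + 1) * radial_coeff h k j (s + 2) = ?P * ((B - 1) * real (k choose j))" .
  have t3: "radial_coeff h (Suc k) j s = ?P * ((B + real i) * real (Suc k choose j))"
    by (simp only: radial_coeff_def e1 p3) simp
  have "(B + real k) * real (k choose i) + (B - 1) * real (k choose Suc i)
     = (B + real i) * (real (k choose i) + real (k choose Suc i))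
      + ((real k - real i) * real (k choose i) - real (Suc i) * real (k choose Suc i))"
    by (simp add: algebra_simps)
  also have "\<dots> = (B + real i) * real (Suc k choose j)"
    using choose_Suc_mult[OF i] by (simp add: Suc)
  finally have main: "(B + real i) * real (Suc k choose j) =
      (B + real k) * real (k choose i) + (B - 1) * real (k choose j)"
    by (simp only: Suc)
  have "(case j of 0 \<Rightarrow> 0 | Suc i \<Rightarrow> 4 * s * (h - 1 - s) * radial_coeff h k i (s + 1))
     = 4 * s * (h - 1 - s) * radial_coeff h k i (s + 1)" by (simp add: Suc)
  then show ?thesis unfolding t3 main t2 t1 by (simp only: distrib_left)
qed

text \<open>
  Superpositions of the functions \<open>(z + \<rho>)\<^bsup>-N\<^esup>\<close>, with \<open>z\<close> running through the values of a function on \<open>[0,1]\<close>. A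
  constant function gives the single powers \<open>(1 + \<rho>)\<^bsup>-N\<^esup>\<close>.
\<close>

locale mixture =
  fixes z :: "real \<Rightarrow> real"
  assumes z_cont: "continuous_on {0..1} z"
    and z_nonneg: "t \<in> {0..1} \<Longrightarrow> 0 \<le> z t" and z_le_1: "t \<in> {0..1} \<Longrightarrow> z t \<le> 1"
begin

definition mixed_power :: "real \<Rightarrow> real \<Rightarrow> real \<Rightarrow> real" where
  "mixed_power c N \<rho> = integral {0..1} (\<lambda>t. z t powr c * (z t + \<rho>) powr - N)"

text \<open>
  As \<open>c\<close> is positive, this includes zeros of \<open>z\<close>.
\<close>

lemma continuous_integrand:
  assumes "c > 0" "\<rho> > 0"
  shows "continuous_on {0..1} (\<lambda>t. z t powr c * (z t + \<rho>) powr - N)"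
  using assms z_nonneg
  by (intro continuous_on_mult continuous_on_powr' continuous_on_add continuous_on_const z_cont)
     (auto simp: add_nonneg_eq_0_iff)

lemma integrable_integrand:
  assumes "c > 0" "\<rho> > 0"
  shows "(\<lambda>t. z t powr c * (z t + \<rho>) powr - N) integrable_on {0..1}"
  using integrable_continuous_interval[OF continuous_integrand[OF assms]] .

lemma DERIV_mixed_power:
  assumes c: "c > 0" and \<rho>: "\<rho> > 0"
  shows "(mixed_power c N has_real_derivative - N * mixed_power c (N + 1) \<rho>) (at \<rho>)"
proof -
  have "((\<lambda>\<rho>. integral (cbox 0 1) (\<lambda>t. z t powr c * (z t + \<rho>) powr - N)) has_real_derivative
     integral (cbox 0 1) (\<lambda>t. - N * (z t powr c * (z t + \<rho>) powr - (N + 1)))) (at \<rho> within {0<..})"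
  proof (rule leibniz_rule_field_derivative)
    fix x t :: real assume x: "x \<in> {0<..}" and t: "t \<in> cbox 0 1"
    then have "z t + x > 0" using z_nonneg[of t] by simp
    moreover have "((\<lambda>x. z t + x) has_real_derivative 0 + 1) (at x)"
      by (intro DERIV_add DERIV_const DERIV_ident)
    ultimately have "((\<lambda>x. (z t + x) powr - N) has_real_derivative - N * (z t + x) powr (- N - 1) * (0 + 1)) (at x)"
      by (intro DERIV_chain2[OF has_real_derivative_powr])
    from DERIV_cmult[OF this, of "z t powr c"]
    have "((\<lambda>x. z t powr c * (z t + x) powr - N) has_real_derivative
       - N * (z t powr c * (z t + x) powr - (N + 1))) (at x)"
      by (rule DERIV_cong) (simp add: mult_ac)
    then show "((\<lambda>x. z t powr c * (z t + x) powr - N) has_real_derivative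
       - N * (z t powr c * (z t + x) powr - (N + 1))) (at x within {0<..})"
      by (rule has_field_derivative_at_within)
  next
    show "(\<lambda>t. z t powr c * (z t + x) powr - N) integrable_on cbox 0 1" if "x \<in> {0<..}" for x
      using integrable_integrand[OF c] that by simp
    have zc: "continuous_on ({0<..} \<times> {0..1}) (\<lambda>p::real \<times> real. z (snd p))"
      by (rule continuous_on_compose2[OF z_cont]) (auto intro!: continuous_intros)
    show "continuous_on ({0<..} \<times> cbox 0 1) (\<lambda>(x, t). - N * (z t powr c * (z t + x) powr - (N + 1)))"
      unfolding split_beta cbox_interval using c z_nonneg
      by (intro continuous_on_mult continuous_on_powr' continuous_on_add continuous_on_const zc continuous_on_fst continuous_on_id)
         (auto simp: add_nonneg_eq_0_iff)
  qed (use \<rho> in auto)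
  then show ?thesis using \<rho> by (simp add: mixed_power_def[abs_def] at_within_open[of \<rho> "{0<..}"] cbox_interval)
qed

text \<open>
  This is \<open>\<rho> = (z + \<rho>) - z\<close> under the integral; it expresses the factor \<open>t\<close> in \<open>radial_op\<close> within the family.
\<close>

lemma mixed_power_recursion:
  assumes c: "c > 0" and \<rho>: "\<rho> > 0"
  shows "\<rho> * mixed_power c (N + 1) \<rho> = mixed_power c N \<rho> - mixed_power (c + 1) (N + 1) \<rho>"
proof -
  have "mixed_power c N \<rho> - mixed_power (c + 1) (N + 1) \<rho> = integral {0..1} (\<lambda>t. z t powr c * (z t + \<rho>) powr - N
      - z t powr (c + 1) * (z t + \<rho>) powr - (N + 1))"
    unfolding mixed_power_def using c \<rho> by (intro Henstock_Kurzweil_Integration.integral_diff[symmetric] integrable_integrand) auto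
  also have "\<dots> = integral {0..1} (\<lambda>t. \<rho> * (z t powr c * (z t + \<rho>) powr - (N + 1)))"
  proof (rule Henstock_Kurzweil_Integration.integral_cong)
    fix t :: real assume t: "t \<in> {0..1}"
    then have p: "z t + \<rho> > 0" using z_nonneg[of t] \<rho> by simp
    have "(z t + \<rho>) powr - N = (z t + \<rho>) powr (- (N + 1) + 1)" by simp
    also have "\<dots> = (z t + \<rho>) powr - (N + 1) * (z t + \<rho>)" using p by (simp only: powr_add powr_one)
    finally have 1: "(z t + \<rho>) powr - N = (z t + \<rho>) powr - (N + 1) * (z t + \<rho>)" .
    have 2: "z t powr (c + 1) = z t powr c * z t" using z_nonneg[OF t] by (simp add: powr_add)
    show "z t powr c * (z t + \<rho>) powr - N - z t powr (c + 1) * (z t + \<rho>) powr - (N + 1)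
      = \<rho> * (z t powr c * (z t + \<rho>) powr - (N + 1))"
      unfolding 1 2 by (simp only: algebra_simps)
  qed
  also have "\<dots> = \<rho> * mixed_power c (N + 1) \<rho>" by (simp add: mixed_power_def)
  finally show ?thesis ..
qed

definition mixed_power_seq :: "real \<Rightarrow> real \<Rightarrow> nat \<Rightarrow> real \<Rightarrow> real" where
  "mixed_power_seq c s i \<rho> = (-1) ^ i * pochhammer s i * mixed_power c (s + real i) \<rho>"

lemma mixed_power_seq_0 [simp]: "mixed_power_seq c s 0 \<rho> = mixed_power c s \<rho>" by (simp add: mixed_power_seq_def)

lemma deriv_seq_mixed_power:
  assumes "c > 0" shows "deriv_seq m {0<..} (mixed_power_seq c s)"
proof -
  have d: "(mixed_power_seq c s i has_real_derivative mixed_power_seq c s (Suc i) \<rho>) (at \<rho>)" if "\<rho> > 0" for i \<rho>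
  proof -
    have "(mixed_power_seq c s i has_real_derivative (-1) ^ i * pochhammer s i * (- (s + real i) * mixed_power c (s + real i + 1) \<rho>)) (at \<rho>)"
      unfolding mixed_power_seq_def[abs_def] by (intro DERIV_cmult DERIV_mixed_power assms that)
    then show ?thesis by (rule DERIV_cong) (simp add: mixed_power_seq_def pochhammer_Suc algebra_simps)
  qed
  then have "continuous_on {0<..} (mixed_power_seq c s m)"
    by (intro continuous_at_imp_continuous_on ballI DERIV_isCont) auto
  with d show ?thesis by (auto simp: deriv_seq_def)
qed

lemma radial_op_mixed_power:
  assumes c: "c > 0" and \<rho>: "\<rho> > 0"
  shows "radial_op n (mixed_power_seq c s) i \<rho> =
    4 * s * (real n / 2 - 1 - s) * mixed_power_seq c (s + 1) i \<rho> + 4 * s * (s + 1) * mixed_power_seq (c + 1) (s + 2) i \<rho>"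
proof -
  define N where "N = s + real i + 1"
  have p1: "pochhammer s (i + 1) = s * pochhammer (s + 1) i" by (simp add: pochhammer_rec)
  have p2: "pochhammer s (i + 2) = s * (s + 1) * pochhammer (s + 2) i"
    using pochhammer_rec[of s "Suc i"] pochhammer_rec[of "s + 1" i] by (simp add: add.assoc)
  have p2': "pochhammer s (i + 2) = pochhammer s (i + 1) * N" by (simp add: pochhammer_Suc N_def algebra_simps)
  have "radial_op n (mixed_power_seq c s) i \<rho> = (-1) ^ i * (- (4 * pochhammer s (i + 2) * (\<rho> * mixed_power c (N + 1) \<rho>))
      + (4 * real i + 2 * real n) * pochhammer s (i + 1) * mixed_power c N \<rho>)"
    by (simp add: radial_op_def mixed_power_seq_def N_def add_ac algebra_simps)
  also have "\<dots> = (-1) ^ i * (pochhammer s (i + 1) * (4 * real i + 2 * real n - 4 * N) * mixed_power c N \<rho>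
      + 4 * pochhammer s (i + 2) * mixed_power (c + 1) (N + 1) \<rho>)"
    unfolding mixed_power_recursion[OF assms] p2' by (simp add: algebra_simps)
  also have "\<dots> = 4 * s * (real n / 2 - 1 - s) * mixed_power_seq c (s + 1) i \<rho> + 4 * s * (s + 1) * mixed_power_seq (c + 1) (s + 2) i \<rho>"
    unfolding p1 p2 by (simp add: mixed_power_seq_def N_def add_ac algebra_simps)
  finally show ?thesis .
qed

lemma radial_op_pow_mixed_power:
  assumes "c > 0" and \<rho>: "\<rho> > 0"
  shows "(radial_op n ^^ k) (mixed_power_seq c s) i \<rho> =
    (\<Sum>j\<le>k. radial_coeff (real n / 2) k j s * mixed_power_seq (c + real k - real j) (s + 2 * real k - real j) i \<rho>)"
  using assms(1)
proof (induction k arbitrary: c s)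
  case 0 then show ?case by (simp add: radial_coeff_def)
next
  case (Suc k)
  let ?h = "real n / 2"
  let ?T = "\<lambda>j. mixed_power_seq (c + real (Suc k) - real j) (s + 2 * real (Suc k) - real j) i \<rho>"
  let ?\<alpha> = "4 * s * (?h - 1 - s)" let ?\<beta> = "4 * s * (s + 1)"
  have "(radial_op n ^^ Suc k) (mixed_power_seq c s) i \<rho> = (radial_op n ^^ k) (radial_op n (mixed_power_seq c s)) i \<rho>"
    by (simp add: funpow_swap1)
  also have "\<dots> = ?\<alpha> * (radial_op n ^^ k) (mixed_power_seq c (s + 1)) i \<rho> + ?\<beta> * (radial_op n ^^ k) (mixed_power_seq (c + 1) (s + 2)) i \<rho>"
    by (rule radial_op_pow_lincomb) (rule radial_op_mixed_power[OF Suc.prems \<rho>])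
  also have "(radial_op n ^^ k) (mixed_power_seq c (s + 1)) i \<rho> = (\<Sum>j\<le>k. radial_coeff ?h k j (s + 1) * ?T (Suc j))"
    unfolding Suc.IH[OF Suc.prems] by (intro sum.cong refl) (simp add: algebra_simps)
  also have "?\<alpha> * \<dots> = (\<Sum>j\<le>Suc k. (case j of 0 \<Rightarrow> 0 | Suc l \<Rightarrow> ?\<alpha> * radial_coeff ?h k l (s + 1)) * ?T j)"
    unfolding sum.atMost_Suc_shift by (simp add: sum_distrib_left mult.assoc)
  also have "(radial_op n ^^ k) (mixed_power_seq (c + 1) (s + 2)) i \<rho> = (\<Sum>j\<le>k. radial_coeff ?h k j (s + 2) * ?T j)"
    using Suc.prems by (subst Suc.IH) (auto intro!: sum.cong simp: algebra_simps)
  also have "\<dots> = (\<Sum>j\<le>Suc k. radial_coeff ?h k j (s + 2) * ?T j)"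
    by (simp add: radial_coeff_def)
  also have "(\<Sum>j\<le>Suc k. (case j of 0 \<Rightarrow> 0 | Suc l \<Rightarrow> ?\<alpha> * radial_coeff ?h k l (s + 1)) * ?T j)
      + ?\<beta> * (\<Sum>j\<le>Suc k. radial_coeff ?h k j (s + 2) * ?T j) = (\<Sum>j\<le>Suc k. radial_coeff ?h (Suc k) j s * ?T j)"
    unfolding sum_distrib_left sum.distrib[symmetric]
    by (intro sum.cong refl) (simp only: radial_coeff_Suc atMost_iff distrib_right mult.assoc)
  finally show ?case .
qed

lemma neg_laplacian_pow_mixed_power:
  fixes x :: "'a::euclidean_space"
  assumes "c > 0" "x \<noteq> 0"
  shows "neg_laplacian_pow k (\<lambda>x. mixed_power c s (x \<bullet> x)) x =
    (\<Sum>j\<le>k. radial_coeff (real DIM('a) / 2) k j s * mixed_power (c + real k - real j) (s + 2 * real k - real j) (x \<bullet> x))"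
proof -
  have "neg_laplacian_pow k (\<lambda>x. mixed_power_seq c s 0 (x \<bullet> x)) x = (radial_op DIM('a) ^^ k) (mixed_power_seq c s) 0 (x \<bullet> x)"
    using assms by (intro neg_laplacian_pow_radial[of "{0<..}"] deriv_seq_mixed_power) auto
  also have "\<dots> = (\<Sum>j\<le>k. radial_coeff (real DIM('a) / 2) k j s * mixed_power (c + real k - real j) (s + 2 * real k - real j) (x \<bullet> x))"
    using assms by (subst radial_op_pow_mixed_power) auto
  finally show ?thesis by simp
qed

lemma C_on_mixed_power:
  assumes "c > 0"
  shows "C_on m (- {0}) (\<lambda>x::'a::euclidean_space. mixed_power c s (x \<bullet> x))"
proof -
  have "{x::'a. x \<bullet> x \<in> {0<..}} = - {0}" by auto
  then show ?thesis using C_on_radial[OF _ deriv_seq_mixed_power[OF assms, of m s], where 'a='a] by simp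
qed

end

section \<open>Profiles and existence of solutions\<close>

lemma (in mixture) mixed_power_nonneg: "0 \<le> mixed_power c N \<rho>"
  unfolding mixed_power_def
  by (cases "(\<lambda>t. z t powr c * (z t + \<rho>) powr - N) integrable_on {0..1}")
     (auto simp: not_integrable_integral intro: Henstock_Kurzweil_Integration.integral_nonneg)

lemma constant_mixture: "mixture (\<lambda>_. 1)"
  by standard auto

lemma mixed_power_constant: "mixture.mixed_power (\<lambda>_. 1) c N \<rho> = (1 + \<rho>) powr - N"
  by (simp add: mixture.mixed_power_def[OF constant_mixture])

text \<open>
  All coefficients in the formula for \<open>(-\<Delta>)\<^sup>k (1 + |x|\<^sup>2)\<^bsup>-s\<^esup>\<close> are positive, and among the powers that occur the one
  with \<open>j = k\<close> decays most slowly.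
\<close>

lemma regular_profile:
  fixes s :: real
  defines "U \<equiv> \<lambda>x::'a::euclidean_space. (1 + x \<bullet> x) powr - s"
  assumes s: "s > 0" and k: "s + real k < real DIM('a) / 2"
  shows "C_on m (- {0}) U"
    and "\<exists>A>0. \<exists>B>0. \<forall>x. x \<noteq> 0 \<longrightarrow> A * (1 + x \<bullet> x) powr - (s + real k) \<le> neg_laplacian_pow k U x \<and>
      neg_laplacian_pow k U x \<le> B * (1 + x \<bullet> x) powr - (s + real k)"
proof -
  interpret mixture "\<lambda>_. 1" by (rule constant_mixture)
  have U: "U = (\<lambda>x. mixed_power 1 s (x \<bullet> x))" by (simp add: U_def mixed_power_constant)
  show "C_on m (- {0}) U" unfolding U by (rule C_on_mixed_power) simp
  let ?a = "\<lambda>j. radial_coeff (real DIM('a) / 2) k j s"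
  have a: "?a j > 0" if "j \<le> k" for j
    using that s k by (simp add: radial_coeff_def pochhammer_pos)
  have L: "neg_laplacian_pow k U x = (\<Sum>j\<le>k. ?a j * (1 + x \<bullet> x) powr - (s + 2 * real k - real j))" if "x \<noteq> 0" for x
    using neg_laplacian_pow_mixed_power[OF zero_less_one that, of k s] by (simp add: U_def mixed_power_constant)
  define B where "B = (\<Sum>j\<le>k. ?a j)"
  have "B > 0" unfolding B_def using a by (intro sum_pos) auto
  moreover have "?a k * (1 + x \<bullet> x) powr - (s + real k) \<le> neg_laplacian_pow k U x" if "x \<noteq> 0" for x
  proof -
    have "?a k * (1 + x \<bullet> x) powr - (s + 2 * real k - real k) \<le> neg_laplacian_pow k U x"
      unfolding L[OF that] by (intro member_le_sum mult_nonneg_nonneg less_imp_le[OF a]) auto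
    then show ?thesis by (simp add: algebra_simps)
  qed
  moreover have "neg_laplacian_pow k U x \<le> B * (1 + x \<bullet> x) powr - (s + real k)" if "x \<noteq> 0" for x
    unfolding L[OF that] B_def sum_distrib_right
  proof (intro sum_mono mult_left_mono)
    fix j assume "j \<in> {..k}"
    then have "0 \<le> ?a j" "real j \<le> real k" using a[of j] by auto
    then show "0 \<le> ?a j" "(1 + x \<bullet> x) powr - (s + 2 * real k - real j) \<le> (1 + x \<bullet> x) powr - (s + real k)"
      by (auto intro!: powr_mono)
  qed
  ultimately show "\<exists>A>0. \<exists>B>0. \<forall>x. x \<noteq> 0 \<longrightarrow> A * (1 + x \<bullet> x) powr - (s + real k) \<le> neg_laplacian_pow k U x \<and>
      neg_laplacian_pow k U x \<le> B * (1 + x \<bullet> x) powr - (s + real k)"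
    using a[of k] by blast
qed

lemma power_mixture: "e > 0 \<Longrightarrow> mixture (\<lambda>t. t powr e)"
  by standard (auto intro!: continuous_on_powr' continuous_on_id continuous_on_const powr_le1)

context
  fixes e M :: real
  assumes e: "e > 0" and M: "M > 0"
begin

interpretation mixture "\<lambda>t. t powr e" by (rule power_mixture[OF e])

lemma integrable_power_mixture:
  assumes "\<rho> \<ge> 0"
  shows "(\<lambda>t. (t powr e) powr M * (t powr e + \<rho>) powr - M) integrable_on {0..1}"
proof (cases "\<rho> = 0")
  case False
  then show ?thesis using integrable_integrand[OF M] assms by simp
next
  case True
  have "(\<lambda>t::real. 1 :: real) integrable_on {0..1}" by (intro integrable_continuous_interval continuous_intros)
  then show ?thesis
    by (rule integrable_spike_finite[of "{0}", rotated 2]) (auto simp: True simp flip: powr_add)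
qed

text \<open>
  As \<open>z \<le> 1\<close>, the quotient \<open>z / (z + \<rho>)\<close> is at most \<open>1 / (1 + \<rho>)\<close>.
\<close>

lemma power_mixture_le:
  assumes \<rho>: "\<rho> \<ge> 0" shows "mixed_power M M \<rho> \<le> (1 + \<rho>) powr - M"
proof -
  have "mixed_power M M \<rho> \<le> integral {0..1} (\<lambda>_::real. (1 + \<rho>) powr - M)"
    unfolding mixed_power_def
  proof (rule integral_le[OF integrable_power_mixture[OF \<rho>]])
    show "(\<lambda>_::real. (1 + \<rho>) powr - M) integrable_on {0..1}"
      by (intro integrable_continuous_interval continuous_intros)
    fix t :: real assume t: "t \<in> {0..1}"
    show "(t powr e) powr M * (t powr e + \<rho>) powr - M \<le> (1 + \<rho>) powr - M"
    proof (cases "t = 0")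
      case False
      let ?z = "t powr e"
      have z: "0 < ?z" "?z \<le> 1" using t False z_le_1[OF t] by auto
      have "?z * \<rho> \<le> 1 * \<rho>" using z \<rho> by (intro mult_right_mono) auto
      then have "?z * (1 + \<rho>) \<le> ?z + \<rho>" by (simp add: distrib_left)
      then have "(?z + \<rho>) powr - M \<le> (?z * (1 + \<rho>)) powr - M"
        using M z \<rho> by (intro powr_mono2') auto
      also have "\<dots> = ?z powr - M * (1 + \<rho>) powr - M" using z \<rho> by (simp add: powr_mult)
      finally have "?z powr M * (?z + \<rho>) powr - M \<le> ?z powr M * (?z powr - M * (1 + \<rho>) powr - M)"
        by (intro mult_left_mono) auto
      also have "\<dots> = (1 + \<rho>) powr - M"
        using z by (simp flip: mult.assoc powr_add)
      finally show ?thesis .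
    qed (use M in simp)
  qed
  then show ?thesis by simp
qed

text \<open>
  The integrand is bounded by \<open>1\<close> even for \<open>\<rho> = 0\<close>, so dominated convergence includes the origin.
\<close>

lemma continuous_power_mixture: "continuous_on {0..} (mixed_power M M)"
  unfolding continuous_on_eq_continuous_within
proof
  fix a :: real assume a: "a \<in> {0..}"
  show "continuous (at a within {0..}) (mixed_power M M)"
  proof (rule continuous_within_sequentiallyI)
    fix \<rho> :: "nat \<Rightarrow> real" assume lim: "\<rho> \<longlonglongrightarrow> a" and pos: "\<forall>n. \<rho> n \<in> {0..}"
    show "(\<lambda>n. mixed_power M M (\<rho> n)) \<longlonglongrightarrow> mixed_power M M a"
      unfolding mixed_power_def
    proof (rule dominated_convergence(2))
      show "(\<lambda>t. (t powr e) powr M * (t powr e + \<rho> n) powr - M) integrable_on {0..1}" for n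
        using pos by (intro integrable_power_mixture) auto
      show "(\<lambda>t::real. 1 :: real) integrable_on {0..1}" by (intro integrable_continuous_interval continuous_intros)
      fix t :: real assume t: "t \<in> {0..1}"
      show "norm ((t powr e) powr M * (t powr e + \<rho> n) powr - M) \<le> 1" for n
      proof (cases "t = 0")
        case False
        have "(t powr e + \<rho> n) powr - M \<le> (t powr e) powr - M"
          using M False t pos by (intro powr_mono2') auto
        then have "(t powr e) powr M * (t powr e + \<rho> n) powr - M \<le> (t powr e) powr M * (t powr e) powr - M"
          by (intro mult_left_mono) auto
        also have "\<dots> = 1" using False t by (simp flip: powr_add)
        finally show ?thesis by simp
      qed (use M in simp)
      show "(\<lambda>n. (t powr e) powr M * (t powr e + \<rho> n) powr - M) \<longlonglongrightarrow> (t powr e) powr M * (t powr e + a) powr - M"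
      proof (cases "t = 0")
        case False
        have "t powr e + a \<noteq> 0" using False t a by (auto simp: add_nonneg_eq_0_iff)
        then show ?thesis
          by (intro tendsto_mult tendsto_powr tendsto_add tendsto_const lim)
      qed (use M in simp)
    qed
  qed
qed

text \<open>
  The integrand is at most \<open>(z + \<rho>)\<^bsup>-k\<^esup>\<close>. With \<open>\<rho> = r\<^sup>e\<close> and \<open>z = t\<^sup>e\<close> the sum \<open>z + \<rho>\<close> is comparable
  to \<open>(t + r)\<^sup>e\<close>, so this power can be integrated explicitly.
\<close>

lemma power_mixture_upper:
  assumes ek: "e * real k > 1" and \<rho>: "\<rho> > 0"
  shows "mixed_power (M + real k) (M + 2 * real k) \<rho> \<le> 2 powr (e * real k) / (e * real k - 1) * \<rho> powr (1 / e - real k)"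
proof -
  define r where "r = \<rho> powr (1 / e)"
  have r: "r > 0" "r powr e = \<rho>" using \<rho> e by (auto simp: r_def powr_powr)
  let ?g = "\<lambda>t. - ((t + r) powr (1 - e * real k)) / (e * real k - 1)"
  have int: "((\<lambda>t. (t + r) powr - (e * real k)) has_integral ?g 1 - ?g 0) {0..1}"
  proof (rule fundamental_theorem_of_calculus)
    fix t :: real assume "t \<in> {0..1}"
    then have "t + r > 0" using r by simp
    moreover have "((\<lambda>t. t + r) has_real_derivative 1 + 0) (at t)" by (intro DERIV_add DERIV_const DERIV_ident)
    ultimately have "((\<lambda>t. (t + r) powr (1 - e * real k)) has_real_derivative
        (1 - e * real k) * (t + r) powr (1 - e * real k - 1) * (1 + 0)) (at t)"
      by (intro DERIV_chain2[OF has_real_derivative_powr])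
    from DERIV_cdivide[OF DERIV_minus[OF this], of "e * real k - 1"]
    have "(?g has_real_derivative (t + r) powr - (e * real k)) (at t)"
      by (rule DERIV_cong) (use ek in \<open>simp add: field_simps\<close>)
    then show "(?g has_vector_derivative (t + r) powr - (e * real k)) (at t within {0..1})"
      by (simp add: has_real_derivative_iff_has_vector_derivative[symmetric] has_field_derivative_at_within)
  qed simp
  have "mixed_power (M + real k) (M + 2 * real k) \<rho> \<le> integral {0..1} (\<lambda>t. 2 powr (e * real k) * (t + r) powr - (e * real k))"
    unfolding mixed_power_def
  proof (rule integral_le[OF integrable_integrand])
    show "(\<lambda>t. 2 powr (e * real k) * (t + r) powr - (e * real k)) integrable_on {0..1}"
      using integrable_on_cmult_left[OF has_integral_integrable[OF int], of "2 powr (e * real k)"] by simp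
    fix t :: real assume t: "t \<in> {0..1}"
    let ?z = "t powr e"
    have "?z powr (M + real k) * (?z + \<rho>) powr - (M + 2 * real k)
        \<le> (?z + \<rho>) powr (M + real k) * (?z + \<rho>) powr - (M + 2 * real k)"
      using \<rho> M by (intro mult_right_mono powr_mono2) auto
    also have "\<dots> = (?z + \<rho>) powr - real k" by (simp flip: powr_add)
    also have "\<dots> \<le> (((t + r) / 2) powr e) powr - real k"
    proof (rule powr_mono2')
      have "((t + r) / 2) powr e \<le> (max t r) powr e" using t r e by (intro powr_mono2) auto
      also have "\<dots> \<le> ?z + \<rho>" using r \<rho> by (cases "t \<le> r") (auto simp: max_def)
      finally show "((t + r) / 2) powr e \<le> ?z + \<rho>" .
    qed (use t r in auto)
    also have "\<dots> = 2 powr (e * real k) * (t + r) powr - (e * real k)"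
      using t r by (simp add: powr_powr powr_divide powr_minus_divide)
    finally show "?z powr (M + real k) * (?z + \<rho>) powr - (M + 2 * real k)
        \<le> 2 powr (e * real k) * (t + r) powr - (e * real k)" .
  qed (use M \<rho> in auto)
  also have "\<dots> = 2 powr (e * real k) * (?g 1 - ?g 0)"
    using integral_unique[OF int] by simp
  also have "\<dots> \<le> 2 powr (e * real k) * (r powr (1 - e * real k) / (e * real k - 1))"
    using ek by (intro mult_left_mono) (auto simp flip: diff_divide_distrib intro!: divide_right_mono)
  also have "r powr (1 - e * real k) = \<rho> powr (1 / e - real k)"
    using e by (simp add: r_def powr_powr diff_divide_distrib right_diff_distrib)
  finally show ?thesis by simp
qed

lemma power_mixture_far:
  assumes \<rho>: "\<rho> > 0"
  shows "mixed_power (M + real k) (M + 2 * real k) \<rho> \<le> \<rho> powr - (M + 2 * real k)"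
proof -
  have "mixed_power (M + real k) (M + 2 * real k) \<rho> \<le> integral {0..1} (\<lambda>_::real. \<rho> powr - (M + 2 * real k))"
    unfolding mixed_power_def
  proof (rule integral_le[OF integrable_integrand])
    show "(\<lambda>_::real. \<rho> powr - (M + 2 * real k)) integrable_on {0..1}"
      by (intro integrable_continuous_interval continuous_intros)
    fix t :: real assume t: "t \<in> {0..1}"
    have "(t powr e) powr (M + real k) * (t powr e + \<rho>) powr - (M + 2 * real k) \<le> 1 * \<rho> powr - (M + 2 * real k)"
      using M \<rho> z_le_1[OF t] by (intro mult_mono powr_le1 powr_mono2') auto
    then show "(t powr e) powr (M + real k) * (t powr e + \<rho>) powr - (M + 2 * real k) \<le> \<rho> powr - (M + 2 * real k)"
      by simp
  qed (use M \<rho> in auto)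
  then show ?thesis by simp
qed

text \<open>
  It suffices to integrate over \<open>r/2 \<le> t \<le> r\<close> with \<open>r\<^sup>e = \<rho>\<close>, where \<open>z\<close> is comparable to \<open>\<rho>\<close>.
\<close>

lemma power_mixture_lower:
  assumes \<rho>: "0 < \<rho>" "\<rho> \<le> 1"
  shows "2 powr (- e * (M + real k) - (M + 2 * real k) - 1) * \<rho> powr (1 / e - real k) \<le> mixed_power (M + real k) (M + 2 * real k) \<rho>"
proof -
  define r where "r = \<rho> powr (1 / e)"
  have r: "r > 0" "r \<le> 1" "r powr e = \<rho>" using \<rho> e by (auto simp: r_def powr_powr intro!: powr_le1)
  let ?f = "\<lambda>t. (t powr e) powr (M + real k) * (t powr e + \<rho>) powr - (M + 2 * real k)"
  let ?m = "2 powr (- e * (M + real k) - (M + 2 * real k)) * \<rho> powr - real k"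
  have f: "?f integrable_on {0..1}" using M \<rho> by (intro integrable_integrand) auto
  have fr: "?f integrable_on {r / 2..r}"
    by (rule integrable_subinterval_real[OF f]) (use r in auto)
  have "2 powr (- e * (M + real k) - (M + 2 * real k) - 1) * \<rho> powr (1 / e - real k) = ?m * (r / 2)"
    by (simp add: r_def powr_diff powr_minus_divide)
  also have "\<dots> = integral {r / 2..r} (\<lambda>_. ?m)" using r by simp
  also have "\<dots> \<le> integral {r / 2..r} ?f"
  proof (rule integral_le[OF _ fr])
    show "(\<lambda>_. ?m) integrable_on {r / 2..r}" by (intro integrable_continuous_interval continuous_intros)
    fix t assume t: "t \<in> {r / 2..r}"
    have "(r / 2) powr e \<le> t powr e" "t powr e \<le> r powr e" using t r e by (auto intro!: powr_mono2)
    then have z: "2 powr - e * \<rho> \<le> t powr e" "t powr e \<le> \<rho>" using r by (auto simp: powr_divide powr_minus_divide)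
    have "?m = (2 powr - e * \<rho>) powr (M + real k) * (2 * \<rho>) powr - (M + 2 * real k)"
    proof -
      have "(2 powr - e * \<rho>) powr (M + real k) * (2 * \<rho>) powr - (M + 2 * real k) =
        (2 powr (- e * (M + real k)) * 2 powr - (M + 2 * real k)) * (\<rho> powr (M + real k) * \<rho> powr - (M + 2 * real k))"
        using \<rho> by (simp add: powr_mult powr_powr mult_ac)
      also have "\<dots> = 2 powr (- e * (M + real k) + - (M + 2 * real k)) * \<rho> powr ((M + real k) + - (M + 2 * real k))"
        by (simp only: powr_add)
      also have "(M + real k) + - (M + 2 * real k) = - real k" by simp
      also have "- e * (M + real k) + - (M + 2 * real k) = - e * (M + real k) - (M + 2 * real k)"
        by (rule add_uminus_conv_diff)
      finally show ?thesis ..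
    qed
    also have "\<dots> \<le> ?f t"
      using z \<rho> M t r by (intro mult_mono powr_mono2 powr_mono2') (auto intro!: add_pos_pos)
    finally show "?m \<le> ?f t" .
  qed
  also have "\<dots> \<le> integral {0..1} ?f"
    using r by (intro integral_subset_le[OF _ fr f]) auto
  finally show ?thesis by (simp add: mixed_power_def)
qed

end

text \<open>
  The superposition with \<open>N = M = n/2 - k\<close> and \<open>z = t\<^sup>e\<close>: the formula for \<open>(-\<Delta>)\<^sup>k\<close> has a single,
  positive term, which for \<open>e = 2 / (2k - \<sigma>)\<close> behaves like \<open>|x|\<^bsup>-\<sigma>\<^esup>\<close> at the origin. This covers all
  \<open>\<sigma> \<in> (0, 2k)\<close> at once, whereas \<open>(-\<Delta>)\<^sup>k\<close> of the pure power \<open>|x|\<^bsup>2k - \<sigma>\<^esup>\<close> has a sign depending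
  on \<open>\<sigma>\<close> and vanishes for even integers \<open>\<sigma>\<close>.
\<close>

lemma singular_profile:
  fixes \<sigma> :: real and k :: nat
  defines "M \<equiv> real DIM('a::euclidean_space) / 2 - real k"
  assumes \<sigma>: "0 < \<sigma>" "\<sigma> < 2 * real k" and M: "M > 0"
  obtains U :: "'a::euclidean_space \<Rightarrow> real" and A B where "continuous_on UNIV U" "C_on (2 * k) (- {0}) U"
    "\<And>x. 0 \<le> U x" "\<And>x. U x \<le> (1 + x \<bullet> x) powr - M" "A > 0" "B > 0"
    "\<And>x. x \<noteq> 0 \<Longrightarrow> 0 \<le> neg_laplacian_pow k U x"
    "\<And>x. x \<noteq> 0 \<Longrightarrow> x \<bullet> x \<le> 1 \<Longrightarrow> A * (x \<bullet> x) powr - (\<sigma> / 2) \<le> neg_laplacian_pow k U x"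
    "\<And>x. x \<noteq> 0 \<Longrightarrow> neg_laplacian_pow k U x \<le> B * (x \<bullet> x) powr - (\<sigma> / 2)"
    "\<And>x. x \<noteq> 0 \<Longrightarrow> neg_laplacian_pow k U x \<le> B * (x \<bullet> x) powr - (M + 2 * real k)"
proof -
  define e where "e = 2 / (2 * real k - \<sigma>)"
  have e: "e > 0" using \<sigma> by (simp add: e_def)
  have ek: "e * real k > 1" using \<sigma> by (simp add: e_def field_simps)
  have e': "1 / e - real k = - (\<sigma> / 2)" using \<sigma> by (simp add: e_def field_simps)
  interpret mixture "\<lambda>t. t powr e" by (rule power_mixture[OF e])
  define U where "U x = mixed_power M M (x \<bullet> x)" for x :: 'a
  define a where "a = radial_coeff (real DIM('a) / 2) k 0 M"
  have a: "a > 0" using M by (simp add: a_def radial_coeff_def pochhammer_pos)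
  have L: "neg_laplacian_pow k U x = a * mixed_power (M + real k) (M + 2 * real k) (x \<bullet> x)" if "x \<noteq> 0" for x
  proof -
    have "radial_coeff (real DIM('a) / 2) k j M = 0" if "j > 0" for j
      using that by (simp add: radial_coeff_def M_def pochhammer_0_left)
    then have "(\<Sum>j\<in>{..k} - {0}. radial_coeff (real DIM('a) / 2) k j M *
        mixed_power (M + real k - real j) (M + 2 * real k - real j) (x \<bullet> x)) = 0"
      by (intro sum.neutral) auto
    then show ?thesis
      unfolding U_def[abs_def] neg_laplacian_pow_mixed_power[OF M that] by (subst sum.remove[of _ 0]) (simp_all add: a_def)
  qed
  define A where "A = a * 2 powr (- e * (M + real k) - (M + 2 * real k) - 1)"
  define B where "B = a * max 1 (2 powr (e * real k) / (e * real k - 1))"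
  have Bpos: "B > 0" using a by (simp add: B_def)
  show thesis
  proof (rule that[of U A B])
    show "continuous_on UNIV U"
      unfolding U_def by (rule continuous_on_compose2[OF continuous_power_mixture[OF e M]])
        (auto intro!: continuous_intros)
    show "C_on (2 * k) (- {0}) U" unfolding U_def[abs_def] by (rule C_on_mixed_power[OF M])
    show "0 \<le> U x" "U x \<le> (1 + x \<bullet> x) powr - M" for x
      unfolding U_def using mixed_power_nonneg power_mixture_le[OF e M, of "x \<bullet> x"] by auto
    show "A > 0" "B > 0" using a Bpos by (auto simp: A_def)
    fix x :: 'a assume x: "x \<noteq> 0"
    then have pos: "x \<bullet> x > 0" by simp
    show "0 \<le> neg_laplacian_pow k U x" using a mixed_power_nonneg L[OF x] by simp
    show "A * (x \<bullet> x) powr - (\<sigma> / 2) \<le> neg_laplacian_pow k U x" if "x \<bullet> x \<le> 1"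
      using mult_left_mono[OF power_mixture_lower[OF e M pos that, of k], of a] a
      by (simp add: L[OF x] A_def e' mult.assoc)
    have "mixed_power (M + real k) (M + 2 * real k) (x \<bullet> x) \<le> max 1 (2 powr (e * real k) / (e * real k - 1)) * (x \<bullet> x) powr - (\<sigma> / 2)"
      using power_mixture_upper[OF e M ek pos] unfolding e'
      by (rule order_trans) (intro mult_right_mono, auto)
    from mult_left_mono[OF this, of a] show "neg_laplacian_pow k U x \<le> B * (x \<bullet> x) powr - (\<sigma> / 2)"
      using a by (simp add: L[OF x] B_def mult.assoc)
    have "mixed_power (M + real k) (M + 2 * real k) (x \<bullet> x) \<le> max 1 (2 powr (e * real k) / (e * real k - 1)) * (x \<bullet> x) powr - (M + 2 * real k)"
      using power_mixture_far[OF e M pos, of k]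
        mult_right_mono[of 1 "max 1 (2 powr (e * real k) / (e * real k - 1))" "(x \<bullet> x) powr - (M + 2 * real k)"]
      by simp
    from mult_left_mono[OF this, of a] show "neg_laplacian_pow k U x \<le> B * (x \<bullet> x) powr - (M + 2 * real k)"
      using a by (simp add: L[OF x] B_def mult.assoc)
  qed
qed

text \<open>
  The right-hand side \<open>|x|\<^bsup>-\<sigma>\<^esup> v\<^sup>q\<close> for \<open>v\<close> comparable to \<open>(1 + |x|\<^sup>2)\<^bsup>-t\<^esup>\<close> and \<open>q t = s + k - \<sigma>/2\<close>.
\<close>

definition source_profile :: "nat \<Rightarrow> real \<Rightarrow> real \<Rightarrow> 'a::euclidean_space \<Rightarrow> real" where
  "source_profile k \<sigma> s x = norm x powr - \<sigma> * (1 + x \<bullet> x) powr (\<sigma> / 2 - s - real k)"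

text \<open>
  The singular profile dictates the behaviour of \<open>(-\<Delta>)\<^sup>k U\<close> for \<open>|x| \<le> 1\<close> and the regular one for \<open>|x| \<ge> 1\<close>; in
  either region the other one is nonnegative and at most of the same order.
\<close>

lemma profile_exists:
  fixes \<sigma> s :: real
  assumes \<sigma>: "0 \<le> \<sigma>" "\<sigma> < 2 * real k" and s: "s > 0" "s + real k < real DIM('a) / 2"
  obtains U :: "'a::euclidean_space \<Rightarrow> real" and d D where "continuous_on UNIV U" "C_on (2 * k) (- {0}) U"
    "\<And>x. (1 + x \<bullet> x) powr - s \<le> U x" "\<And>x. U x \<le> 2 * (1 + x \<bullet> x) powr - s" "d > 0" "D > 0"
    "\<And>x. x \<noteq> 0 \<Longrightarrow> d * source_profile k \<sigma> s x \<le> neg_laplacian_pow k U x"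
    "\<And>x. x \<noteq> 0 \<Longrightarrow> neg_laplacian_pow k U x \<le> D * source_profile k \<sigma> s x"
proof -
  define M where "M = real DIM('a) / 2 - real k"
  have M: "M > 0" "s < M" using s by (auto simp: M_def)
  define U1 :: "'a \<Rightarrow> real" where "U1 x = (1 + x \<bullet> x) powr - s" for x
  have pos: "1 + x \<bullet> x > 0" for x :: 'a by (simp add: add_pos_nonneg)
  have ne: "1 + x \<bullet> x \<noteq> 0" for x :: 'a using pos[of x] by simp
  have cU1: "continuous_on UNIV U1" unfolding U1_def by (intro continuous_intros) (use ne in auto)
  have CU1: "C_on (2 * k) (- {0}) U1"
    using regular_profile(1)[OF s, of "2 * k"] by (simp add: U1_def[abs_def])
  obtain A1 B1 where A1: "A1 > 0" "B1 > 0"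
    "\<And>x. x \<noteq> 0 \<Longrightarrow> A1 * (1 + x \<bullet> x) powr - (s + real k) \<le> neg_laplacian_pow k U1 x"
    "\<And>x. x \<noteq> 0 \<Longrightarrow> neg_laplacian_pow k U1 x \<le> B1 * (1 + x \<bullet> x) powr - (s + real k)"
    using regular_profile(2)[OF s] unfolding U1_def[abs_def] by blast
  show thesis
  proof (cases "\<sigma> = 0")
    case True
    then have "source_profile k \<sigma> s x = (1 + x \<bullet> x) powr - (s + real k)" if "x \<noteq> 0" for x :: 'a
      using that by (simp add: source_profile_def algebra_simps)
    then show thesis using cU1 CU1 A1 by (intro that[of U1 A1 B1]) (auto simp: U1_def)
  next
    case False
    then have "\<sigma> > 0" using \<sigma> by simp
    from singular_profile[OF this \<sigma>(2) M(1)[unfolded M_def]]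
    obtain U2 :: "'a \<Rightarrow> real" and A2 B2 where U2: "continuous_on UNIV U2" "C_on (2 * k) (- {0}) U2"
      "\<And>x. 0 \<le> U2 x" "\<And>x. U2 x \<le> (1 + x \<bullet> x) powr - M" "A2 > 0" "B2 > 0"
      "\<And>x. x \<noteq> 0 \<Longrightarrow> 0 \<le> neg_laplacian_pow k U2 x"
      "\<And>x. x \<noteq> 0 \<Longrightarrow> x \<bullet> x \<le> 1 \<Longrightarrow> A2 * (x \<bullet> x) powr - (\<sigma> / 2) \<le> neg_laplacian_pow k U2 x"
      "\<And>x. x \<noteq> 0 \<Longrightarrow> neg_laplacian_pow k U2 x \<le> B2 * (x \<bullet> x) powr - (\<sigma> / 2)"
      "\<And>x. x \<noteq> 0 \<Longrightarrow> neg_laplacian_pow k U2 x \<le> B2 * (x \<bullet> x) powr - (M + 2 * real k)"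
      unfolding M_def by blast
    define U where "U x = U1 x + U2 x" for x
    \<comment> \<open>The minimum of the second factor of \<open>source_profile\<close> on \<open>|x| \<le> 1\<close>.\<close>
    define \<tau> where "\<tau> = (2::real) powr (\<sigma> / 2 - s - real k)"
    define d where "d = min A2 (A1 / 2 powr (\<sigma> / 2))"
    define D where "D = B1 + B2 / \<tau> + B2 * 2 powr (s + real k)"
    have dD: "d > 0" "D > 0" "\<tau> > 0" using A1 U2 by (auto simp: d_def D_def \<tau>_def add_pos_pos)
    have oc: "open (- {0 :: 'a})" by (simp add: open_Compl)
    have L: "neg_laplacian_pow k U x = neg_laplacian_pow k U1 x + neg_laplacian_pow k U2 x" if "x \<noteq> 0" for x
      unfolding U_def[abs_def] using that by (intro neg_laplacian_pow_add[OF oc _ CU1 U2(2)]) auto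
    have bounds: "d * source_profile k \<sigma> s x \<le> neg_laplacian_pow k U x \<and>
      neg_laplacian_pow k U x \<le> D * source_profile k \<sigma> s x" if x: "x \<noteq> 0" for x
    proof -
      define r where "r = x \<bullet> x"
      have r: "r > 0" using x by (simp add: r_def)
      define P where "P = (1 + r) powr - (s + real k)"
      define R where "R = r powr - (\<sigma> / 2)"
      define T where "T = (1 + r) powr (\<sigma> / 2 - s - real k)"
      define f1 where "f1 = neg_laplacian_pow k U1 x"
      define f2 where "f2 = neg_laplacian_pow k U2 x"
      have \<Phi>: "source_profile k \<sigma> s x = R * T"
        using r by (simp add: source_profile_def R_def T_def r_def norm_eq_sqrt_inner powr_powr flip: powr_half_sqrt)
      have nn: "P \<ge> 0" "R \<ge> 0" "T \<ge> 0" by (auto simp: P_def R_def T_def)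
      have P: "P = (1 + r) powr - (\<sigma> / 2) * T" using r by (simp add: P_def T_def flip: powr_add)
      have "(1 + r) powr - (\<sigma> / 2) \<le> R" unfolding R_def using r \<sigma> by (intro powr_mono2') auto
      then have PR: "P \<le> R * T" unfolding P using nn by (intro mult_right_mono)
      have f1: "A1 * P \<le> f1" "f1 \<le> B1 * P" using A1(3,4)[OF x] by (auto simp: f1_def P_def r_def)
      have f2: "0 \<le> f2" "r \<le> 1 \<Longrightarrow> A2 * R \<le> f2" "f2 \<le> B2 * R" "f2 \<le> B2 * r powr - (M + 2 * real k)"
        using U2(7-10)[OF x] by (auto simp: f2_def R_def r_def)
      have up1: "f1 \<le> B1 * (R * T)" using f1(2) mult_left_mono[OF PR, of B1] A1 by linarith
      have f1n: "0 \<le> f1" using f1(1) nn A1 by (meson mult_nonneg_nonneg less_imp_le order_trans)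
      have D0: "0 \<le> B2 / \<tau> * (R * T)" "0 \<le> B2 * 2 powr (s + real k) * (R * T)"
        using U2 dD nn by auto
      have DD: "D * (R * T) = B1 * (R * T) + B2 / \<tau> * (R * T) + B2 * 2 powr (s + real k) * (R * T)"
        by (simp add: D_def distrib_right)
      show ?thesis
      proof (cases "r \<le> 1")
        case True
        have ex: "\<sigma> / 2 - s - real k \<le> 0" using \<sigma> s by simp
        have T: "\<tau> \<le> T" "T \<le> 1"
          unfolding \<tau>_def T_def using r True ex powr_mono2'[OF ex, of 1 "1 + r"] by (auto intro!: powr_mono2')
        have "f2 \<le> B2 / \<tau> * (R * T)"
        proof -
          have "B2 * R \<le> B2 / \<tau> * (R * T)"
            using mult_left_mono[OF T(1), of "B2 / \<tau> * R"] U2(6) dD nn by (simp add: mult_ac)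
          then show ?thesis using f2(3) by linarith
        qed
        then have "f1 + f2 \<le> D * (R * T)" using up1 D0 DD by linarith
        moreover have "d * (R * T) \<le> A2 * R"
          using T nn dD by (intro mult_mono) (auto simp: d_def mult_left_le)
        ultimately show ?thesis using f2(2)[OF True] f1n by (simp add: \<Phi> L[OF x] f1_def f2_def)
      next
        case False
        then have r1: "r \<ge> 1" by simp
        have half: "((1 + r) / 2) powr - m = 2 powr m * (1 + r) powr - m" for m
          using r by (simp add: powr_divide powr_minus_divide)
        have "r powr - (M + 2 * real k) \<le> r powr - (s + real k)" using r1 M by (intro powr_mono) auto
        also have "\<dots> \<le> ((1 + r) / 2) powr - (s + real k)" using r1 s by (intro powr_mono2') auto
        also have "\<dots> = 2 powr (s + real k) * P"
          unfolding P_def using half[of "s + real k"] .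
        also have "\<dots> \<le> 2 powr (s + real k) * (R * T)" using PR by (intro mult_left_mono) auto
        finally have "B2 * r powr - (M + 2 * real k) \<le> B2 * (2 powr (s + real k) * (R * T))"
          using U2(6) by (intro mult_left_mono) auto
        then have "f1 + f2 \<le> D * (R * T)" using up1 f2(4) D0 DD by (simp add: mult.assoc)
        moreover have "R \<le> ((1 + r) / 2) powr - (\<sigma> / 2)"
          unfolding R_def using r1 \<sigma> by (intro powr_mono2') auto
        then have "R \<le> 2 powr (\<sigma> / 2) * (1 + r) powr - (\<sigma> / 2)"
          unfolding half .
        then have "R * T \<le> 2 powr (\<sigma> / 2) * P"
          unfolding P mult.assoc[symmetric] using nn by (intro mult_right_mono)
        then have "A1 / 2 powr (\<sigma> / 2) * (R * T) \<le> A1 * P"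
          using mult_left_mono[of "R * T" "2 powr (\<sigma> / 2) * P" "A1 / 2 powr (\<sigma> / 2)"] A1 by simp
        moreover have "d * (R * T) \<le> A1 / 2 powr (\<sigma> / 2) * (R * T)"
          using nn by (intro mult_right_mono) (auto simp: d_def)
        ultimately show ?thesis using f1(1) f2(1) by (simp add: \<Phi> L[OF x] f1_def f2_def)
      qed
    qed
    show thesis
    proof (rule that[of U d D])
      show "continuous_on UNIV U" unfolding U_def by (intro continuous_intros cU1 U2)
      show "C_on (2 * k) (- {0}) U" unfolding U_def[abs_def] by (intro C_on_add oc CU1 U2)
      show "(1 + x \<bullet> x) powr - s \<le> U x" for x using U2(3)[of x] by (simp add: U_def U1_def)
      have "(1 + x \<bullet> x) powr - M \<le> (1 + x \<bullet> x) powr - s" for x :: 'a using M by (intro powr_mono) auto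
      then show "U x \<le> 2 * (1 + x \<bullet> x) powr - s" for x
        using order_trans[OF U2(4)[of x]] by (simp add: U_def U1_def)
    qed (use dD bounds in auto)
  qed
qed

text \<open>
  The quotient of two functions that are both comparable to \<open>source_profile\<close>.
\<close>

lemma coefficient_exists:
  fixes L V :: "'a::euclidean_space \<Rightarrow> real"
  assumes q: "q > 1" and qt: "q * t = s + real k - \<sigma> / 2" and d: "d > 0" "D > 0"
    and V: "\<And>x. (1 + x \<bullet> x) powr - t \<le> V x" "\<And>x. V x \<le> 2 * (1 + x \<bullet> x) powr - t"
    and L: "\<And>x. x \<noteq> 0 \<Longrightarrow> d * source_profile k \<sigma> s x \<le> L x"
      "\<And>x. x \<noteq> 0 \<Longrightarrow> L x \<le> D * source_profile k \<sigma> s x"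
  obtains c where "double_bounded c" "\<And>x. x \<noteq> 0 \<Longrightarrow> L x = c x * (V x powr q / norm x powr \<sigma>)"
proof -
  let ?W = "\<lambda>x. V x powr q / norm x powr \<sigma>"
  \<comment> \<open>Double boundedness extends to the origin, where the equation says nothing: any positive value will do there.\<close>
  define c where "c x = (if x = 0 then 1 else L x / ?W x)" for x
  have W: "source_profile k \<sigma> s x \<le> ?W x" "?W x \<le> 2 powr q * source_profile k \<sigma> s x"
    "0 < source_profile k \<sigma> s x" if x: "x \<noteq> 0" for x
  proof -
    have pos: "1 + x \<bullet> x > 0" by (simp add: add_pos_nonneg)
    have T: "((1 + x \<bullet> x) powr - t) powr q = (1 + x \<bullet> x) powr (\<sigma> / 2 - s - real k)"
      using qt by (simp add: powr_powr mult.commute diff_diff_eq)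
    have V0: "0 \<le> V x" using V(1)[of x] order_trans[OF powr_ge_zero] by blast
    have "((1 + x \<bullet> x) powr - t) powr q \<le> V x powr q" using V(1) q by (intro powr_mono2) auto
    then have 1: "(1 + x \<bullet> x) powr (\<sigma> / 2 - s - real k) \<le> V x powr q" unfolding T .
    have "V x powr q \<le> (2 * (1 + x \<bullet> x) powr - t) powr q" using V(2) V0 q by (intro powr_mono2) auto
    also have "\<dots> = 2 powr q * (1 + x \<bullet> x) powr (\<sigma> / 2 - s - real k)" using pos by (simp add: powr_mult T)
    finally have 2: "V x powr q \<le> 2 powr q * (1 + x \<bullet> x) powr (\<sigma> / 2 - s - real k)" .
    show "source_profile k \<sigma> s x \<le> ?W x" "?W x \<le> 2 powr q * source_profile k \<sigma> s x"
      using divide_right_mono[OF 1, of "norm x powr \<sigma>"] divide_right_mono[OF 2, of "norm x powr \<sigma>"]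
      by (simp_all add: source_profile_def powr_minus_divide)
    show "0 < source_profile k \<sigma> s x" using pos x by (simp add: source_profile_def)
  qed
  have c: "d / 2 powr q \<le> c x" "c x \<le> D" if x: "x \<noteq> 0" for x
  proof -
    have w: "?W x > 0" using W[OF x] by linarith
    have "d / 2 powr q * ?W x \<le> d / 2 powr q * (2 powr q * source_profile k \<sigma> s x)"
      using W(2)[OF x] d by (intro mult_left_mono) auto
    also have "\<dots> \<le> L x" using L(1)[OF x] by simp
    finally show "d / 2 powr q \<le> c x" unfolding c_def using w x by (simp only: if_False pos_le_divide_eq)
    have "L x \<le> D * ?W x" using L(2)[OF x] mult_left_mono[OF W(1)[OF x], of D] d by linarith
    then show "c x \<le> D" unfolding c_def using w x by (simp only: if_False pos_divide_le_eq)
  qed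
  define C where "C = max 1 (max D (2 powr q / d))"
  have C: "C \<ge> 1" "C \<ge> D" "C \<ge> 2 powr q / d" by (auto simp: C_def)
  have "1 / C \<le> d / 2 powr q"
    using C d by (simp add: field_simps)
  then have "1 / C \<le> c x \<and> c x \<le> C" for x
    using c[of x] C by (cases "x = 0") (auto simp: c_def intro: order_trans)
  then have "double_bounded c" unfolding double_bounded_def using C by (intro exI[of _ C]) auto
  moreover have "L x = c x * ?W x" if "x \<noteq> 0" for x
  proof -
    have "?W x \<noteq> 0" using W[OF that] by linarith
    moreover have "y / w * w = y" if "w \<noteq> 0" for y w :: real using that by simp
    ultimately have "L x / ?W x * ?W x = L x" by blast
    then show ?thesis using that by (simp only: c_def if_False)
  qed
  ultimately show thesis by (rule that)
qed

text \<open>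
  With \<open>2s\<close> and \<open>2t\<close> the two terms of the maximum, the decay rates \<open>s\<close> and \<open>t\<close> of the profiles (in \<open>|x|\<^sup>2\<close>) satisfy
  \<open>q t = s + k - \<sigma>1/2\<close> and \<open>p s = t + k - \<sigma>2/2\<close>, and the hypothesis says that both lie below \<open>n/2 - k\<close>.
\<close>

lemma subcritical_imp_positive_solution:
  fixes p q \<sigma>\<^sub>1 \<sigma>\<^sub>2 :: real and k :: nat
  assumes p: "p > 1" and q: "q > 1" and \<sigma>: "0 \<le> \<sigma>\<^sub>1" "\<sigma>\<^sub>1 < 2 * real k" "0 \<le> \<sigma>\<^sub>2" "\<sigma>\<^sub>2 < 2 * real k"
    and sub: "max ((2 * real k * (q + 1) - (\<sigma>\<^sub>1 + \<sigma>\<^sub>2 * q)) / (p * q - 1))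
             ((2 * real k * (p + 1) - (\<sigma>\<^sub>2 + \<sigma>\<^sub>1 * p)) / (p * q - 1))
           < real DIM('a) - 2 * real k"
  shows "\<exists>(c\<^sub>1 :: 'a::euclidean_space \<Rightarrow> real) c\<^sub>2 u v. double_bounded c\<^sub>1 \<and> double_bounded c\<^sub>2 \<and>
            positive_solution k p q \<sigma>\<^sub>1 \<sigma>\<^sub>2 c\<^sub>1 c\<^sub>2 u v"
proof -
  have "1 * 1 < p * q" using p q by (intro mult_strict_mono) auto
  then have pq: "p * q - 1 > 0" by simp
  define s where "s = (2 * real k * (q + 1) - (\<sigma>\<^sub>1 + \<sigma>\<^sub>2 * q)) / (p * q - 1) / 2"
  define t where "t = (2 * real k * (p + 1) - (\<sigma>\<^sub>2 + \<sigma>\<^sub>1 * p)) / (p * q - 1) / 2"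
  have twice_half: "2 * (y / 2) = y" for y :: real by simp
  have st: "2 * s = (2 * real k * (q + 1) - (\<sigma>\<^sub>1 + \<sigma>\<^sub>2 * q)) / (p * q - 1)"
    "2 * t = (2 * real k * (p + 1) - (\<sigma>\<^sub>2 + \<sigma>\<^sub>1 * p)) / (p * q - 1)"
    unfolding s_def t_def by (rule twice_half)+
  have sn: "s + real k < real DIM('a) / 2" and tn: "t + real k < real DIM('a) / 2"
  proof -
    have "2 * s < real DIM('a) - 2 * real k" "2 * t < real DIM('a) - 2 * real k"
      using sub unfolding st max_less_iff_conj by blast+
    then show "s + real k < real DIM('a) / 2" "t + real k < real DIM('a) / 2" by simp_all
  qed
  have "\<sigma>\<^sub>2 * q < 2 * real k * q" "\<sigma>\<^sub>1 * p < 2 * real k * p" using p q \<sigma> by auto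
  then have s: "s > 0" and t: "t > 0"
    unfolding s_def t_def using \<sigma> pq by (auto simp: distrib_left intro!: divide_pos_pos)
  have qt: "q * t = s + real k - \<sigma>\<^sub>1 / 2" and ps: "p * s = t + real k - \<sigma>\<^sub>2 / 2"
    using pq by (simp_all add: s_def t_def field_simps)
  obtain u :: "'a \<Rightarrow> real" and d1 D1 where u: "continuous_on UNIV u" "C_on (2 * k) (- {0}) u"
    "\<And>x. (1 + x \<bullet> x) powr - s \<le> u x" "\<And>x. u x \<le> 2 * (1 + x \<bullet> x) powr - s" "d1 > 0" "D1 > 0"
    "\<And>x. x \<noteq> 0 \<Longrightarrow> d1 * source_profile k \<sigma>\<^sub>1 s x \<le> neg_laplacian_pow k u x"
    "\<And>x. x \<noteq> 0 \<Longrightarrow> neg_laplacian_pow k u x \<le> D1 * source_profile k \<sigma>\<^sub>1 s x"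
    using profile_exists[OF \<sigma>(1,2) s sn] by blast
  obtain v :: "'a \<Rightarrow> real" and d2 D2 where v: "continuous_on UNIV v" "C_on (2 * k) (- {0}) v"
    "\<And>x. (1 + x \<bullet> x) powr - t \<le> v x" "\<And>x. v x \<le> 2 * (1 + x \<bullet> x) powr - t" "d2 > 0" "D2 > 0"
    "\<And>x. x \<noteq> 0 \<Longrightarrow> d2 * source_profile k \<sigma>\<^sub>2 t x \<le> neg_laplacian_pow k v x"
    "\<And>x. x \<noteq> 0 \<Longrightarrow> neg_laplacian_pow k v x \<le> D2 * source_profile k \<sigma>\<^sub>2 t x"
    using profile_exists[OF \<sigma>(3,4) t tn] by blast
  obtain c1 where c1: "double_bounded c1"
    "\<And>x. x \<noteq> 0 \<Longrightarrow> neg_laplacian_pow k u x = c1 x * (v x powr q / norm x powr \<sigma>\<^sub>1)"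
    using coefficient_exists[OF q qt u(5,6) v(3,4) u(7,8)] by blast
  obtain c2 where c2: "double_bounded c2"
    "\<And>x. x \<noteq> 0 \<Longrightarrow> neg_laplacian_pow k v x = c2 x * (u x powr p / norm x powr \<sigma>\<^sub>2)"
    using coefficient_exists[OF p ps v(5,6) u(3,4) v(7,8)] by blast
  have pos: "0 < (1 + x \<bullet> x) powr r" for x :: 'a and r
    using add_pos_nonneg[OF zero_less_one inner_ge_zero[of x]] by simp
  have "0 < u x" "0 < v x" for x using less_le_trans[OF pos u(3)[of x]] less_le_trans[OF pos v(3)[of x]] by auto
  then have "positive_solution k p q \<sigma>\<^sub>1 \<sigma>\<^sub>2 c1 c2 u v"
    unfolding positive_solution_def using u v c1 c2 by blast
  with c1 c2 show ?thesis by blast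
qed

theorem corollary1:
  fixes k :: nat and p q \<sigma>\<^sub>1 \<sigma>\<^sub>2 :: real
  assumes "CARD('n::finite) \<ge> 3"
    and "k \<ge> 1" and "2 * k < CARD('n)"
    and "p > 1" and "q > 1"
    and "0 \<le> \<sigma>\<^sub>1" and "\<sigma>\<^sub>1 < 2 * real k"
    and "0 \<le> \<sigma>\<^sub>2" and "\<sigma>\<^sub>2 < 2 * real k"
  shows "(\<exists>(c\<^sub>1 :: real ^ 'n \<Rightarrow> real) (c\<^sub>2 :: real ^ 'n \<Rightarrow> real) u v.
            double_bounded c\<^sub>1 \<and> double_bounded c\<^sub>2 \<and>
            positive_solution k p q \<sigma>\<^sub>1 \<sigma>\<^sub>2 c\<^sub>1 c\<^sub>2 u v) \<longleftrightarrow>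
         max ((2 * real k * (q + 1) - (\<sigma>\<^sub>1 + \<sigma>\<^sub>2 * q)) / (p * q - 1))
             ((2 * real k * (p + 1) - (\<sigma>\<^sub>2 + \<sigma>\<^sub>1 * p)) / (p * q - 1))
           < real CARD('n) - 2 * real k"
proof
  have dim: "DIM(real ^ 'n) = CARD('n)" by simp
  {
    assume "\<exists>(c\<^sub>1 :: real ^ 'n \<Rightarrow> real) (c\<^sub>2 :: real ^ 'n \<Rightarrow> real) u v.
            double_bounded c\<^sub>1 \<and> double_bounded c\<^sub>2 \<and> positive_solution k p q \<sigma>\<^sub>1 \<sigma>\<^sub>2 c\<^sub>1 c\<^sub>2 u v"
    then show "max ((2 * real k * (q + 1) - (\<sigma>\<^sub>1 + \<sigma>\<^sub>2 * q)) / (p * q - 1))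
             ((2 * real k * (p + 1) - (\<sigma>\<^sub>2 + \<sigma>\<^sub>1 * p)) / (p * q - 1))
           < real CARD('n) - 2 * real k"
      using positive_solution_imp_subcritical[where 'a="real ^ 'n", unfolded dim] assms by blast
  next
    assume "max ((2 * real k * (q + 1) - (\<sigma>\<^sub>1 + \<sigma>\<^sub>2 * q)) / (p * q - 1))
             ((2 * real k * (p + 1) - (\<sigma>\<^sub>2 + \<sigma>\<^sub>1 * p)) / (p * q - 1))
           < real CARD('n) - 2 * real k"
    then show "\<exists>(c\<^sub>1 :: real ^ 'n \<Rightarrow> real) (c\<^sub>2 :: real ^ 'n \<Rightarrow> real) u v.
            double_bounded c\<^sub>1 \<and> double_bounded c\<^sub>2 \<and> positive_solution k p q \<sigma>\<^sub>1 \<sigma>\<^sub>2 c\<^sub>1 c\<^sub>2 u v"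
      using subcritical_imp_positive_solution[where 'a="real ^ 'n", unfolded dim] assms by blast
  }
qed

end
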